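(* Let $(G,\chi_E)$ be an edge-signed map and suppose that $(med(G),C_F,\chi_V)$ is an antipodally symmetric map (realized by the antipodal function $\alpha$). Let $D(L)$ be the link diagram determined by $(med(G),C_F,\chi_V)$. Then the number of components of $D(L)$ is even if and only if $\alpha$ is color-preserving.
   Context: A map $G=(V,E,F)$ is the image of an embedding in $\mathbb S^2$ of a finite graph (loops and multiple edges allowed) whose faces (the regions of $\mathbb S^2\setminus G$) are simply connected; $F$ is the set of faces. An edge-signed map $(G,\chi_E)$ is a map with a function $\chi_E:E\to\{+,-\}$. The medial graph $med(G)$ has one vertex on each edge of $G$, two vertices being joined whenever the corresponding edges are consecutive on a face of $G$ (with multiplicity); it is a 4-regular map in $\mathbb S^2$. $C_F$ denotes the proper 2-coloring of the faces of $med(G)$ in which the black faces are those corresponding to the vertices of $G$ and the white faces those corresponding to the faces of $G$. $\chi_V$ denotes the vertex-signature of $med(G)$ induced by $\chi_E$: the vertex on edge $e$ has sign $\chi_E(e)$. Diagram determined by $(med(G),C_F,\chi_V)$: the link diagram on $\mathbb S^2$ (viewed from outside) with underlying shadow $med(G)$ in which, at a vertex of sign $+$, an observer standing in a black face at the crossing and looking towards the crossing sees the strand on their left pass over the strand on their right, and at a vertex of sign $-$ the strand on the right passes over the strand on the left. The components of $D(L)$ are the components of the link $L$ it represents, i.e. the closed curves obtained by traversing $med(G)$ going straight through at each vertex. $\alpha:\mathbb S^2\to\mathbb S^2$, $\alpha(x)=-x$, is the antipodal function. A map $H$ is antipodally symmetric (realized by $\alpha$) if it is embedded in $\mathbb S^2$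 so that $\alpha(H)=H$; then $\alpha$ permutes the vertices, edges and faces of $H$ (no condition on colors or signs is required). $\alpha$ is color-preserving (resp. color-reversing) if each pair of faces $f$ and $\alpha(f)$ of $med(G)$ have the same (resp. different) color. It is known that, for a properly 2-face-colored antipodally symmetric map, $\alpha$ is either color-preserving or color-reversing. *)

theory Defs
  imports "HOL-Complex_Analysis.Complex_Analysis"
begin

section \<open>Maps on the sphere\<close>

text \<open>
  The sphere is \<open>sphere 0 1\<close> in \<open>real^3\<close>.  A map is recorded by its set of vertices (points) and its
  set of edges, each edge being an open arc (endpoints not included); loops and
  multiple edges are possible.
\<close>

record sphere_map =
  verts :: "(real^3) set"
  edges :: "(real^3) set set"

definition support :: "sphere_map \<Rightarrow> (real^3) set" where
  "support H = verts H \<union> \<Union>(edges H)"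

definition faces :: "sphere_map \<Rightarrow> (real^3) set set" where
  "faces H = components (sphere 0 1 - support H)"

definition edge_path :: "sphere_map \<Rightarrow> (real^3) set \<Rightarrow> (real \<Rightarrow> real^3) \<Rightarrow> bool" where
  "edge_path H e g \<longleftrightarrow>
     simple_path g \<and> pathstart g \<in> verts H \<and> pathfinish g \<in> verts H \<and> g ` {0<..<1} = e"

definition is_map :: "sphere_map \<Rightarrow> bool" where
  "is_map H \<longleftrightarrow>
     finite (verts H) \<and> verts H \<noteq> {} \<and> finite (edges H) \<and>
     support H \<subseteq> sphere 0 1 \<and>
     (\<forall>e\<in>edges H. \<exists>g. edge_path H e g) \<and>
     (\<forall>e\<in>edges H. e \<inter> verts H = {}) \<and>
     (\<forall>e\<in>edges H. \<forall>e'\<in>edges H. e \<noteq> e' \<longrightarrow> e \<inter> e' = {}) \<and>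
     (\<forall>f\<in>faces H. simply_connected f)"

text \<open>The second summand counts loops (whose closure contains a single vertex) once more.\<close>

definition degree_at :: "sphere_map \<Rightarrow> real^3 \<Rightarrow> nat" where
  "degree_at H p =
     card {e \<in> edges H. p \<in> closure e} + card {e \<in> edges H. closure e \<inter> verts H = {p}}"

definition four_regular :: "sphere_map \<Rightarrow> bool" where
  "four_regular H \<longleftrightarrow> (\<forall>p\<in>verts H. degree_at H p = 4)"


section \<open>Medial maps\<close>

text \<open>
  The edge \<open>m\<close> of \<open>M\<close> cuts off a corner of \<open>G\<close>: \<open>a\<close> and \<open>b\<close> are half-edges of \<open>G\<close> (pieces of edges
  \<open>e\<close>, \<open>e'\<close> cut at the vertices \<open>x\<close>, \<open>y\<close> of \<open>M\<close>) at a common vertex \<open>v\<close> of \<open>G\<close>, and \<open>m\<close> joins \<open>x\<close> to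
  \<open>y\<close> in such a way that \<open>a\<close>, \<open>b\<close> and \<open>m\<close> bound a region \<open>T\<close> free of points of \<open>G\<close> and of \<open>M\<close>; so \<open>e\<close>
  and \<open>e'\<close> follow each other at \<open>v\<close> on the boundary of the face of \<open>G\<close> that contains \<open>T\<close>.  At a
  vertex of degree 1 one has \<open>a = b\<close> and \<open>m\<close> is a loop.
\<close>

definition cuts_corner :: "sphere_map \<Rightarrow> sphere_map \<Rightarrow> (real^3) set \<Rightarrow> bool" where
  "cuts_corner G M m \<longleftrightarrow>
     (\<exists>v\<in>verts G. \<exists>e\<in>edges G. \<exists>e'\<in>edges G. \<exists>x \<in> verts M \<inter> e. \<exists>y \<in> verts M \<inter> e'.
      \<exists>a \<in> components (e - {x}). \<exists>b \<in> components (e' - {y}).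
      \<exists>T \<in> components (sphere 0 1 - (support G \<union> support M)).
        v \<in> closure a \<and> v \<in> closure b \<and>
        closure m = m \<union> {x, y} \<and>
        closure T - T = m \<union> {x, y} \<union> a \<union> b \<union> {v})"

text \<open>
  Multiplicities: a region \<open>T\<close> as above determines both its corner of \<open>G\<close> and the edge \<open>m\<close>, so
  distinct edges of \<open>M\<close> cut off distinct corners.  As \<open>M\<close> is 4-regular with one vertex on each edge
  of \<open>G\<close>, it has \<open>2 * card (edges G)\<close> edges, which is the number of corners of \<open>G\<close>; hence every
  corner is cut off by exactly one edge of \<open>M\<close>.
\<close>

definition medial_map :: "sphere_map \<Rightarrow> sphere_map \<Rightarrow> bool" where
  "medial_map G M \<longleftrightarrow>
     is_map M \<and> four_regular M \<and>
     verts M \<subseteq> \<Union>(edges G) \<and>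
     (\<forall>e\<in>edges G. \<exists>!x. x \<in> verts M \<and> x \<in> e) \<and>
     (\<forall>m\<in>edges M. m \<inter> support G = {} \<and> cuts_corner G M m)"

datatype color = Black | White

datatype sign = Plus | Minus

definition proper_coloring :: "sphere_map \<Rightarrow> ((real^3) set \<Rightarrow> color) \<Rightarrow> bool" where
  "proper_coloring H C \<longleftrightarrow>
     (\<forall>f\<in>faces H. \<forall>f'\<in>faces H. f \<noteq> f' \<longrightarrow>
        (\<exists>e\<in>edges H. e \<subseteq> closure f \<and> e \<subseteq> closure f') \<longrightarrow> C f \<noteq> C f')"

definition medial_coloring ::
  "sphere_map \<Rightarrow> sphere_map \<Rightarrow> ((real^3) set \<Rightarrow> color) \<Rightarrow> bool" where
  "medial_coloring G M C \<longleftrightarrow>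
     proper_coloring M C \<and>
     (\<forall>f\<in>faces M. (C f = Black \<longleftrightarrow> (\<exists>v\<in>verts G. v \<in> f)) \<and>
                   (C f = White \<longleftrightarrow> (\<exists>f'\<in>faces G. f \<subseteq> f')))"

definition medial_signature ::
  "sphere_map \<Rightarrow> ((real^3) set \<Rightarrow> sign) \<Rightarrow> real^3 \<Rightarrow> sign" where
  "medial_signature G chiE x = chiE (THE e. e \<in> edges G \<and> x \<in> e)"


section \<open>Link diagrams and their components\<close>

text \<open>
  An edge-end of \<open>H\<close> at \<open>p\<close> is represented by any parametrization, starting at \<open>p\<close>, of an edge.
\<close>

definition ends_at :: "sphere_map \<Rightarrow> real^3 \<Rightarrow> (real \<Rightarrow> real^3) set" where
  "ends_at H p = {g. pathstart g = p \<and> (\<exists>e\<in>edges H. edge_path H e g)}"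

text \<open>
  Two edge-ends at \<open>p\<close> are consecutive in the cyclic order around \<open>p\<close> iff arbitrarily close to \<open>p\<close>
  there is a connected piece of the complement of the map touching both of them all the way to \<open>p\<close>.
  (The same end, parametrized twice, is consecutive to itself in this sense.)
\<close>

definition consecutive_ends ::
  "sphere_map \<Rightarrow> real^3 \<Rightarrow> (real \<Rightarrow> real^3) \<Rightarrow> (real \<Rightarrow> real^3) \<Rightarrow> bool" where
  "consecutive_ends H p g h \<longleftrightarrow>
     (\<forall>U. open U \<and> p \<in> U \<longrightarrow>
        (\<exists>W. connected W \<and> W \<subseteq> U \<inter> (sphere 0 1 - support H) \<and>
             (\<exists>d>0. g ` {0..d} \<subseteq> closure W \<and> h ` {0..d} \<subseteq> closure W)))"

text \<open>
  Going straight through a 4-valent vertex: of the four edge-ends there, one leaves by the only one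
  that is neither the end of arrival nor consecutive to it.
\<close>

definition straight :: "sphere_map \<Rightarrow> ((real^3) set \<times> (real^3) set) set" where
  "straight H = {(e, e'). e \<in> edges H \<and> e' \<in> edges H \<and>
     (\<exists>p\<in>verts H. \<exists>g h. edge_path H e g \<and> edge_path H e' h \<and>
        pathstart g = p \<and> pathstart h = p \<and> \<not> consecutive_ends H p g h)}"

text \<open>\<open>over D x\<close> is the set of the edge-ends at \<open>x\<close> that belong to the strand passing over at \<open>x\<close>.\<close>

record link_diagram =
  shadow :: sphere_map
  over :: "real^3 \<Rightarrow> (real \<Rightarrow> real^3) set"

text \<open>Each closed curve traversed by going straight is recorded as the set of edges it runs through.\<close>

definition link_components :: "link_diagram \<Rightarrow> (real^3) set set set" where
  "link_components D = edges (shadow D) // (straight (shadow D))\<^sup>*"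

text \<open>
  For a unit vector \<open>u\<close> orthogonal to \<open>x\<close>, this is the orthogonal projection onto the tangent plane at
  \<open>x\<close>, as seen from outside the sphere; it embeds the open hemisphere around \<open>x\<close>.
\<close>

definition outside_view :: "real^3 \<Rightarrow> real^3 \<Rightarrow> real^3 \<Rightarrow> complex" where
  "outside_view x u z = Complex (z \<bullet> u) (z \<bullet> (cross3 x u))"

text \<open>
  An observer standing in \<open>f\<close>, at the corner of \<open>f\<close> at \<open>x\<close> between the ends \<open>g\<close> and \<open>h\<close>, and looking
  towards \<open>x\<close> has \<open>g\<close> on the left and \<open>h\<close> on the right.  This means that a triangle of \<open>f\<close> at this
  corner is traversed counterclockwise by starting from \<open>x\<close> along \<open>g\<close>, crossing the corner from \<open>g\<close>
  to \<open>h\<close> by a path \<open>c\<close> and going back to \<open>x\<close> along \<open>h\<close>.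
\<close>

definition left_right ::
  "(real^3) set \<Rightarrow> real^3 \<Rightarrow> (real \<Rightarrow> real^3) \<Rightarrow> (real \<Rightarrow> real^3) \<Rightarrow> bool" where
  "left_right f x g h \<longleftrightarrow>
     (\<exists>u s t c. norm u = 1 \<and> u \<bullet> x = 0 \<and> 0 < s \<and> s < 1 \<and> 0 < t \<and> t < 1 \<and>
        path c \<and> pathstart c = g s \<and> pathfinish c = h t \<and>
        (let T = subpath 0 s g +++ (c +++ subpath t 0 h); P = outside_view x u \<circ> T in
           simple_path T \<and> path_image T \<subseteq> {z \<in> sphere 0 1. 0 < z \<bullet> x} \<and>
           (\<forall>z\<in>sphere 0 1. 0 < z \<bullet> x \<and> outside_view x u z \<in> inside (path_image P) \<longrightarrow>
              z \<in> f \<and> winding_number P (outside_view x u z) = 1)))"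

definition diagram_of ::
  "sphere_map \<Rightarrow> ((real^3) set \<Rightarrow> color) \<Rightarrow> (real^3 \<Rightarrow> sign) \<Rightarrow> link_diagram" where
  "diagram_of M C chiV =
     \<lparr> shadow = M,
       over = (\<lambda>x. {g \<in> ends_at M x. \<exists>f\<in>faces M. \<exists>h\<in>ends_at M x. C f = Black \<and>
                 (case chiV x of Plus \<Rightarrow> left_right f x g h | Minus \<Rightarrow> left_right f x h g)}) \<rparr>"


section \<open>Antipodal symmetry\<close>

definition antipode :: "real^3 \<Rightarrow> real^3" where
  "antipode x = - x"

definition antipodally_symmetric :: "sphere_map \<Rightarrow> bool" where
  "antipodally_symmetric H \<longleftrightarrow>
     antipode ` verts H = verts H \<and> (\<lambda>e. antipode ` e) ` edges H = edges H"

definition color_preserving :: "sphere_map \<Rightarrow> ((real^3) set \<Rightarrow> color) \<Rightarrow> bool" where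
  "color_preserving H C \<longleftrightarrow> (\<forall>f\<in>faces H. C (antipode ` f) = C f)"

end

theory Submission
  imports Defs
begin

text \<open>
  Project the sphere from a point \<open>p\<close> off the map, so that the antipodal map becomes
  \<open>z \<mapsto> - 1 / cnj z\<close> and \<open>- p\<close> becomes \<open>0\<close>.  Orient every component curve and let \<open>N z\<close> be the
  sum of the winding numbers of all of them around \<open>z\<close>.  It is an integer off the map, vanishes near
  infinity, i.e. near \<open>p\<close>, and by the Jordan curve theorem changes by \<open>1\<close> or \<open>- 1\<close> across an edge.  As
  the colors change there too, \<open>p\<close> and \<open>- p\<close> lie in faces of the same color iff \<open>N 0\<close> is even.
  Two antipodal components have the same winding number around \<open>0\<close> up to sign, and a self-antipodal
  one has odd winding number, since along half of it the argument changes by an odd multiple of \<open>pi\<close>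
  and the other half repeats this change.  So \<open>N 0\<close> has the parity of the number of components.

  That the components are closed curves at all amounts to the four edge-ends at a vertex having a
  cyclic order in which each end has exactly one opposite; this order is found by cutting a small
  disc into sectors by means of the theta-curve theorem.
\<close>

section \<open>Sectors of a disc\<close>

text \<open>Edges are merely topological arcs without tangent directions. Going straight must
  therefore be read off from which edge-ends share a region near the vertex, and the relation
  \<open>straight\<close> ranges over all parametrizations of an edge. The proof passes to finitely
  many darts, one parametrization for each edge and direction, chosen so that the antipode of a dart
  is again a dart. Reversal, antipode and the successor along a curve then become permutations of a
  finite set, with exact identities between them. These identities carry the parity argument. A
  curve never runs through an edge in both directions, so every edge contributes a single strand to
  \<open>N\<close> and the jump across it is odd. A curve that is its own antipode is shifted along
  itself by half its period. The number of components does not depend on the centre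
  \<open>p\<close>, which can be put into any face; hence one count controls the colors of all
  faces.\<close>

definition radial_arc :: "complex \<Rightarrow> real \<Rightarrow> (real \<Rightarrow> complex) \<Rightarrow> bool" where
  "radial_arc c r a \<longleftrightarrow> arc a \<and> pathstart a = c \<and> pathfinish a \<in> sphere c r \<and>
     path_image a - {pathfinish a} \<subseteq> ball c r"

text \<open>The circular arc \<beta> is existentially quantified, so the same two legs have two
  sectors. The relation is symmetric in the legs and records no orientation.\<close>

definition sector ::
  "complex \<Rightarrow> real \<Rightarrow> complex set \<Rightarrow> (real \<Rightarrow> complex) \<Rightarrow> (real \<Rightarrow> complex) \<Rightarrow> bool" where
  "sector c r S a b \<longleftrightarrow> (\<exists>\<beta>. arc \<beta> \<and> pathstart \<beta> = pathfinish a \<and> pathfinish \<beta> = pathfinish b \<and>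
     path_image \<beta> \<subseteq> sphere c r \<and> S = inside (path_image a \<union> path_image b \<union> path_image \<beta>))"

lemma radial_arc_Int_sphere:
  assumes "radial_arc c r a" "0 < r"
  shows "path_image a \<inter> sphere c r = {pathfinish a}"
  using assms pathfinish_in_path_image[of a] by (auto simp: radial_arc_def subset_iff)

lemma radial_arc_subset_cball:
  assumes "radial_arc c r a"
  shows "path_image a \<subseteq> cball c r"
  using assms by (force simp: radial_arc_def subset_iff)

lemma sector_sym: "sector c r S a b \<Longrightarrow> sector c r S b a"
  unfolding sector_def
  by (smt (verit) Un_assoc Un_commute arc_reversepath path_image_reversepath pathfinish_reversepath
      pathstart_reversepath)

text \<open>The boundary is assembled as one closed path because \<open>N_jump\<close> needs its
  winding number, not only its image.\<close>

lemma sector_boundary: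
  assumes r: "0 < r" and a: "radial_arc c r a" and b: "radial_arc c r b"
    and ab: "path_image a \<inter> path_image b = {c}"
    and \<beta>: "arc \<beta>" "pathstart \<beta> = pathfinish a" "pathfinish \<beta> = pathfinish b"
       "path_image \<beta> \<subseteq> sphere c r"
  defines "J \<equiv> (a +++ \<beta>) +++ reversepath b"
  shows "simple_path J" "pathstart J = c" "pathfinish J = c"
    "path_image J = path_image a \<union> path_image b \<union> path_image \<beta>"
proof -
  have A: "path_image a \<inter> path_image \<beta> = {pathfinish a}"
    using radial_arc_Int_sphere[OF a r] \<beta> pathstart_in_path_image[of \<beta>] by auto
  have B: "path_image b \<inter> path_image \<beta> = {pathfinish b}"
    using radial_arc_Int_sphere[OF b r] \<beta> pathfinish_in_path_image[of \<beta>] by auto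
  have a1: "arc a" "pathstart a = c" and b1: "arc b" "pathstart b = c"
    using a b by (auto simp: radial_arc_def)
  have 1: "arc (a +++ \<beta>)"
    using a1 \<beta> A by (intro arc_join) auto
  show "simple_path J"
    unfolding J_def
    using 1 a1 b1 \<beta> A B ab
    by (intro simple_path_join_loop) (auto simp: arc_reversepath path_image_join)
  show "pathstart J = c" "pathfinish J = c"
    "path_image J = path_image a \<union> path_image b \<union> path_image \<beta>"
    using a1 b1 \<beta> by (auto simp: J_def path_image_join)
qed

lemma sector_props:
  assumes r: "0 < r" and a: "radial_arc c r a" and b: "radial_arc c r b"
    and ab: "path_image a \<inter> path_image b = {c}" and S: "sector c r S a b"
  shows "open S" "connected S" "S \<subseteq> ball c r" "S \<inter> (path_image a \<union> path_image b) = {}"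
    "path_image a \<union> path_image b \<subseteq> closure S"
    "closure S \<inter> ball c r \<subseteq> S \<union> path_image a \<union> path_image b"
proof -
  obtain \<beta> where \<beta>: "arc \<beta>" "pathstart \<beta> = pathfinish a" "pathfinish \<beta> = pathfinish b"
     "path_image \<beta> \<subseteq> sphere c r"
    and S_eq: "S = inside (path_image a \<union> path_image b \<union> path_image \<beta>)"
    using S by (auto simp: sector_def)
  define J where "J = (a +++ \<beta>) +++ reversepath b"
  note J = sector_boundary[OF r a b ab \<beta>, folded J_def]
  have jo: "open (inside (path_image J))" "connected (inside (path_image J))"
     "frontier (inside (path_image J)) = path_image J"
    using Jordan_inside_outside[of J] J by auto
  have S_J: "S = inside (path_image J)" using S_eq J by simp
  show S1: "open S" "connected S" using jo S_J by auto
  have "path_image J \<subseteq> cball c r"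
    using J radial_arc_subset_cball[OF a] radial_arc_subset_cball[OF b] \<beta> by auto
  \<comment> \<open>A connected unbounded set off the curve cannot meet its inside, so the inside
    stays in the closed disc; openness then removes the circle.\<close>
  then have "(cball c r - path_image J) \<union> - cball c r = - path_image J" by blast
  moreover have "connected (- cball c r)" "\<not> bounded (- cball c r)"
    using connected_complement_bounded_convex[of "cball c r"] cobounded_imp_unbounded[of "- cball c r"]
    by auto
  ultimately have "S \<subseteq> cball c r"
    using inside_subset[of "- cball c r" "cball c r - path_image J" "path_image J"] S_J by blast
  then have "S \<subseteq> interior (cball c r)"
    using S1 by (intro interior_maximal)
  then show "S \<subseteq> ball c r" by simp
  have cl: "closure S = S \<union> path_image J"
    using jo S_J by (metis closure_Un_frontier)
  show "S \<inter> (path_image a \<union> path_image b) = {}"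
    using inside_no_overlap[of "path_image J"] J(4) S_J by blast
  show "path_image a \<union> path_image b \<subseteq> closure S" using cl J by auto
  show "closure S \<inter> ball c r \<subseteq> S \<union> path_image a \<union> path_image b"
    using cl J \<beta> by auto
qed

lemma connected_arc_minus_ends:
  fixes a :: "real \<Rightarrow> complex"
  assumes "arc a"
  shows "connected (path_image a - {pathstart a, pathfinish a})"
  using assms connected_simple_path_endless arc_imp_simple_path by blast

lemma Int_eq_singletonI: "A \<inter> S = {q} \<Longrightarrow> B \<subseteq> S \<Longrightarrow> q \<in> B \<Longrightarrow> A \<inter> B = {q}"
  by blast

lemma Int_eq_emptyI: "A \<inter> S = {q} \<Longrightarrow> B \<subseteq> S \<Longrightarrow> q \<notin> B \<Longrightarrow> A \<inter> B = {}"
  by auto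

text \<open>The leg \<open>l\<close> and the boundary of the sector form a theta curve: its middle
  arc \<open>l\<close> joins \<open>c\<close> to a point of the circular arc, which it cuts in
  two.\<close>

lemma sector_split:
  assumes r: "0 < r" and a: "radial_arc c r a" and b: "radial_arc c r b" and l: "radial_arc c r l"
    and ab: "path_image a \<inter> path_image b = {c}"
    and al: "path_image a \<inter> path_image l = {c}"
    and bl: "path_image b \<inter> path_image l = {c}"
    and S: "sector c r S a b" and meet: "path_image l \<inter> S \<noteq> {}"
  obtains S1 S2 where "sector c r S1 a l" "sector c r S2 l b" "S1 \<inter> S2 = {}"
    "S1 \<union> S2 \<union> (path_image l - {c, pathfinish l}) = S"
proof -
  obtain \<beta> where \<beta>: "arc \<beta>" "pathstart \<beta> = pathfinish a" "pathfinish \<beta> = pathfinish b"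
     "path_image \<beta> \<subseteq> sphere c r"
    and S_eq: "S = inside (path_image a \<union> path_image b \<union> path_image \<beta>)"
    using S by (auto simp: sector_def)
  define J where "J = (a +++ \<beta>) +++ reversepath b"
  note J = sector_boundary[OF r a b ab \<beta>, folded J_def]
  note pr = sector_props[OF r a b ab S]
  have a1: "arc a" "pathstart a = c" and b1: "arc b" "pathstart b = c"
     and l1: "arc l" "pathstart l = c"
    using a b l by (auto simp: radial_arc_def)
  have jo: "open (inside (path_image J))" "open (outside (path_image J))"
     "frontier (inside (path_image J)) = path_image J"
     "inside (path_image J) \<union> outside (path_image J) = - path_image J"
     "inside (path_image J) \<inter> outside (path_image J) = {}"
    using Jordan_inside_outside[of J] J by auto
  have S_J: "S = inside (path_image J)" using S_eq J by simp
  let ?l = "path_image l - {c, pathfinish l}"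
  have sphl: "path_image l \<inter> sphere c r = {pathfinish l}" by (rule radial_arc_Int_sphere[OF l r])
  have fin_ne: "pathfinish l \<noteq> c" "pathfinish a \<noteq> c" "pathfinish b \<noteq> c"
    using l a b r by (auto simp: radial_arc_def)
  have lJ: "?l \<inter> path_image J = {}"
    using al bl sphl \<beta>(4) J(4) by auto
  have lS: "?l \<subseteq> S"
  proof -
    have con: "connected ?l" using connected_arc_minus_ends[OF l1(1)] l1 by simp
    have "c \<notin> S" using pr(4) a1 pathstart_in_path_image[of a] by auto
    moreover have "pathfinish l \<notin> S"
      using pr(3) l by (auto simp: radial_arc_def)
    ultimately have "?l \<inter> S \<noteq> {}" using meet by auto
    moreover have "?l \<subseteq> inside (path_image J) \<union> outside (path_image J)"
      using jo(4) lJ by auto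
    ultimately show ?thesis
      using connectedD[OF con jo(1) jo(2)] jo(5) S_J by blast
  qed
  \<comment> \<open>The end of \<open>l\<close> is a limit of points of \<open>S\<close> outside
    \<open>S\<close>, so it lies on the boundary curve; being on neither leg, it lies on
    \<beta>.\<close>
  have "pathfinish l \<in> closure S"
  proof -
    have "path l" using l1 by (simp add: arc_imp_path)
    then have "l ` closure {0<..<1} \<subseteq> closure (l ` {0<..<1})"
      by (intro image_closure_subset) (auto simp: path_def intro: closure_subset[THEN subsetD])
    moreover have "?l = l ` {0<..<1}"
      using simple_path_endless[OF arc_imp_simple_path[OF l1(1)]] l1 by simp
    ultimately have "path_image l \<subseteq> closure ?l" by (simp add: path_image_def)
    then show ?thesis using closure_mono[OF lS] pathfinish_in_path_image by blast
  qed
  moreover have "closure S = S \<union> path_image J"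
    using jo(3) S_J by (metis closure_Un_frontier)
  moreover have nm: "pathfinish l \<notin> S" "pathfinish l \<notin> path_image a" "pathfinish l \<notin> path_image b"
    using pr(3) l al bl fin_ne pathfinish_in_path_image[of l] by (auto simp: radial_arc_def)
  ultimately have fl: "pathfinish l \<in> path_image \<beta>"
    using J(4) by auto
  then obtain t where t: "t \<in> {0..1}" "\<beta> t = pathfinish l"
    by (auto simp: path_image_def)
  have t0: "t \<noteq> 0"
    using t(2) \<beta>(2) nm(2) pathfinish_in_path_image[of a] by (metis pathstart_def)
  have t1: "t \<noteq> 1"
    using t(2) \<beta>(3) nm(3) pathfinish_in_path_image[of b] by (metis pathfinish_def)
  define \<beta>1 where "\<beta>1 = subpath 0 t \<beta>"
  define \<beta>2 where "\<beta>2 = subpath t 1 \<beta>"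
  have im\<beta>: "path_image \<beta>1 = \<beta> ` {0..t}" "path_image \<beta>2 = \<beta> ` {t..1}"
    using t by (auto simp: \<beta>1_def \<beta>2_def path_image_subpath)
  have im\<beta>': "path_image \<beta>1 \<subseteq> sphere c r" "path_image \<beta>2 \<subseteq> sphere c r"
    using t \<beta>(4) unfolding im\<beta> by (auto simp: path_image_def)
  have \<beta>1: "arc \<beta>1" "pathstart \<beta>1 = pathfinish a" "pathfinish \<beta>1 = pathfinish l"
    using t t0 \<beta> by (auto simp: \<beta>1_def pathstart_def[of \<beta>] arc_subpath_arc)
  have \<beta>2: "arc \<beta>2" "pathstart \<beta>2 = pathfinish l" "pathfinish \<beta>2 = pathfinish b"
    using t t1 \<beta> by (auto simp: \<beta>2_def pathfinish_def[of \<beta>] arc_subpath_arc)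
  have \<beta>U: "path_image \<beta>1 \<union> path_image \<beta>2 = path_image \<beta>"
  proof -
    have "{0..1} = {0..t} \<union> {t..1}" using t by auto
    then have "path_image \<beta> = \<beta> ` {0..t} \<union> \<beta> ` {t..1}"
      unfolding path_image_def by (simp only: image_Un)
    then show ?thesis unfolding im\<beta> by simp
  qed
  have \<beta>I: "path_image \<beta>1 \<inter> path_image \<beta>2 = {pathfinish l}"
  proof -
    have "inj_on \<beta> {0..1}" using \<beta> by (simp add: arc_def)
    then have "\<beta> ` {0..t} \<inter> \<beta> ` {t..1} = \<beta> ` ({0..t} \<inter> {t..1})"
      using t by (subst inj_on_image_Int[of \<beta> "{0..1}"]) auto
    also have "{0..t} \<inter> {t..1} = {t}" using t by auto
    finally show ?thesis using t by (simp add: im\<beta>)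
  qed
  have S1: "path_image a \<inter> path_image \<beta>1 = {pathfinish a}" "path_image b \<inter> path_image \<beta>1 = {}"
    "path_image b \<inter> path_image \<beta>2 = {pathfinish b}" "path_image a \<inter> path_image \<beta>2 = {}"
    "path_image l \<inter> path_image \<beta>1 = {pathfinish l}" "path_image l \<inter> path_image \<beta>2 = {pathfinish l}"
  proof -
    have sph: "path_image a \<inter> sphere c r = {pathfinish a}" "path_image b \<inter> sphere c r = {pathfinish b}"
      using radial_arc_Int_sphere[OF a r] radial_arc_Int_sphere[OF b r] by auto
    have ne: "pathfinish l \<noteq> pathfinish a" "pathfinish l \<noteq> pathfinish b"
      using nm(2,3) pathfinish_in_path_image by metis+
    have mem: "pathfinish a \<in> path_image \<beta>1" "pathfinish l \<in> path_image \<beta>1"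
       "pathfinish l \<in> path_image \<beta>2" "pathfinish b \<in> path_image \<beta>2"
      using \<beta>1(2,3) \<beta>2(2,3) pathstart_in_path_image pathfinish_in_path_image by metis+
    then have nmem: "pathfinish a \<notin> path_image \<beta>2" "pathfinish b \<notin> path_image \<beta>1"
      using \<beta>I ne by (metis IntI singletonD)+
    show "path_image a \<inter> path_image \<beta>1 = {pathfinish a}" "path_image b \<inter> path_image \<beta>1 = {}"
    "path_image b \<inter> path_image \<beta>2 = {pathfinish b}" "path_image a \<inter> path_image \<beta>2 = {}"
    "path_image l \<inter> path_image \<beta>1 = {pathfinish l}" "path_image l \<inter> path_image \<beta>2 = {pathfinish l}"
      by (simp_all only: Int_eq_singletonI[OF sph(1) im\<beta>'(1) mem(1)] Int_eq_emptyI[OF sph(2) im\<beta>'(1) nmem(2)]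
        Int_eq_singletonI[OF sph(2) im\<beta>'(2) mem(4)] Int_eq_emptyI[OF sph(1) im\<beta>'(2) nmem(1)]
        Int_eq_singletonI[OF sphl im\<beta>'(1) mem(2)] Int_eq_singletonI[OF sphl im\<beta>'(2) mem(3)])
  qed
  let ?c1 = "a +++ \<beta>1" and ?c2 = "b +++ reversepath \<beta>2"
  have im: "path_image ?c1 = path_image a \<union> path_image \<beta>1" "path_image ?c2 = path_image b \<union> path_image \<beta>2"
    using \<beta>1 \<beta>2 by (auto simp: path_image_join)
  have arcs: "arc ?c1" "arc ?c2"
    using a1 b1 \<beta>1 \<beta>2 S1 by (intro arc_join; simp add: arc_reversepath)+
  have tot: "path_image ?c1 \<union> path_image ?c2 = path_image a \<union> path_image b \<union> path_image \<beta>"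
    using im \<beta>U by auto
  obtain "inside (path_image ?c1 \<union> path_image l) \<inter> inside (path_image ?c2 \<union> path_image l) = {}"
     "inside (path_image ?c1 \<union> path_image l) \<union> inside (path_image ?c2 \<union> path_image l) \<union>
        (path_image l - {c, pathfinish l}) = inside (path_image ?c1 \<union> path_image ?c2)"
  proof (rule split_inside_simple_closed_curve[of ?c1 c "pathfinish l" ?c2 l])
    show "path_image ?c1 \<inter> path_image ?c2 = {c, pathfinish l}"
      using S1 \<beta>I ab by (simp add: im Int_Un_distrib Int_Un_distrib2 Int_commute insert_commute)
    show "path_image ?c1 \<inter> path_image l = {c, pathfinish l}"
      using S1 al by (simp add: im Int_Un_distrib Int_Un_distrib2 Int_commute insert_commute)
    show "path_image ?c2 \<inter> path_image l = {c, pathfinish l}"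
      using S1 bl by (simp add: im Int_Un_distrib Int_Un_distrib2 Int_commute insert_commute)
    show "path_image l \<inter> inside (path_image ?c1 \<union> path_image ?c2) \<noteq> {}"
      using meet S_eq tot by simp
  qed (use arcs a1 b1 l1 \<beta>1 \<beta>2 fin_ne in \<open>simp_all add: arc_imp_simple_path\<close>)
  note sp = this
  show ?thesis
  proof (rule that)
    show "sector c r (inside (path_image ?c1 \<union> path_image l)) a l"
      unfolding sector_def im using \<beta>1 im\<beta>'(1) by (intro exI[of _ \<beta>1]) (simp add: ac_simps)
    show "sector c r (inside (path_image ?c2 \<union> path_image l)) l b"
      unfolding sector_def im using \<beta>2 im\<beta>'(2) by (intro exI[of _ \<beta>2]) (simp add: ac_simps)
    show "inside (path_image ?c1 \<union> path_image l) \<inter> inside (path_image ?c2 \<union> path_image l) = {}"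
      by (rule sp(1))
    show "inside (path_image ?c1 \<union> path_image l) \<union> inside (path_image ?c2 \<union> path_image l) \<union>
       (path_image l - {c, pathfinish l}) = S"
      using sp(2) by (simp only: tot S_eq)
  qed
qed

text \<open>Here the middle arc of the theta curve is the concatenation of the two legs, and the
  outer arcs are the two pieces into which their ends cut the circle.\<close>

lemma sector_two:
  assumes r: "0 < r" and a: "radial_arc c r a" and b: "radial_arc c r b"
    and ab: "path_image a \<inter> path_image b = {c}"
  obtains S1 S2 where "sector c r S1 a b" "sector c r S2 b a" "S1 \<inter> S2 = {}"
    "S1 \<union> S2 \<union> (path_image a \<union> path_image b - {pathfinish a, pathfinish b}) = ball c r"
proof -
  have a1: "arc a" "pathstart a = c" "pathfinish a \<in> sphere c r"
    and b1: "arc b" "pathstart b = c" "pathfinish b \<in> sphere c r"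
    using a b by (auto simp: radial_arc_def)
  have fin_ne: "pathfinish a \<noteq> pathfinish b"
    using ab pathfinish_in_path_image[of a] pathfinish_in_path_image[of b] a1 r
    by (metis IntI dist_self less_irrefl mem_sphere singletonD)
  have circ: "simple_path (circlepath c r)" "pathfinish (circlepath c r) = pathstart (circlepath c r)"
     "path_image (circlepath c r) = sphere c r"
    using r by (auto simp: simple_path_circlepath)
  obtain u d where ud: "arc u" "arc d" "pathstart u = pathfinish a" "pathfinish u = pathfinish b"
       "pathstart d = pathfinish b" "pathfinish d = pathfinish a"
       "path_image u \<inter> path_image d = {pathfinish a, pathfinish b}"
       "path_image u \<union> path_image d = sphere c r"
    using exists_double_arc[OF circ(1,2), of "pathfinish a" "pathfinish b"] circ(3) a1 b1 fin_ne by metis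
  let ?l = "reversepath a +++ b"
  have imA: "path_image a \<inter> sphere c r = {pathfinish a}" and imB: "path_image b \<inter> sphere c r = {pathfinish b}"
    using radial_arc_Int_sphere[OF a r] radial_arc_Int_sphere[OF b r] by auto
  have im: "path_image ?l = path_image a \<union> path_image b"
    using a1 b1 by (simp add: path_image_join)
  have arcl: "arc ?l" using a1 b1 ab by (intro arc_join) (auto simp: arc_reversepath)
  have inb: "inside (sphere c r) = ball c r"
    using inside_frontier_eq_interior[of "cball c r"] r by auto
  have sub: "path_image u \<subseteq> sphere c r" "path_image d \<subseteq> sphere c r"
    using ud(8) by auto
  have mem: "pathfinish a \<in> path_image u" "pathfinish b \<in> path_image u"
     "pathfinish a \<in> path_image d" "pathfinish b \<in> path_image d"
    using ud(3-6) pathstart_in_path_image pathfinish_in_path_image by metis+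
  have Int_eq_circ: "path_image a \<inter> path_image u = {pathfinish a}" "path_image b \<inter> path_image u = {pathfinish b}"
     "path_image a \<inter> path_image d = {pathfinish a}" "path_image b \<inter> path_image d = {pathfinish b}"
    by (simp_all only: Int_eq_singletonI[OF imA sub(1) mem(1)] Int_eq_singletonI[OF imB sub(1) mem(2)]
        Int_eq_singletonI[OF imA sub(2) mem(3)] Int_eq_singletonI[OF imB sub(2) mem(4)])
  obtain "inside (path_image u \<union> path_image ?l) \<inter> inside (path_image (reversepath d) \<union> path_image ?l) = {}"
     "inside (path_image u \<union> path_image ?l) \<union> inside (path_image (reversepath d) \<union> path_image ?l) \<union>
        (path_image ?l - {pathfinish a, pathfinish b}) = inside (path_image u \<union> path_image (reversepath d))"
  proof (rule split_inside_simple_closed_curve[of u "pathfinish a" "pathfinish b" "reversepath d" ?l])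
    show "path_image u \<inter> path_image ?l = {pathfinish a, pathfinish b}"
      using Int_eq_circ by (simp add: im Int_Un_distrib Int_commute insert_commute)
    show "path_image (reversepath d) \<inter> path_image ?l = {pathfinish a, pathfinish b}"
      using Int_eq_circ by (simp add: im Int_Un_distrib Int_commute insert_commute)
    have "c \<in> path_image ?l" using im a1 pathstart_in_path_image[of a] by auto
    moreover have "c \<in> inside (path_image u \<union> path_image (reversepath d))" using ud inb r by simp
    ultimately show "path_image ?l \<inter> inside (path_image u \<union> path_image (reversepath d)) \<noteq> {}" by blast
  qed (use a1(1,2) b1(1,2) ud(1-7) arcl fin_ne in \<open>simp_all add: arc_imp_simple_path arc_reversepath\<close>)
  note sp = this
  show ?thesis
  proof (rule that)
    show "sector c r (inside (path_image u \<union> path_image ?l)) a b"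
      unfolding sector_def im using ud(1-4) sub by (intro exI[of _ u]) (simp add: ac_simps)
    show "sector c r (inside (path_image (reversepath d) \<union> path_image ?l)) b a"
      unfolding sector_def im using ud(2,5,6) sub by (intro exI[of _ d]) (simp add: ac_simps)
    show "inside (path_image u \<union> path_image ?l) \<inter> inside (path_image (reversepath d) \<union> path_image ?l) = {}"
      by (rule sp(1))
    show "inside (path_image u \<union> path_image ?l) \<union> inside (path_image (reversepath d) \<union> path_image ?l) \<union>
      (path_image a \<union> path_image b - {pathfinish a, pathfinish b}) = ball c r"
      using sp(2) by (simp only: im path_image_reversepath ud(8) inb)
  qed
qed

section \<open>Stars of legs and their truncation by a small disc\<close>

lemma ex_ball_avoiding:
  assumes "closed R" "c \<notin> R"
  shows "\<exists>e>0. ball c e \<inter> R = {}"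
proof -
  have "open (- R)" using assms by auto
  then obtain e where "e > 0" "ball c e \<subseteq> - R"
    using openE[of "- R" c] assms(2) by auto
  then show ?thesis by blast
qed

lemma radial_truncation:
  assumes g: "arc g" "pathstart g = c" and r: "0 < r" "r < dist c (pathfinish g)"
  shows "\<exists>t. 0 < t \<and> t < 1 \<and> radial_arc c r (subpath 0 t g)"
proof -
  have "pathstart g \<in> closure (ball c r)" "pathfinish g \<notin> ball c r"
    using g r by auto
  then obtain u where u: "0 \<le> u" "u \<le> 1" "g u \<in> frontier (ball c r)"
    "path_image (subpath 0 u g) - {g u} \<subseteq> interior (ball c r)"
    using subpath_to_frontier[OF arc_imp_path[OF g(1)]] by blast
  have gu: "g u \<in> sphere c r" using u(3) r by auto
  have "u \<noteq> 0" using gu g(2) r by (auto simp: pathstart_def)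
  moreover have "u \<noteq> 1" using gu r by (auto simp: pathfinish_def)
  ultimately have "0 < u" "u < 1" using u by auto
  moreover have "radial_arc c r (subpath 0 u g)"
    using u gu g \<open>0 < u\<close> \<open>u < 1\<close> r
    by (auto simp: radial_arc_def arc_subpath_arc pathstart_def[of g])
  ultimately show ?thesis by blast
qed

text \<open>\<open>K\<close> stands for the whole projected map and \<open>L\<close> for the legs at
  \<open>c\<close>. Only within some disc must \<open>K\<close> consist of legs, and even there a
  leg may leave a smaller disc and come back.\<close>

definition star_data ::
  "complex set \<Rightarrow> complex \<Rightarrow> (real \<Rightarrow> complex) set \<Rightarrow> bool" where
  "star_data K c L \<longleftrightarrow> closed K \<and> finite L \<and> L \<noteq> {} \<and>
     (\<forall>g\<in>L. arc g \<and> pathstart g = c \<and> path_image g \<subseteq> K) \<and>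
     (\<forall>g\<in>L. \<forall>h\<in>L. g \<noteq> h \<longrightarrow> path_image g \<inter> path_image h = {c}) \<and>
     (\<exists>\<epsilon>>0. K \<inter> ball c \<epsilon> \<subseteq> (\<Union>g\<in>L. path_image g))"

lemma connected_subset_ball:
  fixes Z :: "complex set"
  assumes "connected Z" "x \<in> Z" "x \<in> ball c r" "Z \<inter> sphere c r = {}"
  shows "Z \<subseteq> ball c r"
proof (rule ccontr)
  assume "\<not> Z \<subseteq> ball c r"
  then have "Z - ball c r \<noteq> {}" "Z \<inter> ball c r \<noteq> {}" using assms by auto
  then have "Z \<inter> frontier (ball c r) \<noteq> {}" by (intro connected_Int_frontier[OF assms(1)])
  moreover have "0 < r" using assms(3) by (metis empty_iff ball_empty not_less)
  then have "frontier (ball c r) = sphere c r" by (rule frontier_ball)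
  ultimately show False using assms(4) by auto
qed

text \<open>Two radii are needed because a leg may re-enter the disc of radius \<open>r\<close>
  after its first exit. Within \<open>r'\<close> only the truncated legs are seen, and the last
  clause says that the returning pieces do not separate points of a sector that lie this close to
  \<open>c\<close>.\<close>

definition star_cut ::
  "complex set \<Rightarrow> complex \<Rightarrow> (real \<Rightarrow> complex) set \<Rightarrow> real \<Rightarrow> real \<Rightarrow> ((real \<Rightarrow> complex) \<Rightarrow> real) \<Rightarrow> bool"
  where
  "star_cut K c L r r' t \<longleftrightarrow> 0 < r' \<and> r' < r \<and>
     (\<forall>g\<in>L. 0 < t g \<and> t g < 1 \<and> radial_arc c r (subpath 0 (t g) g)) \<and>
     K \<inter> ball c r' \<subseteq> (\<Union>g\<in>L. path_image (subpath 0 (t g) g)) \<and>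
     (\<forall>S x y. connected S \<longrightarrow> S \<subseteq> ball c r \<longrightarrow>
        S \<inter> (\<Union>g\<in>L. path_image (subpath 0 (t g) g)) = {} \<longrightarrow>
        x \<in> S \<inter> ball c r' \<longrightarrow> y \<in> S \<inter> ball c r' \<longrightarrow> connected_component (ball c r - K) x y)"

lemma star_cutD:
  assumes "star_cut K c L r r' t"
  shows "0 < r" "0 < r'" "r' < r"
    "g \<in> L \<Longrightarrow> 0 < t g" "g \<in> L \<Longrightarrow> t g < 1" "g \<in> L \<Longrightarrow> radial_arc c r (subpath 0 (t g) g)"
    "K \<inter> ball c r' \<subseteq> (\<Union>g\<in>L. path_image (subpath 0 (t g) g))"
  using assms unfolding star_cut_def by auto

lemma star_cut_connected:
  assumes "star_cut K c L r r' t" "connected S" "S \<subseteq> ball c r"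
    "S \<inter> (\<Union>g\<in>L. path_image (subpath 0 (t g) g)) = {}" "x \<in> S \<inter> ball c r'" "y \<in> S \<inter> ball c r'"
  shows "connected_component (ball c r - K) x y"
  using assms unfolding star_cut_def by blast

text \<open>The part of \<open>K\<close> beyond the first exit of the legs from the disc may return to the disc, but
  meets the star of the truncated legs only on the bounding circle; Janiszewski's theorem, applied
  with this circle as the connected intersection, shows that it does not cut sectors near \<open>c\<close>.\<close>

lemma star_local:
  assumes sd: "star_data K c L" and e0: "0 < \<epsilon>0"
  obtains r r' t where "r < \<epsilon>0" "star_cut K c L r r' t"
proof -
  have K: "closed K" and L: "finite L" "L \<noteq> {}"
    and Lg: "\<And>g. g \<in> L \<Longrightarrow> arc g \<and> pathstart g = c \<and> path_image g \<subseteq> K"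
    and dis: "\<And>g h. g \<in> L \<Longrightarrow> h \<in> L \<Longrightarrow> g \<noteq> h \<Longrightarrow> path_image g \<inter> path_image h = {c}"
    using sd by (auto simp: star_data_def)
  obtain \<epsilon> where \<epsilon>: "\<epsilon> > 0" "K \<inter> ball c \<epsilon> \<subseteq> (\<Union>g\<in>L. path_image g)"
    using sd by (auto simp: star_data_def)
  have "c \<notin> pathfinish ` L"
    using Lg arc_distinct_ends by (metis imageE)
  then obtain \<delta> where \<delta>: "\<delta> > 0" "ball c \<delta> \<inter> pathfinish ` L = {}"
    using ex_ball_avoiding[of "pathfinish ` L" c] L by (auto intro: finite_imp_closed)
  \<comment> \<open>Below \<epsilon> the set \<open>K\<close> consists of legs, and below \<delta>
    every leg ends outside the disc, so that each leg has a first exit.\<close>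
  define r where "r = min \<epsilon>0 (min \<epsilon> \<delta>) / 2"
  have r: "0 < r" "r < \<epsilon>0" "r < \<epsilon>" "r < \<delta>" using e0 \<epsilon> \<delta> by (auto simp: r_def)
  have "\<forall>g\<in>L. \<exists>t. 0 < t \<and> t < 1 \<and> radial_arc c r (subpath 0 t g)"
  proof
    fix g assume g: "g \<in> L"
    have "pathfinish g \<notin> ball c \<delta>" using \<delta>(2) g by auto
    then have "r < dist c (pathfinish g)" using r by auto
    then show "\<exists>t. 0 < t \<and> t < 1 \<and> radial_arc c r (subpath 0 t g)"
      using Lg[OF g] radial_truncation r(1) by blast
  qed
  then obtain t where t: "\<And>g. g \<in> L \<Longrightarrow> 0 < t g \<and> t g < 1 \<and> radial_arc c r (subpath 0 (t g) g)"
    by metis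
  define A where "A = (\<Union>g\<in>L. path_image (subpath 0 (t g) g))"
  define R where "R = (\<Union>g\<in>L. g ` {t g..1}) \<union> (K - ball c r)"
  have im: "path_image (subpath 0 (t g) g) = g ` {0..t g}" if "g \<in> L" for g
    using t[OF that] by (simp add: path_image_subpath)
  have inj: "inj_on g {0..1}" "g 0 = c" "continuous_on {0..1} g" if "g \<in> L" for g
    using Lg[OF that] by (auto simp: arc_def pathstart_def path_def)
  have full: "path_image g = g ` {0..t g} \<union> g ` {t g..1}" if "g \<in> L" for g
  proof -
    have "{0..1} = {0..t g} \<union> {t g..1}" using t[OF that] by auto
    then show ?thesis unfolding path_image_def by (simp only: image_Un)
  qed
  have c_notin: "c \<notin> g ` {t g..1}" if "g \<in> L" for g
  proof
    assume "c \<in> g ` {t g..1}"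
    then obtain s where s: "s \<in> {t g..1}" "c = g s" by blast
    then have "g s = g 0" using inj(2)[OF that] by simp
    then have "s = 0" using inj_onD[OF inj(1)[OF that], of s 0] t[OF that] s(1) by simp
    then show False using s t[OF that] by simp
  qed
  have "closed (g ` {t g..1})" if "g \<in> L" for g
  proof -
    have "continuous_on {t g..1} g"
      using inj(3)[OF that] t[OF that] by (auto intro: continuous_on_subset)
    then show ?thesis by (intro compact_imp_closed compact_continuous_image) auto
  qed
  then have clR: "closed R" unfolding R_def using L K by (intro closed_Un closed_UN closed_Diff) auto
  have cR: "c \<notin> R" using c_notin r by (auto simp: R_def)
  obtain \<rho> where \<rho>: "\<rho> > 0" "ball c \<rho> \<inter> R = {}" using ex_ball_avoiding[OF clR cR] by blast
  define r' where "r' = min \<rho> r / 2"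
  have r': "0 < r'" "r' < r" "ball c r' \<inter> R = {}"
  proof -
    show "0 < r'" "r' < r" using \<rho> r by (auto simp: r'_def)
    have "ball c r' \<subseteq> ball c \<rho>" using \<rho> r by (auto simp: r'_def)
    then show "ball c r' \<inter> R = {}" using \<rho> by blast
  qed
  have KAR: "K \<inter> ball c r \<subseteq> A \<union> R"
  proof
    fix x assume x: "x \<in> K \<inter> ball c r"
    then have "x \<in> ball c \<epsilon>" using r by auto
    then obtain g where g: "g \<in> L" "x \<in> path_image g" using x \<epsilon> by auto
    then show "x \<in> A \<union> R" using full[OF g(1)] im[OF g(1)] by (auto simp: A_def R_def)
  qed
  have AR: "A \<inter> R \<subseteq> sphere c r"
  proof
    fix x assume x: "x \<in> A \<inter> R"
    then obtain g where g: "g \<in> L" "x \<in> path_image (subpath 0 (t g) g)" by (auto simp: A_def)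
    from x have "x \<in> (\<Union>g\<in>L. g ` {t g..1}) \<or> x \<notin> ball c r" by (auto simp: R_def)
    then show "x \<in> sphere c r"
    proof
      assume "x \<in> (\<Union>g\<in>L. g ` {t g..1})"
      then obtain h where h: "h \<in> L" "x \<in> h ` {t h..1}" by auto
      show ?thesis
      proof (cases "h = g")
        case True
        obtain s s' where s: "s \<in> {0..t g}" "s' \<in> {t g..1}" "x = g s" "x = g s'"
          using g(2) h(2) unfolding True im[OF g(1)] by blast
        have tg: "0 < t g" "t g < 1" using t[OF g(1)] by auto
        have "s = s'" using inj_onD[OF inj(1)[OF g(1)], of s s'] tg s by simp
        then have "s = t g" using s(1,2) by simp
        then have "x = g (t g)" using s(3) by simp
        then show ?thesis using t[OF g(1)] by (auto simp: radial_arc_def)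
      next
        case False
        have "x \<in> path_image g" "x \<in> path_image h"
          using g h full[OF g(1)] full[OF h(1)] im[OF g(1)] by auto
        then have "x = c" using dis[OF h(1) g(1) False] by auto
        then show ?thesis using c_notin[OF h(1)] h by auto
      qed
    next
      assume "x \<notin> ball c r"
      moreover have "x \<in> cball c r" using radial_arc_subset_cball t[OF g(1)] g(2) by blast
      ultimately show ?thesis by auto
    qed
  qed
  have cA: "compact A" unfolding A_def
    using L t by (intro compact_UN) (auto simp: radial_arc_def intro!: compact_path_image arc_imp_path)
  have K1: "K \<inter> ball c r' \<subseteq> (\<Union>g\<in>L. path_image (subpath 0 (t g) g))"
  proof
    fix x assume "x \<in> K \<inter> ball c r'"
    then have "x \<in> A \<union> R" "x \<notin> R" using KAR r' by auto
    then show "x \<in> (\<Union>g\<in>L. path_image (subpath 0 (t g) g))" by (simp add: A_def)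
  qed
  have cc: "connected_component (ball c r - K) x y"
    if S: "connected S" "S \<subseteq> ball c r" "S \<inter> (\<Union>g\<in>L. path_image (subpath 0 (t g) g)) = {}"
      and x: "x \<in> S \<inter> ball c r'" and y: "y \<in> S \<inter> ball c r'" for S x y
  proof -
    have 1: "connected_component (- (A \<union> sphere c r)) x y"
      unfolding connected_component_def using S x y by (intro exI[of _ S]) (auto simp: A_def)
    have 2: "connected_component (- (sphere c r \<union> R)) x y"
      unfolding connected_component_def using x y r' by (intro exI[of _ "ball c r'"]) auto
    have "(A \<union> sphere c r) \<inter> (sphere c r \<union> R) = sphere c r" using AR by auto
    then have 3: "connected ((A \<union> sphere c r) \<inter> (sphere c r \<union> R))" by (simp add: connected_sphere)
    have "compact (A \<union> sphere c r)" "closed (sphere c r \<union> R)"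
      using cA clR by (auto intro: compact_Un closed_Un)
    from Janiszewski[OF this 3 1 2]
    have "connected_component (- ((A \<union> sphere c r) \<union> (sphere c r \<union> R))) x y" .
    then obtain Z where Z: "connected Z" "Z \<subseteq> - ((A \<union> sphere c r) \<union> (sphere c r \<union> R))" "x \<in> Z" "y \<in> Z"
      by (auto simp: connected_component_def)
    have "x \<in> ball c r" "Z \<inter> sphere c r = {}" using x r' Z(2) by auto
    then have "Z \<subseteq> ball c r" by (rule connected_subset_ball[OF Z(1,3)])
    then have "Z \<subseteq> ball c r - K" using KAR Z(2) by blast
    then show "connected_component (ball c r - K) x y"
      using Z by (auto simp: connected_component_def)
  qed
  have "star_cut K c L r r' t"
    unfolding star_cut_def using r' t K1 cc by blast
  then show ?thesis using that r(2) by blast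
qed

lemma truncations_Int:
  assumes sd: "star_data K c L" and gh: "g \<in> L" "h \<in> L" "g \<noteq> h"
    and t: "0 < s" "s < 1" "0 < t" "t < 1"
  shows "path_image (subpath 0 s g) \<inter> path_image (subpath 0 t h) = {c}"
proof -
  have "g 0 = c" "h 0 = c" "path_image g \<inter> path_image h = {c}"
    using sd gh unfolding star_data_def pathstart_def by metis+
  moreover have "path_image (subpath 0 s g) \<subseteq> path_image g" "path_image (subpath 0 t h) \<subseteq> path_image h"
    using t by (simp_all add: path_image_subpath_subset)
  moreover have "g 0 \<in> path_image (subpath 0 s g)" "h 0 \<in> path_image (subpath 0 t h)"
    using pathstart_in_path_image[of "subpath 0 s g"] pathstart_in_path_image[of "subpath 0 t h"] by auto
  ultimately show ?thesis by auto
qed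

text \<open>An interior point of an edge is a star with two legs, and the two sectors are the local
  sides of the edge. The last conclusion, that all of \<open>K\<close> near \<open>c\<close> lies in
  the closure of each side, later makes both adjacent faces touch the edge.\<close>

lemma two_sides:
  assumes sd: "star_data K c {a, b}" and ab: "a \<noteq> b" and e0: "0 < \<epsilon>0"
  obtains r r' s t S1 S2 where "0 < r" "r < \<epsilon>0" "0 < r'" "r' < r" "0 < s" "s < 1" "0 < t" "t < 1"
    "radial_arc c r (subpath 0 s a)" "radial_arc c r (subpath 0 t b)"
    "sector c r S1 (subpath 0 s a) (subpath 0 t b)"
    "sector c r S2 (subpath 0 s a) (subpath 0 t b)" "S1 \<inter> S2 = {}"
    "ball c r' - K \<subseteq> S1 \<union> S2"
    "\<And>S x y. S = S1 \<or> S = S2 \<Longrightarrow> x \<in> S \<inter> ball c r' \<Longrightarrow> y \<in> S \<inter> ball c r' \<Longrightarrow> connected_component (- K) x y"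
    "\<And>S. S = S1 \<or> S = S2 \<Longrightarrow> K \<inter> ball c r' \<subseteq> closure (S \<inter> ball c r')"
proof -
  obtain r r' t where r2: "r < \<epsilon>0" and cut: "star_cut K c {a, b} r r' t"
    using star_local[OF sd e0] by blast
  have t: "0 < t g \<and> t g < 1 \<and> radial_arc c r (subpath 0 (t g) g)" if "g \<in> {a,b}" for g
    using cut that unfolding star_cut_def by blast
  have r: "0 < r" "r < \<epsilon>0" "0 < r'" "r' < r"
    using cut r2 unfolding star_cut_def by auto
  have K1: "K \<inter> ball c r' \<subseteq> (\<Union>g\<in>{a,b}. path_image (subpath 0 (t g) g))"
    using cut unfolding star_cut_def by blast
  define a' where "a' = subpath 0 (t a) a"
  define b' where "b' = subpath 0 (t b) b"
  have ra: "radial_arc c r a'" and rb: "radial_arc c r b'" using t by (auto simp: a'_def b'_def)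
  have I: "path_image a' \<inter> path_image b' = {c}"
    unfolding a'_def b'_def using t ab by (intro truncations_Int[OF sd]) auto
  obtain S1 S2 where S: "sector c r S1 a' b'" "sector c r S2 b' a'" "S1 \<inter> S2 = {}"
    "S1 \<union> S2 \<union> (path_image a' \<union> path_image b' - {pathfinish a', pathfinish b'}) = ball c r"
    using sector_two[OF r(1) ra rb I] by blast
  have S2': "sector c r S2 a' b'" using S(2) by (rule sector_sym)
  have aK: "path_image a' \<subseteq> K" "path_image b' \<subseteq> K"
  proof -
    have "path_image a \<subseteq> K" "path_image b \<subseteq> K" using sd by (auto simp: star_data_def)
    then show "path_image a' \<subseteq> K" "path_image b' \<subseteq> K"
      using path_image_subpath_subset[of 0 "t a" a] path_image_subpath_subset[of 0 "t b" b] t[of a] t[of b]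
      unfolding a'_def b'_def by auto
  qed
  have un: "(\<Union>g\<in>{a,b}. path_image (subpath 0 (t g) g)) = path_image a' \<union> path_image b'"
    by (simp add: a'_def b'_def)
  have sub: "ball c r' \<subseteq> ball c r" using r by auto
  show ?thesis
  proof (rule that[of r r' "t a" "t b" S1 S2])
    show "ball c r' - K \<subseteq> S1 \<union> S2" using S(4) sub aK by blast
    show "connected_component (- K) x y"
      if SS: "S = S1 \<or> S = S2" and x: "x \<in> S \<inter> ball c r'" and y: "y \<in> S \<inter> ball c r'" for S x y
    proof -
      have sec: "sector c r S a' b'" using SS S S2' by auto
      note pr = sector_props(2,3,4)[OF r(1) ra rb I sec]
      have "S \<inter> (\<Union>g\<in>{a,b}. path_image (subpath 0 (t g) g)) = {}" using pr(3) un by simp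
      then have "connected_component (ball c r - K) x y"
        using star_cut_connected[OF cut pr(1,2)] x y by blast
      then show ?thesis by (rule connected_component_of_subset) auto
    qed
    show "K \<inter> ball c r' \<subseteq> closure (S \<inter> ball c r')" if SS: "S = S1 \<or> S = S2" for S
    proof -
      have sec: "sector c r S a' b'" using SS S S2' by auto
      have "K \<inter> ball c r' \<subseteq> ball c r' \<inter> closure S"
        using sector_props(5)[OF r(1) ra rb I sec] K1 un by blast
      then show ?thesis using open_Int_closure_subset[of "ball c r'" S] by (auto simp: Int_commute)
    qed
  qed (use r t S S2' ra rb in \<open>simp_all add: a'_def b'_def\<close>)
qed

section \<open>Cyclic order of four arcs at a point\<close>

definition three_sectors where
  "three_sectors c r f1 f2 f3 \<longleftrightarrow> (\<exists>S1 S2 S3.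
     sector c r S1 f1 f2 \<and> sector c r S2 f2 f3 \<and> sector c r S3 f3 f1 \<and>
     S1 \<inter> S2 = {} \<and> S1 \<inter> S3 = {} \<and> S2 \<inter> S3 = {} \<and>
     (S1 \<union> S2 \<union> S3) \<inter> (path_image f1 \<union> path_image f2 \<union> path_image f3) = {} \<and>
     ball c r \<subseteq> S1 \<union> S2 \<union> S3 \<union> (path_image f1 \<union> path_image f2 \<union> path_image f3))"

definition four_sectors where
  "four_sectors c r f1 f2 f3 f4 \<longleftrightarrow> (\<exists>S1 S2 S3 S4.
     sector c r S1 f1 f2 \<and> sector c r S2 f2 f3 \<and> sector c r S3 f3 f4 \<and> sector c r S4 f4 f1 \<and>
     S1 \<inter> S2 = {} \<and> S1 \<inter> S3 = {} \<and> S1 \<inter> S4 = {} \<and> S2 \<inter> S3 = {} \<and> S2 \<inter> S4 = {} \<and> S3 \<inter> S4 = {} \<and>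
     (S1 \<union> S2 \<union> S3 \<union> S4) \<inter> (path_image f1 \<union> path_image f2 \<union> path_image f3 \<union> path_image f4) = {} \<and>
     ball c r \<subseteq> S1 \<union> S2 \<union> S3 \<union> S4 \<union> (path_image f1 \<union> path_image f2 \<union> path_image f3 \<union> path_image f4))"

lemma radial_arc_interior:
  assumes r: "0 < r" and l: "radial_arc c r l"
  obtains x where "x \<in> path_image l" "x \<in> ball c r" "x \<noteq> c"
proof -
  have arc: "arc l" "pathstart l = c" "pathfinish l \<in> sphere c r" "path_image l - {pathfinish l} \<subseteq> ball c r"
    using l by (auto simp: radial_arc_def)
  have "l (1/2) \<in> path_image l" by (auto simp: path_image_def)
  moreover have "l (1/2) \<noteq> l 0" "l (1/2) \<noteq> l 1"
    using arc(1) inj_onD[of l "{0..1}" "1/2" 0] inj_onD[of l "{0..1}" "1/2" 1] by (auto simp: arc_def)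
  ultimately show ?thesis
    using that[of "l (1/2)"] arc by (auto simp: pathstart_def pathfinish_def)
qed

text \<open>Three legs have a single cyclic order up to reflection, so the conclusion has no
  alternatives: the third leg enters one of the two sectors of the first two, and exchanging these
  is harmless because sectors are unoriented.\<close>

lemma three_sectors_exists:
  assumes r: "0 < r" and f: "radial_arc c r f1" "radial_arc c r f2" "radial_arc c r f3"
    and I: "path_image f1 \<inter> path_image f2 = {c}" "path_image f1 \<inter> path_image f3 = {c}"
      "path_image f2 \<inter> path_image f3 = {c}"
  shows "three_sectors c r f1 f2 f3"
proof -
  have I': "path_image f2 \<inter> path_image f1 = {c}" "path_image f3 \<inter> path_image f1 = {c}"
      "path_image f3 \<inter> path_image f2 = {c}"
    using I by (simp_all add: Int_commute)
  have fs: "path_image f1 \<inter> ball c r = path_image f1 - {pathfinish f1}"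
    "path_image f2 \<inter> ball c r = path_image f2 - {pathfinish f2}"
    "path_image f3 \<inter> ball c r = path_image f3 - {pathfinish f3}"
    using f by (auto simp: radial_arc_def)
  have c: "c \<in> path_image f1" "c \<in> path_image f2" "c \<in> path_image f3" using I by blast+
  have main: "three_sectors c r f1 f2 f3"
    if S: "sector c r S1 f1 f2" "sector c r S2 f2 f1" "S1 \<inter> S2 = {}"
      and U: "S1 \<union> S2 \<union> (path_image f1 \<union> path_image f2 - {pathfinish f1, pathfinish f2}) = ball c r"
      and x: "x \<in> path_image f3" "x \<in> S2" for x S1 S2
  proof -
    obtain T1 T2 where T: "sector c r T1 f2 f3" "sector c r T2 f3 f1" "T1 \<inter> T2 = {}"
      "T1 \<union> T2 \<union> (path_image f3 - {c, pathfinish f3}) = S2"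
      using sector_split[OF r f(2,1,3) I'(1) I(3,2) S(2)] x by blast
    note p = sector_props(3,4)[OF r f(1,2) I(1) S(1)] sector_props(3,4)[OF r f(2,1) I'(1) S(2)]
      sector_props(4)[OF r f(2,3) I(3) T(1)] sector_props(4)[OF r f(3,1) I'(2) T(2)]
    have f3: "S1 \<inter> path_image f3 = {}"
    proof -
      have "path_image f3 \<inter> ball c r \<subseteq> S2 \<union> {c}" using T(4) fs(3) by auto
      moreover have "c \<notin> S1" using p(2) c by blast
      ultimately show ?thesis using p(1) S(3) by blast
    qed
    have T2: "T1 \<subseteq> S2" "T2 \<subseteq> S2" using T(4) by auto
    have ST: "S1 \<inter> T1 = {}" "S1 \<inter> T2 = {}" using T2 S(3) by blast+
    have B: "ball c r \<subseteq> S1 \<union> T1 \<union> T2 \<union> (path_image f1 \<union> path_image f2 \<union> path_image f3)"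
      using U T(4) by blast
    have D: "(S1 \<union> T1 \<union> T2) \<inter> (path_image f1 \<union> path_image f2 \<union> path_image f3) = {}"
    proof -
      have "S1 \<inter> (path_image f1 \<union> path_image f2 \<union> path_image f3) = {}" using p(2) f3 by blast
      moreover have "T1 \<inter> (path_image f1 \<union> path_image f2 \<union> path_image f3) = {}" using p(4,5) T2 by blast
      moreover have "T2 \<inter> (path_image f1 \<union> path_image f2 \<union> path_image f3) = {}" using p(4,6) T2 by blast
      ultimately show ?thesis by blast
    qed
    show ?thesis
      unfolding three_sectors_def
      by (rule exI[of _ S1], rule exI[of _ T1], rule exI[of _ T2], intro conjI S(1) T(1-3) ST B D)
  qed
  obtain S1 S2 where S: "sector c r S1 f1 f2" "sector c r S2 f2 f1" "S1 \<inter> S2 = {}"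
    and U: "S1 \<union> S2 \<union> (path_image f1 \<union> path_image f2 - {pathfinish f1, pathfinish f2}) = ball c r"
    using sector_two[OF r f(1,2) I(1)] by blast
  obtain x where x: "x \<in> path_image f3" "x \<in> ball c r" "x \<noteq> c"
    using radial_arc_interior[OF r f(3)] by blast
  have "x \<notin> path_image f1" "x \<notin> path_image f2" using x I by auto
  then consider "x \<in> S2" | "x \<in> S1" using U x(2) by blast
  then show ?thesis
  proof cases
    case 1 then show ?thesis using main S U x(1) by blast
  next
    case 2
    show ?thesis
    proof (rule main[of S2 S1 x])
      show "sector c r S2 f1 f2" "sector c r S1 f2 f1" using S sector_sym by blast+
    qed (use S(3) U x 2 in \<open>auto simp: Un_commute Int_commute\<close>)
  qed
qed

lemma four_sectors_split:
  assumes r: "0 < r" and f: "radial_arc c r f1" "radial_arc c r f2" "radial_arc c r f3" "radial_arc c r f4"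
    and I: "path_image f1 \<inter> path_image f2 = {c}" "path_image f1 \<inter> path_image f3 = {c}"
      "path_image f2 \<inter> path_image f3 = {c}"
    and I4: "path_image f1 \<inter> path_image f4 = {c}" "path_image f2 \<inter> path_image f4 = {c}"
      "path_image f3 \<inter> path_image f4 = {c}"
    and S: "sector c r S1 f1 f2" "sector c r S2 f2 f3" "sector c r S3 f3 f1"
     "S1 \<inter> S2 = {}" "S1 \<inter> S3 = {}" "S2 \<inter> S3 = {}"
     "(S1 \<union> S2 \<union> S3) \<inter> (path_image f1 \<union> path_image f2 \<union> path_image f3) = {}"
     "ball c r \<subseteq> S1 \<union> S2 \<union> S3 \<union> (path_image f1 \<union> path_image f2 \<union> path_image f3)"
    and x: "x \<in> path_image f4" "x \<in> S3"
  shows "four_sectors c r f1 f2 f3 f4"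
proof -
  have I': "path_image f3 \<inter> path_image f1 = {c}" "path_image f4 \<inter> path_image f1 = {c}"
    using I I4 by (simp_all add: Int_commute)
  have fs: "path_image f4 \<inter> ball c r = path_image f4 - {pathfinish f4}"
    using f by (auto simp: radial_arc_def)
  have c: "c \<in> path_image f1" "c \<in> path_image f2" "c \<in> path_image f3" using I by blast+
  obtain T1 T2 where T: "sector c r T1 f3 f4" "sector c r T2 f4 f1" "T1 \<inter> T2 = {}"
      "T1 \<union> T2 \<union> (path_image f4 - {c, pathfinish f4}) = S3"
    using sector_split[OF r f(3,1,4) I'(1) I4(3,1) S(3)] x by blast
  note p = sector_props(3)[OF r f(1,2) I(1) S(1)] sector_props(3)[OF r f(2,3) I(3) S(2)]
     sector_props(4)[OF r f(3,4) I4(3) T(1)] sector_props(4)[OF r f(4,1) I'(2) T(2)]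
  have f4: "path_image f4 \<inter> ball c r \<subseteq> S3 \<union> {c}" using T(4) fs by auto
  have "c \<notin> S1" "c \<notin> S2" using S(7) c by blast+
  then have f4': "S1 \<inter> path_image f4 = {}" "S2 \<inter> path_image f4 = {}"
    using f4 p(1,2) S(5,6) by blast+
  have T3: "T1 \<subseteq> S3" "T2 \<subseteq> S3" using T(4) by auto
  let ?F = "path_image f1 \<union> path_image f2 \<union> path_image f3 \<union> path_image f4"
  have D: "(S1 \<union> S2 \<union> T1 \<union> T2) \<inter> ?F = {}"
  proof -
    have "S1 \<inter> ?F = {}" "S2 \<inter> ?F = {}" using f4' S(7) by blast+
    moreover have "T1 \<inter> ?F = {}" using p(3) S(7) T3 by blast
    moreover have "T2 \<inter> ?F = {}" using p(4) S(7) T3 by blast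
    ultimately show ?thesis by blast
  qed
  have B: "ball c r \<subseteq> S1 \<union> S2 \<union> T1 \<union> T2 \<union> ?F"
    using S(8) T(4) by blast
  have ST: "S1 \<inter> T1 = {}" "S1 \<inter> T2 = {}" "S2 \<inter> T1 = {}" "S2 \<inter> T2 = {}"
    using T3 S(5,6) by blast+
  show ?thesis
    unfolding four_sectors_def
    by (rule exI[of _ S1], rule exI[of _ S2], rule exI[of _ T1], rule exI[of _ T2], intro conjI S(1,2,4) T(1-3) ST B D)
qed

text \<open>The alternatives are the three cyclic orders of four legs up to rotation and reflection,
  one for each sector of the first three legs that the fourth may enter.\<close>

lemma four_sectors_exists:
  assumes r: "0 < r" and f: "radial_arc c r f1" "radial_arc c r f2" "radial_arc c r f3" "radial_arc c r f4"
    and I: "path_image f1 \<inter> path_image f2 = {c}" "path_image f1 \<inter> path_image f3 = {c}"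
      "path_image f2 \<inter> path_image f3 = {c}"
    and I4: "path_image f1 \<inter> path_image f4 = {c}" "path_image f2 \<inter> path_image f4 = {c}"
      "path_image f3 \<inter> path_image f4 = {c}"
  shows "four_sectors c r f1 f2 f3 f4 \<or> four_sectors c r f2 f3 f1 f4 \<or> four_sectors c r f3 f1 f2 f4"
proof -
  have I': "path_image f2 \<inter> path_image f1 = {c}" "path_image f3 \<inter> path_image f1 = {c}"
      "path_image f3 \<inter> path_image f2 = {c}"
    using I by (simp_all add: Int_commute)
  obtain S1 S2 S3 where S: "sector c r S1 f1 f2" "sector c r S2 f2 f3" "sector c r S3 f3 f1"
     "S1 \<inter> S2 = {}" "S1 \<inter> S3 = {}" "S2 \<inter> S3 = {}"
     "(S1 \<union> S2 \<union> S3) \<inter> (path_image f1 \<union> path_image f2 \<union> path_image f3) = {}"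
     "ball c r \<subseteq> S1 \<union> S2 \<union> S3 \<union> (path_image f1 \<union> path_image f2 \<union> path_image f3)"
    using three_sectors_exists[OF r f(1,2,3) I] unfolding three_sectors_def by blast
  obtain x where x: "x \<in> path_image f4" "x \<in> ball c r" "x \<noteq> c"
    using radial_arc_interior[OF r f(4)] by blast
  have "x \<notin> path_image f1" "x \<notin> path_image f2" "x \<notin> path_image f3" using x I4 by auto
  then consider "x \<in> S3" | "x \<in> S1" | "x \<in> S2" using S(8) x(2) by blast
  then show ?thesis
  proof cases
    case 1
    then show ?thesis using four_sectors_split[OF r f I I4 S x(1)] by blast
  next
    case 2
    have "four_sectors c r f2 f3 f1 f4"
      by (rule four_sectors_split[OF r f(2,3,1,4) I(3) I'(1,2) I4(2,3,1) S(2,3,1) _ _ _ _ _ x(1) 2])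
         (use S(4-8) in blast)+
    then show ?thesis by blast
  next
    case 3
    have "four_sectors c r f3 f1 f2 f4"
      by (rule four_sectors_split[OF r f(3,1,2,4) I'(2,3) I(1) I4(3,1,2) S(3,1,2) _ _ _ _ _ x(1) 3])
         (use S(4-8) in blast)+
    then show ?thesis by blast
  qed
qed

text \<open>The planar counterpart of \<open>consecutive_ends\<close> for one fixed neighbourhood
  \<open>U\<close>. The quantifier over \<open>U\<close> is split off because sectors control one
  disc at a time.\<close>

definition touching ::
  "complex set \<Rightarrow> complex set \<Rightarrow> (real \<Rightarrow> complex) \<Rightarrow> (real \<Rightarrow> complex) \<Rightarrow> bool" where
  "touching K U g h \<longleftrightarrow> (\<exists>W. connected W \<and> W \<subseteq> U - K \<and>
     (\<exists>d>0. g ` {0..d} \<subseteq> closure W \<and> h ` {0..d} \<subseteq> closure W))"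

lemma touching_mono: "touching K U g h \<Longrightarrow> U \<subseteq> U' \<Longrightarrow> touching K U' g h"
  unfolding touching_def by (meson Diff_mono order_refl subset_trans)

lemma touching_sym: "touching K U g h \<longleftrightarrow> touching K U h g"
  unfolding touching_def by (intro iff_exI conj_cong refl conj_commute)

lemma initial_segment_in_ball:
  assumes "path g" "pathstart g = c" "0 < e" "0 < t" "t < 1"
  obtains d where "0 < d" "d \<le> t" "g ` {0..d} \<subseteq> ball c e"
proof -
  have cont: "continuous_on {0..1} g" and g0: "g 0 = c"
    using assms by (auto simp: path_def pathstart_def)
  obtain \<delta> where \<delta>: "\<delta> > 0" "\<And>x. x \<in> {0..1} \<Longrightarrow> dist x 0 < \<delta> \<Longrightarrow> dist (g x) (g 0) < e"
    using cont assms(3) unfolding continuous_on_iff by (metis atLeastAtMost_iff order_refl zero_le_one)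
  have "g ` {0..min t (\<delta>/2)} \<subseteq> ball c e"
    using \<delta> assms g0 by (auto simp: dist_commute)
  then show ?thesis using that[of "min t (\<delta>/2)"] \<delta>(1) assms by auto
qed

text \<open>The sector itself may be cut by returning parts of \<open>K\<close>. The witness is
  therefore the component of the disc minus \<open>K\<close> that contains the part of the sector
  inside the inner disc.\<close>

lemma touching_adjacent:
  assumes sd: "star_data K c L" and cut: "star_cut K c L r r' t" and gh: "g \<in> L" "h \<in> L" "g \<noteq> h"
    and S: "sector c r S (subpath 0 (t g) g) (subpath 0 (t h) h)"
    and SL: "S \<inter> (\<Union>g\<in>L. path_image (subpath 0 (t g) g)) = {}"
  shows "touching K (ball c r) g h"
proof -
  note ct = star_cutD[OF cut]
  have tg: "0 < t g" "t g < 1" "radial_arc c r (subpath 0 (t g) g)"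
    and th: "0 < t h" "t h < 1" "radial_arc c r (subpath 0 (t h) h)"
    using ct(4-6) gh by blast+
  have I: "path_image (subpath 0 (t g) g) \<inter> path_image (subpath 0 (t h) h) = {c}"
    using truncations_Int[OF sd gh] tg th by blast
  note p = sector_props[OF ct(1) tg(3) th(3) I S]
  have c: "c \<in> closure S" using p(5) I by blast
  have "ball c r' \<inter> S \<noteq> {}"
    using c ct(2) open_Int_closure_eq_empty[of "ball c r'" S] by (metis centre_in_ball disjoint_iff open_ball)
  then obtain x where x: "x \<in> S \<inter> ball c r'" by blast
  define W where "W = connected_component_set (ball c r - K) x"
  have SW: "S \<inter> ball c r' \<subseteq> W"
    unfolding W_def using star_cut_connected[OF cut p(2,3) SL x] by auto
  have seg: "\<exists>d>0. d \<le> t k \<and> k ` {0..d} \<subseteq> closure W"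
    if k: "k = g \<or> k = h" for k
  proof -
    have k': "path k" "pathstart k = c" "0 < t k" "t k < 1"
      using k gh sd tg th by (auto simp: star_data_def arc_imp_path)
    obtain d where d: "0 < d" "d \<le> t k" "k ` {0..d} \<subseteq> ball c r'"
      using initial_segment_in_ball[OF k'(1,2) ct(2) k'(3,4)] by blast
    have "k ` {0..d} \<subseteq> path_image (subpath 0 (t k) k)"
      using d k'(3) by (auto simp: path_image_subpath)
    then have "k ` {0..d} \<subseteq> closure S" using p(5) k by blast
    then have "k ` {0..d} \<subseteq> ball c r' \<inter> closure S" using d by blast
    also have "\<dots> \<subseteq> closure (ball c r' \<inter> S)" by (rule open_Int_closure_subset) simp
    also have "\<dots> \<subseteq> closure W" using SW by (intro closure_mono) auto
    finally show ?thesis using d by blast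
  qed
  obtain d1 where d1: "0 < d1" "g ` {0..d1} \<subseteq> closure W" using seg[of g] by auto
  obtain d2 where d2: "0 < d2" "h ` {0..d2} \<subseteq> closure W" using seg[of h] by auto
  have "g ` {0..min d1 d2} \<subseteq> closure W" "h ` {0..min d1 d2} \<subseteq> closure W"
    using d1(2) d2(2) by auto
  moreover have "0 < min d1 d2" using d1 d2 by simp
  moreover have "connected W" "W \<subseteq> ball c r - K"
    unfolding W_def using connected_component_subset by auto
  ultimately show ?thesis unfolding touching_def by metis
qed

text \<open>A point of \<open>g\<close> strictly between \<open>c\<close> and the circle lies in the
  closed sector but not in the open one, hence on a bounding leg; distinct legs meet only at
  \<open>c\<close>.\<close>

lemma touching_imp_common_sector:
  assumes sd: "star_data K c L" and cut: "star_cut K c L r r' t" and gL: "g \<in> L"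
    and abL: "a \<in> L" "b \<in> L" "a \<noteq> b"
    and S: "sector c r S (subpath 0 (t a) a) (subpath 0 (t b) b)"
    and SL: "S \<inter> (\<Union>g\<in>L. path_image (subpath 0 (t g) g)) = {}"
    and W: "W \<subseteq> S" "0 < d" "g ` {0..d} \<subseteq> closure W"
  shows "g = a \<or> g = b"
proof (rule ccontr)
  assume ne: "\<not> (g = a \<or> g = b)"
  note ct = star_cutD[OF cut]
  have ta: "0 < t a" "t a < 1" "radial_arc c r (subpath 0 (t a) a)"
    and tb: "0 < t b" "t b < 1" "radial_arc c r (subpath 0 (t b) b)"
    and tg: "0 < t g" "t g < 1" "radial_arc c r (subpath 0 (t g) g)"
    using ct(4-6) abL gL by blast+
  have I: "path_image (subpath 0 (t a) a) \<inter> path_image (subpath 0 (t b) b) = {c}"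
    "path_image (subpath 0 (t g) g) \<inter> path_image (subpath 0 (t a) a) = {c}"
    "path_image (subpath 0 (t g) g) \<inter> path_image (subpath 0 (t b) b) = {c}"
    using truncations_Int[OF sd] abL gL ne ta tb tg by blast+
  note p = sector_props[OF ct(1) ta(3) tb(3) I(1) S]
  have g: "arc g" "pathstart g = c" using sd gL by (auto simp: star_data_def)
  define s where "s = min d (t g) / 2"
  have s: "0 < s" "s \<le> d" "s < t g" using W(2) tg by (auto simp: s_def)
  have mem: "g s \<in> path_image (subpath 0 (t g) g)" using s tg by (auto simp: path_image_subpath)
  have inj: "inj_on g {0..1}" using g by (simp add: arc_def)
  have "g s \<noteq> g 0" "g s \<noteq> g (t g)"
    using s tg inj_onD[OF inj, of s 0] inj_onD[OF inj, of s "t g"] by auto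
  then have gs: "g s \<noteq> c" "g s \<in> ball c r"
    using g mem tg(3) by (auto simp: radial_arc_def pathstart_def)
  have "g s \<in> g ` {0..d}" using s by simp
  then have "g s \<in> closure S" using W(3) closure_mono[OF W(1)] by blast
  then have "g s \<in> S \<union> path_image (subpath 0 (t a) a) \<union> path_image (subpath 0 (t b) b)"
    using p(6) gs by blast
  moreover have "g s \<notin> S" using SL mem gL by blast
  ultimately show False using I mem gs(1) by blast
qed

lemma connected_in_disjoint_open:
  assumes "connected W" "W \<subseteq> A \<union> B" "open A" "open B" "A \<inter> B = {}"
  shows "W \<subseteq> A \<or> W \<subseteq> B"
  using connectedD[OF assms(1,3,4)] assms(2,5) by blast

text \<open>A connected witness lies in a single sector and so touches only the two legs that bound
  it; opposite legs bound no common sector.\<close>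

lemma touching_four_sectors:
  assumes sd: "star_data K c L" and cut: "star_cut K c L r r' t"
    and L: "L = {g1, g2, g3, g4}" "distinct [g1, g2, g3, g4]"
    and fs: "four_sectors c r (subpath 0 (t g1) g1) (subpath 0 (t g2) g2) (subpath 0 (t g3) g3) (subpath 0 (t g4) g4)"
  defines "T \<equiv> touching K (ball c r)"
  shows "T g1 g2" "T g2 g3" "T g3 g4" "T g4 g1" "\<not> T g1 g3" "\<not> T g2 g4"
proof -
  let ?a = "\<lambda>g. subpath 0 (t g) g"
  obtain S1 S2 S3 S4 where S: "sector c r S1 (?a g1) (?a g2)" "sector c r S2 (?a g2) (?a g3)"
     "sector c r S3 (?a g3) (?a g4)" "sector c r S4 (?a g4) (?a g1)"
     "S1 \<inter> S2 = {}" "S1 \<inter> S3 = {}" "S1 \<inter> S4 = {}" "S2 \<inter> S3 = {}" "S2 \<inter> S4 = {}" "S3 \<inter> S4 = {}"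
     "(S1 \<union> S2 \<union> S3 \<union> S4) \<inter> (path_image (?a g1) \<union> path_image (?a g2) \<union> path_image (?a g3) \<union> path_image (?a g4)) = {}"
     "ball c r \<subseteq> S1 \<union> S2 \<union> S3 \<union> S4 \<union> (path_image (?a g1) \<union> path_image (?a g2) \<union> path_image (?a g3) \<union> path_image (?a g4))"
    using fs unfolding four_sectors_def by blast
  have un: "(\<Union>g\<in>L. path_image (?a g)) = path_image (?a g1) \<union> path_image (?a g2) \<union> path_image (?a g3) \<union> path_image (?a g4)"
    using L by auto
  have SL: "S1 \<inter> (\<Union>g\<in>L. path_image (?a g)) = {}" "S2 \<inter> (\<Union>g\<in>L. path_image (?a g)) = {}"
     "S3 \<inter> (\<Union>g\<in>L. path_image (?a g)) = {}" "S4 \<inter> (\<Union>g\<in>L. path_image (?a g)) = {}"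
    using S(11) un by blast+
  have gL: "g1 \<in> L" "g2 \<in> L" "g3 \<in> L" "g4 \<in> L" using L by auto
  have ne: "g1 \<noteq> g2" "g2 \<noteq> g3" "g3 \<noteq> g4" "g4 \<noteq> g1" "g1 \<noteq> g3" "g2 \<noteq> g4" using L(2) by auto
  note ct = star_cutD[OF cut]
  show "T g1 g2" "T g2 g3" "T g3 g4" "T g4 g1"
    unfolding T_def
    using touching_adjacent[OF sd cut gL(1,2) ne(1) S(1) SL(1)] touching_adjacent[OF sd cut gL(2,3) ne(2) S(2) SL(2)]
      touching_adjacent[OF sd cut gL(3,4) ne(3) S(3) SL(3)] touching_adjacent[OF sd cut gL(4,1) ne(4) S(4) SL(4)]
    by blast+
  have op: "open S1" "open S2" "open S3" "open S4"
    using sector_props(1)[OF ct(1) ct(6)[OF gL(1)] ct(6)[OF gL(2)] truncations_Int[OF sd gL(1,2) ne(1)] S(1)]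
      sector_props(1)[OF ct(1) ct(6)[OF gL(2)] ct(6)[OF gL(3)] truncations_Int[OF sd gL(2,3) ne(2)] S(2)]
      sector_props(1)[OF ct(1) ct(6)[OF gL(3)] ct(6)[OF gL(4)] truncations_Int[OF sd gL(3,4) ne(3)] S(3)]
      sector_props(1)[OF ct(1) ct(6)[OF gL(4)] ct(6)[OF gL(1)] truncations_Int[OF sd gL(4,1) ne(4)] S(4)]
      ct(4,5) gL by blast+
  have opposite: False
    if T: "touching K (ball c r) g h" and gh: "g \<in> L" "h \<in> L" "(g = g1 \<and> h = g3) \<or> (g = g2 \<and> h = g4)" for g h
  proof -
    obtain W d where W: "connected W" "W \<subseteq> ball c r - K" "0 < d" "g ` {0..d} \<subseteq> closure W" "h ` {0..d} \<subseteq> closure W"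
      using T unfolding touching_def by blast
    have aK: "path_image (?a k) \<subseteq> K" if "k \<in> L" for k
    proof -
      have "path_image k \<subseteq> K" using sd that by (auto simp: star_data_def)
      moreover have "path_image (?a k) \<subseteq> path_image k"
        using ct(4,5)[OF that] by (simp add: path_image_subpath_subset)
      ultimately show ?thesis by blast
    qed
    have "W \<subseteq> (S1 \<union> S2) \<union> (S3 \<union> S4)"
      using W(2) S(12) aK[OF gL(1)] aK[OF gL(2)] aK[OF gL(3)] aK[OF gL(4)] by blast
    then have "W \<subseteq> S1 \<union> S2 \<or> W \<subseteq> S3 \<union> S4"
      using S(6-9) op by (intro connected_in_disjoint_open[OF W(1)]) auto
    then consider "W \<subseteq> S1" | "W \<subseteq> S2" | "W \<subseteq> S3" | "W \<subseteq> S4"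
      using connected_in_disjoint_open[OF W(1) _ op(1,2) S(5)] connected_in_disjoint_open[OF W(1) _ op(3,4) S(10)]
      by blast
    then show False
    proof cases
      case 1 then show ?thesis using touching_imp_common_sector[OF sd cut _ gL(1,2) ne(1) S(1) SL(1) 1 W(3)] W gh ne by metis
    next
      case 2 then show ?thesis using touching_imp_common_sector[OF sd cut _ gL(2,3) ne(2) S(2) SL(2) 2 W(3)] W gh ne by metis
    next
      case 3 then show ?thesis using touching_imp_common_sector[OF sd cut _ gL(3,4) ne(3) S(3) SL(3) 3 W(3)] W gh ne by metis
    next
      case 4 then show ?thesis using touching_imp_common_sector[OF sd cut _ gL(4,1) ne(4) S(4) SL(4) 4 W(3)] W gh ne by metis
    qed
  qed
  show "\<not> T g1 g3" "\<not> T g2 g4" unfolding T_def using opposite gL by blast+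
qed

definition germ_consecutive ::
  "complex set \<Rightarrow> complex \<Rightarrow> (real \<Rightarrow> complex) \<Rightarrow> (real \<Rightarrow> complex) \<Rightarrow> bool" where
  "germ_consecutive K c g h \<longleftrightarrow> (\<forall>U. open U \<and> c \<in> U \<longrightarrow> touching K U g h)"

text \<open>The cyclic order of the legs seen in a disc might depend on its radius; it does not, because
  touching in a smaller disc implies touching in a larger one.\<close>

lemma germ_consecutive_cycle:
  assumes sd: "star_data K c L" and L: "L = {f1, f2, f3, f4}" "distinct [f1, f2, f3, f4]"
  defines "G \<equiv> germ_consecutive K c"
  obtains g1 g2 g3 g4 where "L = {g1, g2, g3, g4}" "distinct [g1, g2, g3, g4]"
    "G g1 g2" "G g2 g3" "G g3 g4" "G g4 g1" "\<not> G g1 g3" "\<not> G g2 g4"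
proof -
  define P where "P r a b d e \<longleftrightarrow> touching K (ball c r) a b \<and> touching K (ball c r) b d \<and>
     touching K (ball c r) d e \<and> touching K (ball c r) e a \<and>
     \<not> touching K (ball c r) a d \<and> \<not> touching K (ball c r) b e" for r a b d e
  have ex: "\<exists>r>0. r < e \<and> (P r g1 g2 g3 g4 \<or> P r g2 g3 g1 g4 \<or> P r g3 g1 g2 g4)"
    if e: "0 < e" and g: "L = {g1, g2, g3, g4}" "distinct [g1, g2, g3, g4]" for e g1 g2 g3 g4
  proof -
    obtain r r' t where r2: "r < e" and cut: "star_cut K c L r r' t"
      using star_local[OF sd e] by blast
    note ct = star_cutD[OF cut]
    let ?a = "\<lambda>g. subpath 0 (t g) g"
    have gL: "g1 \<in> L" "g2 \<in> L" "g3 \<in> L" "g4 \<in> L" using g by auto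
    have I: "path_image (?a g) \<inter> path_image (?a h) = {c}" if "g \<in> L" "h \<in> L" "g \<noteq> h" for g h
      using truncations_Int[OF sd that] ct(4,5) that by blast
    have ne: "g1 \<noteq> g2" "g1 \<noteq> g3" "g2 \<noteq> g3" "g1 \<noteq> g4" "g2 \<noteq> g4" "g3 \<noteq> g4" using g(2) by auto
    consider "four_sectors c r (?a g1) (?a g2) (?a g3) (?a g4)" | "four_sectors c r (?a g2) (?a g3) (?a g1) (?a g4)"
      | "four_sectors c r (?a g3) (?a g1) (?a g2) (?a g4)"
      using four_sectors_exists[OF ct(1) ct(6)[OF gL(1)] ct(6)[OF gL(2)] ct(6)[OF gL(3)] ct(6)[OF gL(4)]
          I[OF gL(1,2) ne(1)] I[OF gL(1,3) ne(2)] I[OF gL(2,3) ne(3)]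
          I[OF gL(1,4) ne(4)] I[OF gL(2,4) ne(5)] I[OF gL(3,4) ne(6)]] by blast
    then have "P r g1 g2 g3 g4 \<or> P r g2 g3 g1 g4 \<or> P r g3 g1 g2 g4"
    proof cases
      case 1
      show ?thesis using touching_four_sectors[OF sd cut g 1] unfolding P_def by blast
    next
      case 2
      have "L = {g2, g3, g1, g4}" "distinct [g2, g3, g1, g4]" using g by auto
      then show ?thesis using touching_four_sectors[OF sd cut _ _ 2] unfolding P_def by blast
    next
      case 3
      have "L = {g3, g1, g2, g4}" "distinct [g3, g1, g2, g4]" using g by auto
      then show ?thesis using touching_four_sectors[OF sd cut _ _ 3] unfolding P_def by blast
    qed
    then show ?thesis using ct(1) r2 by blast
  qed
  have main: "G g1 g2 \<and> G g2 g3 \<and> G g3 g4 \<and> G g4 g1 \<and> \<not> G g1 g3 \<and> \<not> G g2 g4"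
    if g: "L = {g1, g2, g3, g4}" "distinct [g1, g2, g3, g4]" and P0: "P r0 g1 g2 g3 g4" "0 < r0" for g1 g2 g3 g4 r0
  proof -
    have small: "P r g1 g2 g3 g4"
      if r: "0 < r" "r < r0" "P r g1 g2 g3 g4 \<or> P r g2 g3 g1 g4 \<or> P r g3 g1 g2 g4" for r
    proof -
      have sub: "ball c r \<subseteq> ball c r0" using r(2) by (intro subset_ball) simp
      have mono: "touching K (ball c r) a b \<Longrightarrow> touching K (ball c r0) a b" for a b
        by (rule touching_mono[OF _ sub])
      \<comment> \<open>Each of the other two orders makes \<open>g1\<close> and \<open>g3\<close>
        adjacent, although they are opposite in the disc of radius \<open>r0\<close>.\<close>
      show ?thesis using r(3) P0(1) mono touching_sym unfolding P_def by metis
    qed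
    have "touching K U g1 g2 \<and> touching K U g2 g3 \<and> touching K U g3 g4 \<and> touching K U g4 g1"
      if U: "open U" "c \<in> U" for U
    proof -
      obtain e where e: "0 < e" "ball c e \<subseteq> U" using U openE by blast
      obtain r where r: "0 < r" "r < min e r0" "P r g1 g2 g3 g4 \<or> P r g2 g3 g1 g4 \<or> P r g3 g1 g2 g4"
        using ex[OF _ g, of "min e r0"] e P0(2) by auto
      have "P r g1 g2 g3 g4" using small r by auto
      moreover have "ball c r \<subseteq> U" using e r by (auto simp: subset_ball)
      ultimately show ?thesis unfolding P_def using touching_mono by metis
    qed
    moreover have "\<not> G g1 g3" "\<not> G g2 g4"
      using P0 unfolding G_def germ_consecutive_def P_def by (metis centre_in_ball open_ball)+
    ultimately show ?thesis unfolding G_def germ_consecutive_def by blast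
  qed
  obtain r0 where r0: "0 < r0" "P r0 f1 f2 f3 f4 \<or> P r0 f2 f3 f1 f4 \<or> P r0 f3 f1 f2 f4"
    using ex[OF zero_less_one L] by blast
  have perm: "L = {f2, f3, f1, f4}" "distinct [f2, f3, f1, f4]" "L = {f3, f1, f2, f4}" "distinct [f3, f1, f2, f4]"
    using L by auto
  show ?thesis
    using r0(2)
  proof (elim disjE)
    assume "P r0 f1 f2 f3 f4"
    from main[OF L this r0(1)] show ?thesis using that L by blast
  next
    assume "P r0 f2 f3 f1 f4"
    from main[OF perm(1,2) this r0(1)] show ?thesis using that perm by blast
  next
    assume "P r0 f3 f1 f2 f4"
    from main[OF perm(3,4) this r0(1)] show ?thesis using that perm by blast
  qed
qed

section \<open>Stereographic projection\<close>

text \<open>An abstract orthonormal frame instead of coordinates, so that the centre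
  \<open>p\<close> can be any point of the sphere. Its handedness is left open, since only parities
  will be read off.\<close>

locale stereo =
  fixes p u v :: "real^3"
  assumes unit: "p \<bullet> p = 1" "u \<bullet> u = 1" "v \<bullet> v = 1"
    and orth: "u \<bullet> v = 0" "u \<bullet> p = 0" "v \<bullet> p = 0"
    and complete: "x = (x \<bullet> u) *\<^sub>R u + (x \<bullet> v) *\<^sub>R v + (x \<bullet> p) *\<^sub>R p"
begin

definition proj :: "real^3 \<Rightarrow> complex" where
  "proj x = Complex (x \<bullet> u) (x \<bullet> v) / of_real (1 - x \<bullet> p)"

definition lift :: "complex \<Rightarrow> real^3" where
  "lift z = (1 / ((cmod z)\<^sup>2 + 1)) *\<^sub>R ((2 * Re z) *\<^sub>R u + (2 * Im z) *\<^sub>R v + ((cmod z)\<^sup>2 - 1) *\<^sub>R p)"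

lemma orth': "v \<bullet> u = 0" "p \<bullet> u = 0" "p \<bullet> v = 0"
  using orth by (simp_all add: inner_commute)

lemma inner_self: "x \<bullet> x = (x \<bullet> u)\<^sup>2 + (x \<bullet> v)\<^sup>2 + (x \<bullet> p)\<^sup>2"
  by (subst (2) complete[of x]) (simp add: inner_add_right power2_eq_square)

lemma unit_coords:
  assumes "x \<in> sphere 0 1"
  shows "(x \<bullet> u)\<^sup>2 + (x \<bullet> v)\<^sup>2 = 1 - (x \<bullet> p)\<^sup>2"
proof -
  have "x \<bullet> x = 1" using assms by (simp add: dot_square_norm)
  then show ?thesis using inner_self[of x] by simp
qed

lemma inner_p_eq_1_iff:
  assumes "x \<in> sphere 0 1"
  shows "x \<bullet> p = 1 \<longleftrightarrow> x = p"
proof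
  assume xp: "x \<bullet> p = 1"
  then have "(x \<bullet> u)\<^sup>2 + (x \<bullet> v)\<^sup>2 = 0" using unit_coords[OF assms] by simp
  then have "x \<bullet> u = 0" "x \<bullet> v = 0" by (simp_all add: sum_power2_eq_zero_iff)
  then show "x = p" using complete[of x] xp by simp
qed (simp add: unit)

lemma lift_inner:
  "lift z \<bullet> u = 2 * Re z / ((cmod z)\<^sup>2 + 1)"
  "lift z \<bullet> v = 2 * Im z / ((cmod z)\<^sup>2 + 1)"
  "lift z \<bullet> p = ((cmod z)\<^sup>2 - 1) / ((cmod z)\<^sup>2 + 1)"
  by (simp_all add: lift_def inner_add_left orth orth' unit)

lemma cmod_sq_pos: "(cmod z)\<^sup>2 + 1 > 0"
  by (simp add: add_nonneg_pos)

lemma lift_in_sphere: "lift z \<in> sphere 0 1 - {p}"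
proof -
  have pos: "(cmod z)\<^sup>2 + 1 \<noteq> 0" using cmod_sq_pos[of z] by simp
  have "lift z \<bullet> lift z = (4 * ((Re z)\<^sup>2 + (Im z)\<^sup>2) + ((cmod z)\<^sup>2 - 1)\<^sup>2) / ((cmod z)\<^sup>2 + 1)\<^sup>2"
    unfolding inner_self[of "lift z"] lift_inner
    by (simp add: power_divide add_divide_distrib[symmetric] power_mult_distrib)
  also have "(Re z)\<^sup>2 + (Im z)\<^sup>2 = (cmod z)\<^sup>2" by (simp add: cmod_power2)
  also have "4 * (cmod z)\<^sup>2 + ((cmod z)\<^sup>2 - 1)\<^sup>2 = ((cmod z)\<^sup>2 + 1)\<^sup>2"
    by (simp add: power2_eq_square algebra_simps)
  finally have "lift z \<bullet> lift z = 1" using pos by simp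
  then have "lift z \<in> sphere 0 1" by (simp add: norm_eq_sqrt_inner)
  moreover have "lift z \<noteq> p"
  proof
    assume "lift z = p"
    then have "lift z \<bullet> p = 1" by (simp add: unit)
    then show False using pos by (simp add: lift_inner field_simps)
  qed
  ultimately show ?thesis by simp
qed

lemma proj_lift [simp]: "proj (lift z) = z"
proof -
  have pos: "(cmod z)\<^sup>2 + 1 \<noteq> 0" using cmod_sq_pos[of z] by simp
  have "1 - lift z \<bullet> p = 2 / ((cmod z)\<^sup>2 + 1)"
    using pos by (simp add: lift_inner field_simps)
  then show ?thesis
    using pos by (simp add: proj_def lift_inner complex_eq_iff)
qed

lemma proj_cmod:
  assumes "x \<in> sphere 0 1 - {p}"
  shows "(cmod (proj x))\<^sup>2 = (1 + x \<bullet> p) / (1 - x \<bullet> p)"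
proof -
  have ne: "1 - x \<bullet> p \<noteq> 0" using assms inner_p_eq_1_iff[of x] by auto
  have "(cmod (proj x))\<^sup>2 = ((x \<bullet> u)\<^sup>2 + (x \<bullet> v)\<^sup>2) / (1 - x \<bullet> p)\<^sup>2"
    by (simp add: proj_def norm_divide power_divide cmod_power2 del: of_real_diff)
  also have "\<dots> = (1 + x \<bullet> p) * (1 - x \<bullet> p) / (1 - x \<bullet> p)\<^sup>2"
    using unit_coords[of x] assms by (simp add: power2_eq_square algebra_simps)
  also have "\<dots> = (1 + x \<bullet> p) / (1 - x \<bullet> p)" using ne by (simp add: power2_eq_square)
  finally show ?thesis .
qed

lemma lift_proj [simp]:
  assumes "x \<in> sphere 0 1 - {p}"
  shows "lift (proj x) = x"
proof -
  have ne: "1 - x \<bullet> p \<noteq> 0" using assms inner_p_eq_1_iff[of x] by auto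
  have m: "(cmod (proj x))\<^sup>2 + 1 = 2 / (1 - x \<bullet> p)" "(cmod (proj x))\<^sup>2 - 1 = 2 * (x \<bullet> p) / (1 - x \<bullet> p)"
    using proj_cmod[OF assms] ne by (simp_all add: field_simps)
  have r: "Re (proj x) = (x \<bullet> u) / (1 - x \<bullet> p)" "Im (proj x) = (x \<bullet> v) / (1 - x \<bullet> p)"
    by (simp_all add: proj_def Re_divide_of_real Im_divide_of_real del: of_real_diff)
  have "lift (proj x) \<bullet> u = x \<bullet> u" "lift (proj x) \<bullet> v = x \<bullet> v" "lift (proj x) \<bullet> p = x \<bullet> p"
    unfolding lift_inner m r using ne by simp_all
  then show ?thesis using complete[of "lift (proj x)"] complete[of x] by simp
qed

lemma continuous_on_proj: "continuous_on (sphere 0 1 - {p}) proj"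
proof -
  have "1 - x \<bullet> p \<noteq> 0" if "x \<in> sphere 0 1 - {p}" for x using inner_p_eq_1_iff[of x] that by auto
  then have "continuous_on (sphere 0 1 - {p})
     (\<lambda>x. (of_real (x \<bullet> u) + \<i> * of_real (x \<bullet> v)) / complex_of_real (1 - x \<bullet> p))"
    by (intro continuous_intros) (simp add: of_real_eq_0_iff del: of_real_diff)
  then show ?thesis by (simp add: proj_def[abs_def] Complex_eq)
qed

lemma continuous_on_lift: "continuous_on UNIV lift"
proof -
  have "(cmod z)\<^sup>2 + 1 \<noteq> 0" for z using cmod_sq_pos[of z] by simp
  then show ?thesis unfolding lift_def[abs_def] by (intro continuous_intros) auto
qed

lemma proj_eq_iff:
  "x \<in> sphere 0 1 - {p} \<Longrightarrow> y \<in> sphere 0 1 - {p} \<Longrightarrow> proj x = proj y \<longleftrightarrow> x = y"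
  using lift_proj by metis

lemma proj_minus_p: "proj (- p) = 0"
  by (simp add: proj_def orth' complex_eq_iff)

lemma proj_eq_0_iff:
  assumes "x \<in> sphere 0 1 - {p}"
  shows "proj x = 0 \<longleftrightarrow> x = - p"
proof -
  have "- p \<in> sphere 0 1" using unit by (simp add: norm_eq_sqrt_inner)
  moreover have "- p \<noteq> p"
  proof
    assume "- p = p"
    then have "- (p \<bullet> p) = p \<bullet> p" by (metis inner_minus_left)
    then show False using unit(1) by simp
  qed
  ultimately show ?thesis using proj_eq_iff[OF assms, of "- p"] proj_minus_p by auto
qed

text \<open>With \<open>Z = Complex (x \<bullet> u) (x \<bullet> v)\<close> both sides reduce to
  \<open>Z * cnj Z = (1 + x \<bullet> p) * (1 - x \<bullet> p)\<close>, which expresses that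
  \<open>x\<close> has norm 1.\<close>

lemma proj_uminus:
  assumes "x \<in> sphere 0 1 - {p}" "x \<noteq> - p"
  shows "proj (- x) = - 1 / cnj (proj x)"
proof -
  have x': "- x \<in> sphere 0 1 - {p}" using assms by auto
  have ne: "1 - x \<bullet> p \<noteq> 0" using assms inner_p_eq_1_iff[of x] by auto
  have ne': "1 + x \<bullet> p \<noteq> 0" using x' inner_p_eq_1_iff[of "- x"] by auto
  define Z where "Z = Complex (x \<bullet> u) (x \<bullet> v)"
  have ZZ: "Z * cnj Z = of_real ((1 + x \<bullet> p) * (1 - x \<bullet> p))"
  proof -
    have "Z * cnj Z = of_real ((cmod Z)\<^sup>2)" by (rule complex_norm_square[symmetric])
    also have "(cmod Z)\<^sup>2 = (1 + x \<bullet> p) * (1 - x \<bullet> p)"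
      using unit_coords[of x] assms(1) unfolding Z_def cmod_power2 complex.sel
      by (simp add: power2_eq_square algebra_simps)
    finally show ?thesis .
  qed
  then have Z0: "Z \<noteq> 0" using ne ne' by (metis mult_eq_0_iff mult_zero_left of_real_eq_0_iff)
  have "proj (- x) = - Z / of_real (1 + x \<bullet> p)"
    by (simp add: proj_def Z_def complex_eq_iff Re_divide_of_real Im_divide_of_real del: of_real_add)
  also have "\<dots> = - of_real (1 - x \<bullet> p) / cnj Z"
  proof -
    have "- Z * cnj Z = - of_real (1 - x \<bullet> p) * of_real (1 + x \<bullet> p)"
      using ZZ by (simp add: mult.commute del: of_real_add of_real_diff)
    then show ?thesis using Z0 ne'
      by (simp add: frac_eq_eq del: of_real_add of_real_diff)
  qed
  also have "cnj Z = of_real (1 - x \<bullet> p) * cnj (proj x)"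
    using ne by (simp add: proj_def Z_def del: of_real_diff)
  also have "- of_real (1 - x \<bullet> p) / (of_real (1 - x \<bullet> p) * cnj (proj x)) = - 1 / cnj (proj x)"
    using ne by (simp del: of_real_diff)
  finally show ?thesis .
qed

end

lemma ex_stereo:
  fixes p :: "real^3"
  assumes "p \<in> sphere 0 1"
  shows "\<exists>u v. stereo p u v"
proof -
  have "norm (axis 3 1 :: real^3) = norm p" using assms by (simp add: norm_axis_1)
  then obtain f :: "real^3 \<Rightarrow> real^3" where f: "orthogonal_transformation f" "f (axis 3 1) = p"
    by (rule orthogonal_transformation_exists) blast
  define u where "u = f (axis 1 1)"
  define v where "v = f (axis 2 1)"
  have lin: "linear f" and ip: "\<And>x y. f x \<bullet> f y = x \<bullet> y" and "surj f"
    using f by (auto simp: orthogonal_transformation_def orthogonal_transformation_surj)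
  have "x = (x \<bullet> u) *\<^sub>R u + (x \<bullet> v) *\<^sub>R v + (x \<bullet> p) *\<^sub>R p" for x
  proof -
    obtain y where y: "x = f y" using \<open>surj f\<close> by blast
    have "y = (y$1) *\<^sub>R axis 1 1 + (y$2) *\<^sub>R axis 2 1 + (y$3) *\<^sub>R axis 3 1"
      by (simp add: vec_eq_iff forall_3 axis_def)
    then have "f y = f ((y$1) *\<^sub>R axis 1 1 + (y$2) *\<^sub>R axis 2 1 + (y$3) *\<^sub>R axis 3 1)" by simp
    also have "\<dots> = (y$1) *\<^sub>R u + (y$2) *\<^sub>R v + (y$3) *\<^sub>R p"
      by (simp add: linear_add[OF lin] linear_cmul[OF lin] u_def v_def f(2))
    finally have "x = (y$1) *\<^sub>R u + (y$2) *\<^sub>R v + (y$3) *\<^sub>R p" by (simp add: y)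
    moreover have "x \<bullet> u = y$1" "x \<bullet> v = y$2" "x \<bullet> p = y$3"
      by (simp_all add: y u_def v_def f(2)[symmetric] ip inner_axis)
    ultimately show ?thesis by simp
  qed
  note complete = this
  have "stereo p u v"
  proof
    show "p \<bullet> p = 1" "u \<bullet> u = 1" "v \<bullet> v = 1" "u \<bullet> v = 0" "u \<bullet> p = 0" "v \<bullet> p = 0"
      by (simp_all add: u_def v_def f(2)[symmetric] ip inner_axis_axis)
  qed (rule complete)
  then show ?thesis by blast
qed

text \<open>Continuity is available only on \<open>S\<close>, as for \<open>proj\<close> off its
  pole; hence the intersection with \<open>S\<close> on the left.\<close>

lemma image_closure_Int_subset:
  fixes f :: "'a::t2_space \<Rightarrow> 'b::t2_space"
  assumes "continuous_on S f" "W \<subseteq> S"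
  shows "f ` (closure W \<inter> S) \<subseteq> closure (f ` W)"
proof -
  have "closedin (top_of_set S) (S \<inter> f -` closure (f ` W))"
    using assms(1) by (intro continuous_closedin_preimage) auto
  then obtain C where C: "closed C" "S \<inter> f -` closure (f ` W) = S \<inter> C"
    by (auto simp: closedin_closed)
  have "W \<subseteq> C" using C(2) assms(2) closure_subset[of "f ` W"] by blast
  then have "closure W \<subseteq> C" using C(1) by (rule closure_minimal)
  then show ?thesis using C(2) by blast
qed

context stereo
begin

lemma consecutive_ends_proj:
  assumes Q: "support M \<subseteq> sphere 0 1 - {p}" and c: "c \<in> support M"
    and g: "path_image g \<subseteq> support M" and h: "path_image h \<subseteq> support M"
  shows "consecutive_ends M c g h \<longleftrightarrow> germ_consecutive (proj ` support M) (proj c) (proj \<circ> g) (proj \<circ> h)"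
proof
  let ?S = "sphere 0 1 - {p}"
  have gS: "g ` {0..1} \<subseteq> ?S" "h ` {0..1} \<subseteq> ?S" using g h Q by (auto simp: path_image_def)
  {
    assume L: "consecutive_ends M c g h"
    show "germ_consecutive (proj ` support M) (proj c) (proj \<circ> g) (proj \<circ> h)"
      unfolding germ_consecutive_def
    proof (intro allI impI)
      fix U assume U: "open U \<and> proj c \<in> U"
      have "openin (top_of_set ?S) (?S \<inter> proj -` U)"
        using continuous_on_proj U by (intro continuous_openin_preimage_gen) auto
      then obtain V where V: "open V" "?S \<inter> proj -` U = ?S \<inter> V" by (auto simp: openin_open)
      have "open (V - {p})" "c \<in> V - {p}" using V U c Q by (auto intro: open_delete)
      then obtain W d where W: "connected W" "W \<subseteq> (V - {p}) \<inter> (sphere 0 1 - support M)" "0 < d"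
        "g ` {0..d} \<subseteq> closure W" "h ` {0..d} \<subseteq> closure W"
        using L unfolding consecutive_ends_def by meson
      have WS: "W \<subseteq> ?S" using W(2) by auto
      have con: "connected (proj ` W)"
        using W(1) continuous_on_subset[OF continuous_on_proj WS] by (rule connected_continuous_image[rotated])
      have "proj ` W \<subseteq> U" using V(2) W(2) by auto
      moreover have "proj ` W \<inter> proj ` support M = {}"
      proof (rule ccontr)
        assume "proj ` W \<inter> proj ` support M \<noteq> {}"
        then obtain a b where ab: "a \<in> W" "b \<in> support M" "proj a = proj b" by auto
        then have "a = b" using proj_eq_iff[of a b] WS Q by blast
        then show False using ab W(2) by blast
      qed
      ultimately have sub: "proj ` W \<subseteq> U - proj ` support M" by blast
      \<comment> \<open>The \<open>d\<close> given by \<open>consecutive_ends\<close> may exceed 1,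
        and beyond 1 nothing is known about \<open>k\<close>.\<close>
      have cl: "(proj \<circ> k) ` {0..min d 1} \<subseteq> closure (proj ` W)"
        if k: "k ` {0..d} \<subseteq> closure W" "k ` {0..1} \<subseteq> ?S" for k
      proof -
        have "k ` {0..min d 1} \<subseteq> closure W \<inter> ?S"
          using k by (force simp: image_subset_iff)
        then have "proj ` k ` {0..min d 1} \<subseteq> proj ` (closure W \<inter> ?S)" by (rule image_mono)
        also have "\<dots> \<subseteq> closure (proj ` W)"
          by (rule image_closure_Int_subset[OF continuous_on_proj WS])
        finally show ?thesis by (simp add: image_comp)
      qed
      have "0 < min d 1" using W(3) by simp
      then show "touching (proj ` support M) U (proj \<circ> g) (proj \<circ> h)"
        unfolding touching_def using con sub cl[OF W(4) gS(1)] cl[OF W(5) gS(2)] by blast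
    qed
  next
    assume R: "germ_consecutive (proj ` support M) (proj c) (proj \<circ> g) (proj \<circ> h)"
    show "consecutive_ends M c g h"
      unfolding consecutive_ends_def
    proof (intro allI impI)
      fix U assume U: "open U \<and> c \<in> U"
      have op: "open (lift -` U)" using U continuous_on_lift by (simp add: open_vimage)
      have "proj c \<in> lift -` U" using U lift_proj[of c] c Q by (simp add: subset_iff)
      then obtain W d where W: "connected W" "W \<subseteq> lift -` U - proj ` support M" "0 < d"
        "(proj \<circ> g) ` {0..d} \<subseteq> closure W" "(proj \<circ> h) ` {0..d} \<subseteq> closure W"
        using R op unfolding germ_consecutive_def touching_def by meson
      have con: "connected (lift ` W)"
        using W(1) continuous_on_subset[OF continuous_on_lift] by (intro connected_continuous_image) auto
      have sub: "lift ` W \<subseteq> U \<inter> (sphere 0 1 - support M)"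
      proof
        fix x assume "x \<in> lift ` W"
        then obtain z where z: "z \<in> W" "x = lift z" by blast
        then have "proj x \<notin> proj ` support M" "x \<in> U" using W(2) by auto
        then have "x \<notin> support M" by blast
        with \<open>x \<in> U\<close> show "x \<in> U \<inter> (sphere 0 1 - support M)"
          using lift_in_sphere[of z] z(2) by blast
      qed
      have cl: "k ` {0..min d 1} \<subseteq> closure (lift ` W)"
        if k: "(proj \<circ> k) ` {0..d} \<subseteq> closure W" "k ` {0..1} \<subseteq> ?S" for k
      proof -
        have "k ` {0..min d 1} \<subseteq> lift ` closure W"
        proof
          fix x assume "x \<in> k ` {0..min d 1}"
          then obtain s where s: "0 \<le> s" "s \<le> d" "s \<le> 1" "x = k s" by auto
          then have "proj x \<in> closure W" "x \<in> ?S" using k by (auto simp: image_subset_iff)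
          then show "x \<in> lift ` closure W" using lift_proj[of x] by (metis image_eqI)
        qed
        also have "\<dots> \<subseteq> closure (lift ` W)"
          by (intro image_closure_subset[OF continuous_on_subset[OF continuous_on_lift]]
              closed_closure closure_subset subset_UNIV)
        finally show ?thesis .
      qed
      have "0 < min d 1" using W(3) by simp
      then show "\<exists>W. connected W \<and> W \<subseteq> U \<inter> (sphere 0 1 - support M) \<and>
             (\<exists>d>0. g ` {0..d} \<subseteq> closure W \<and> h ` {0..d} \<subseteq> closure W)"
        using con sub cl[OF W(4) gS(1)] cl[OF W(5) gS(2)] by blast
    qed
  }
qed

end

section \<open>Edges of an antipodally symmetric map\<close>

abbreviation anti :: "(real \<Rightarrow> real^3) \<Rightarrow> real \<Rightarrow> real^3" where
  "anti g \<equiv> (\<lambda>t. - g t)"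

lemma antipode_antipode [simp]: "antipode ` antipode ` A = A"
  by (force simp: antipode_def image_iff)

lemma antipode_image_comp: "antipode ` (g ` A) = (\<lambda>t. - g t) ` A"
  by (auto simp: antipode_def image_image)

lemma reversepath_image_open: "reversepath g ` {0<..<1} = g ` {0<..<1}"
proof -
  have "reversepath g ` {0<..<1} = g ` (\<lambda>t. 1 - t) ` {0<..<1}"
    by (simp add: reversepath_def image_image)
  also have "(\<lambda>t::real. 1 - t) ` {0<..<1} = {0<..<1}"
    using image_diff_atLeastAtMost by (auto simp: image_iff intro!: bexI[of _ "1 - _"])
  finally show ?thesis .
qed

lemma continuous_on_initial_segment:
  fixes g :: "real \<Rightarrow> 'a::t2_space"
  assumes "path g" "0 \<le> a" "b \<le> 1"
  shows "compact (g ` {a..b})" "continuous_on {a..b} g" "closed (g ` {a..b})"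
proof -
  show 1: "continuous_on {a..b} g" using assms by (auto simp: path_def intro: continuous_on_subset)
  show "compact (g ` {a..b})" using 1 by (rule compact_continuous_image) auto
  then show "closed (g ` {a..b})" by (rule compact_imp_closed)
qed

lemma simple_path_interior_eqD:
  assumes "simple_path g" "g s = g t" "s \<in> {0..1}" "t \<in> {0<..<1}"
  shows "s = t"
proof -
  have "s = t \<or> s = 0 \<and> t = 1 \<or> s = 1 \<and> t = 0"
    using assms unfolding simple_path_def loop_free_def
    by (metis atLeastAtMost_iff greaterThanLessThan_iff less_imp_le)
  then show ?thesis using assms(4) by auto
qed

lemma map_finite:
  assumes "is_map M"
  shows "finite (verts M)" "finite (edges M)" "verts M \<noteq> {}" "support M \<subseteq> sphere 0 1"
  using assms by (auto simp: is_map_def)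

lemma edge_pathD:
  assumes M: "is_map M" and g: "edge_path M e g" and e: "e \<in> edges M"
  shows "simple_path g" "path g" "pathstart g \<in> verts M" "pathfinish g \<in> verts M" "g ` {0<..<1} = e"
    "path_image g = e \<union> {pathstart g, pathfinish g}" "closure e = path_image g" "path_image g \<subseteq> support M"
    "path_image g \<inter> verts M = {pathstart g, pathfinish g}" "e \<inter> verts M = {}"
proof -
  show g1: "simple_path g" "pathstart g \<in> verts M" "pathfinish g \<in> verts M" "g ` {0<..<1} = e"
    using g by (auto simp: edge_path_def)
  show g2: "path g" using g1(1) by (rule simple_path_imp_path)
  have "{0..1} = {0<..<1} \<union> {0, 1::real}" by auto
  then have "path_image g = g ` {0<..<1} \<union> g ` {0, 1}" unfolding path_image_def by (simp only: image_Un)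
  then show g3: "path_image g = e \<union> {pathstart g, pathfinish g}"
    using g1(4) by (simp add: pathstart_def pathfinish_def)
  show "closure e = path_image g"
  proof
    show "closure e \<subseteq> path_image g"
      using g3 closed_path_image[OF g2] by (intro closure_minimal) auto
    have "g ` closure {0<..<1} \<subseteq> closure (g ` {0<..<1})"
      using g2 by (intro image_closure_subset) (auto simp: path_def intro: closure_subset[THEN subsetD])
    then show "path_image g \<subseteq> closure e" using g1(4) by (simp add: path_image_def)
  qed
  show "path_image g \<subseteq> support M" unfolding g3 support_def using g1 e by auto
  show ev: "e \<inter> verts M = {}" using M e by (auto simp: is_map_def)
  show "path_image g \<inter> verts M = {pathstart g, pathfinish g}" unfolding g3 using g1 ev by auto
qed

lemma edge_path_exists:
  assumes "is_map M" "e \<in> edges M"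
  shows "\<exists>g. edge_path M e g"
  using assms by (auto simp: is_map_def)

lemma edges_disjoint:
  assumes "is_map M" "e \<in> edges M" "e' \<in> edges M" "x \<in> e" "x \<in> e'"
  shows "e = e'"
  using assms unfolding is_map_def by blast

lemma edge_path_reversepath:
  assumes "edge_path M e g"
  shows "edge_path M e (reversepath g)"
  using assms reversepath_image_open[of g] by (auto simp: edge_path_def simple_path_reversepath)

lemma sphere_uminus_ne: "x \<in> sphere 0 1 \<Longrightarrow> - x \<noteq> (x::real^3)"
  by (metis add_eq_0_iff2 double_zero mem_sphere_0 neg_equal_zero norm_zero scaleR_2 zero_neq_one eq_neg_iff_add_eq_0 scaleR_eq_0_iff zero_neq_numeral)

lemma simple_path_uminus: "simple_path g \<Longrightarrow> simple_path (anti g)"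
  for g :: "real \<Rightarrow> real^3"
  by (auto simp: simple_path_def loop_free_def path_def intro: continuous_on_minus)

lemma edge_path_anti:
  assumes sym: "antipodally_symmetric M" and g: "edge_path M e g"
  shows "edge_path M (antipode ` e) (anti g)"
proof -
  have "- x \<in> verts M" if "x \<in> verts M" for x
    using sym that unfolding antipodally_symmetric_def antipode_def by blast
  then show ?thesis
    using g simple_path_uminus antipode_image_comp[of g "{0<..<1}"]
    by (auto simp: edge_path_def pathstart_def pathfinish_def)
qed

text \<open>A loop cannot be its own antipode, since its only vertex would be fixed. For an arc, the
  antipodal map transported to the unit interval would have a fixed point by Brouwer, but no point
  of the sphere is its own antipode.\<close>

lemma antipode_edge_ne:
  assumes M: "is_map M" and sym: "antipodally_symmetric M" and e: "e \<in> edges M"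
  shows "antipode ` e \<noteq> e"
proof
  assume eq: "antipode ` e = e"
  obtain g where g: "edge_path M e g" using edge_path_exists[OF M e] by blast
  note D = edge_pathD[OF M g e]
  have sph: "path_image g \<subseteq> sphere 0 1" using D(8) map_finite(4)[OF M] by blast
  have inv: "- x \<in> path_image g" if "x \<in> path_image g" for x
  proof -
    have "antipode ` closure e = closure (antipode ` e)"
      using closure_injective_linear_image[of antipode e]
      by (auto simp: antipode_def[abs_def] inj_on_def linear_iff)
    then have "antipode ` path_image g = path_image g" using eq D(7) by simp
    then show ?thesis using that by (force simp: antipode_def)
  qed
  have vinv: "- x \<in> verts M" if "x \<in> verts M" for x
    using sym that unfolding antipodally_symmetric_def antipode_def by blast
  have "pathstart g \<noteq> pathfinish g"
  proof
    assume "pathstart g = pathfinish g"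
    then have "path_image g \<inter> verts M = {pathstart g}" using D(9) by simp
    moreover have "- pathstart g \<in> path_image g \<inter> verts M"
      using inv[OF pathstart_in_path_image[of g]] vinv[of "pathstart g"] D(3) by simp
    ultimately have "- pathstart g = pathstart g" by simp
    then show False using sphere_uminus_ne[of "pathstart g"] sph pathstart_in_path_image[of g] by blast
  qed
  then have "arc g" using D(1) by (metis simple_path_imp_arc)
  then obtain h where h: "homeomorphism {0..1} (path_image g) g h" by (rule homeomorphism_arc)
  have "continuous_on {0..1} (\<lambda>t. h (- g t))"
  proof -
    have "continuous_on ((\<lambda>t. - g t) ` {0..1}) h"
      using h inv by (auto simp: homeomorphism_def path_image_def intro: continuous_on_subset)
    moreover have "continuous_on {0..1} (\<lambda>t. - g t)"
      using D(2) by (auto simp: path_def intro: continuous_on_minus)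
    ultimately show ?thesis by (rule continuous_on_compose2[of _ h]) auto
  qed
  moreover have "(\<lambda>t. h (- g t)) \<in> {0..1} \<rightarrow> {0..1}"
    using h inv by (auto simp: homeomorphism_def path_image_def)
  ultimately obtain t where t: "t \<in> {0..1}" "h (- g t) = t"
    using brouwer[of "{0..1::real}" "\<lambda>t. h (- g t)"] by auto
  have gt: "g t \<in> path_image g" using t by (auto simp: path_image_def)
  then have "g (h (- g t)) = - g t" using h inv by (auto simp: homeomorphism_def)
  then have "- g t = g t" using t by simp
  then show False using sphere_uminus_ne[of "g t"] sph gt by blast
qed

lemma edges_nonempty:
  assumes M: "is_map M" and reg: "four_regular M"
  shows "edges M \<noteq> {}"
proof
  assume "edges M = {}"
  moreover obtain p where "p \<in> verts M" using map_finite(3)[OF M] by blast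
  ultimately show False using reg by (auto simp: four_regular_def degree_at_def)
qed

text \<open>If the map covered the sphere, an interior point of an edge would have a neighbourhood
  in the sphere contained in a single arc. Parametrizing this neighbourhood by the plane and the arc
  by an interval would contradict invariance of dimension. The lemma provides the centre of
  projection.\<close>

lemma support_ne_sphere:
  assumes M: "is_map M" and reg: "four_regular M"
  shows "\<exists>p. p \<in> sphere 0 1 \<and> p \<notin> support M"
proof (rule ccontr)
  assume "\<not> ?thesis"
  then have full: "sphere 0 1 \<subseteq> support M" by blast
  obtain e where e: "e \<in> edges M" using edges_nonempty[OF M reg] by blast
  obtain g where g: "edge_path M e g" using edge_path_exists[OF M e] by blast
  note D = edge_pathD[OF M g e]
  \<comment> \<open>The first third of the edge is an arc even if the edge is a loop; 1/6 is the
    middle of that third.\<close>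
  define z where "z = g (1/6)"
  define X where "X = verts M \<union> (\<Union>e'\<in>edges M - {e}. closure e') \<union> g ` {1/3..1}"
  have clX: "closed X"
    unfolding X_def using map_finite[OF M] continuous_on_initial_segment(3)[OF D(2), of "1/3" 1]
    by (intro closed_Un closed_UN) (auto intro: finite_imp_closed)
  have ze: "z \<in> e" using D(5) by (auto simp: z_def)
  have zX: "z \<notin> X"
  proof
    assume "z \<in> X"
    then consider "z \<in> verts M" | e' where "e' \<in> edges M" "e' \<noteq> e" "z \<in> closure e'" | "z \<in> g ` {1/3..1}"
      by (auto simp: X_def)
    then show False
    proof cases
      case 1 then show ?thesis using ze D(10) by blast
    next
      case 2
      obtain g' where g': "edge_path M e' g'" using edge_path_exists[OF M 2(1)] by blast
      note D' = edge_pathD[OF M g' 2(1)]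
      have "z \<in> e' \<union> verts M" using 2(3) D'(3,4,6,7) by auto
      then show ?thesis using edges_disjoint[OF M e 2(1) ze] 2(2) ze D(10) by blast
    next
      case 3
      then obtain s where "s \<in> {1/3..1}" "g s = g (1/6)" by (auto simp: z_def)
      then show ?thesis using simple_path_interior_eqD[OF D(1), of s "1/6"] by auto
    qed
  qed
  obtain \<epsilon> where \<epsilon>: "\<epsilon> > 0" "ball z \<epsilon> \<inter> X = {}"
    using clX zX openE[of "- X" z] by (metis Compl_iff disjoint_eq_subset_Compl open_Compl)
  define a where "a = subpath 0 (1/3) g"
  have "arc a" unfolding a_def using D(1) by (intro arc_simple_path_subpath_interior) auto
  then obtain h where h: "homeomorphism {0..1} (path_image a) a h" by (rule homeomorphism_arc)
  have near: "ball z \<epsilon> \<inter> sphere 0 1 \<subseteq> path_image a"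
  proof
    fix x assume x: "x \<in> ball z \<epsilon> \<inter> sphere 0 1"
    then have xX: "x \<notin> X" using \<epsilon> by blast
    have "x \<in> support M" using x full by blast
    then obtain e' where e': "e' \<in> edges M" "x \<in> e'" using xX by (auto simp: support_def X_def)
    have "e' = e" using xX e' closure_subset[of e'] by (auto simp: X_def)
    then obtain s where s: "s \<in> {0<..<1}" "x = g s" using e' D(5) by auto
    have "s < 1/3"
    proof (rule ccontr)
      assume "\<not> s < 1/3"
      then have "s \<in> {1/3..1}" using s by auto
      then have "x \<in> g ` {1/3..1}" using s(2) by blast
      then show False using xX by (simp add: X_def)
    qed
    then show "x \<in> path_image a" using s by (auto simp: a_def path_image_subpath)
  qed
  have zs: "z \<in> sphere 0 1" using ze e map_finite(4)[OF M] by (auto simp: support_def)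
  then have "- z \<in> sphere 0 1" by simp
  then obtain u v where "stereo (- z) u v" using ex_stereo by blast
  then interpret stereo "- z" u v .
  define O' where "O' = lift -` ball z \<epsilon>"
  have "open O'" unfolding O'_def using continuous_on_lift by (simp add: open_vimage)
  moreover have "lift (proj z) = z" using zs sphere_uminus_ne[OF zs] by (intro lift_proj) auto
  then have "proj z \<in> O'" using \<epsilon>(1) by (simp add: O'_def)
  then have "O' \<noteq> {}" by blast
  moreover have sub: "lift ` O' \<subseteq> path_image a" using near lift_in_sphere by (auto simp: O'_def)
  then have "continuous_on O' (h \<circ> lift)"
    using h continuous_on_subset[OF continuous_on_lift, of O']
    by (intro continuous_on_compose) (auto simp: homeomorphism_def intro: continuous_on_subset)
  moreover have "inj_on (h \<circ> lift) O'"
  proof (rule comp_inj_on)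
    show "inj_on lift O'" by (rule inj_on_inverseI[of _ proj]) simp
    have "inj_on h (path_image a)" using h by (auto simp: homeomorphism_def intro!: inj_on_inverseI[of _ a])
    then show "inj_on h (lift ` O')" using sub by (rule inj_on_subset)
  qed
  ultimately have "DIM(complex) \<le> DIM(real)" by (intro invariance_of_dimension)
  then show False by simp
qed

section \<open>Germs of edges at a vertex\<close>

lemma consecutive_ends_initial:
  assumes "consecutive_ends M v g h"
    and "\<And>d. d > 0 \<Longrightarrow> \<exists>d'>0. g' ` {0..d'} \<subseteq> g ` {0..d}"
    and "\<And>d. d > 0 \<Longrightarrow> \<exists>d'>0. h' ` {0..d'} \<subseteq> h ` {0..d}"
  shows "consecutive_ends M v g' h'"
  unfolding consecutive_ends_def
proof (intro allI impI)
  fix U assume "open U \<and> v \<in> U"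
  then obtain W d where W: "connected W" "W \<subseteq> U \<inter> (sphere 0 1 - support M)" "d > 0"
    "g ` {0..d} \<subseteq> closure W" "h ` {0..d} \<subseteq> closure W"
    using assms(1) unfolding consecutive_ends_def by meson
  obtain d1 where d1: "d1 > 0" "g' ` {0..d1} \<subseteq> g ` {0..d}" using assms(2)[OF W(3)] by blast
  obtain d2 where d2: "d2 > 0" "h' ` {0..d2} \<subseteq> h ` {0..d}" using assms(3)[OF W(3)] by blast
  have "g' ` {0..min d1 d2} \<subseteq> g' ` {0..d1}" "h' ` {0..min d1 d2} \<subseteq> h' ` {0..d2}" by auto
  then have "g' ` {0..min d1 d2} \<subseteq> closure W" "h' ` {0..min d1 d2} \<subseteq> closure W" "0 < min d1 d2"
    using d1 d2 W(4,5) by auto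
  then show "\<exists>W. connected W \<and> W \<subseteq> U \<inter> (sphere 0 1 - support M) \<and>
           (\<exists>d>0. g' ` {0..d} \<subseteq> closure W \<and> h' ` {0..d} \<subseteq> closure W)"
    using W(1,2) by blast
qed

lemma consecutive_ends_sym: "consecutive_ends M v g h \<Longrightarrow> consecutive_ends M v h g"
  unfolding consecutive_ends_def by meson

lemma consecutive_ends_self: "consecutive_ends M v g h \<Longrightarrow> consecutive_ends M v g g"
  unfolding consecutive_ends_def by meson

lemma subpath_initial: "subpath 0 a g ` {0..d} = g ` {0..a * d}" if "0 < a" for a d :: real
proof -
  have "subpath 0 a g ` {0..d} = g ` (\<lambda>x. a * x) ` {0..d}" by (simp add: subpath_def image_image)
  also have "(\<lambda>x. a * x) ` {0..d} = {0..a * d}"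
    using that by (cases "0 \<le> d") (auto simp: image_mult_atLeastAtMost mult_less_0_iff)
  finally show ?thesis .
qed

lemma consecutive_ends_subpath:
  assumes "0 < a"
  shows "consecutive_ends M v (subpath 0 a g) (subpath 0 a h) \<longleftrightarrow> consecutive_ends M v g h"
proof
  assume L: "consecutive_ends M v (subpath 0 a g) (subpath 0 a h)"
  have *: "\<exists>d'>0. k ` {0..d'} \<subseteq> subpath 0 a k ` {0..d}" if "d > 0" for d and k :: "real \<Rightarrow> real^3"
    using that assms by (intro exI[of _ "a * d"]) (simp add: subpath_initial)
  show "consecutive_ends M v g h" by (rule consecutive_ends_initial[OF L * *])
next
  assume L: "consecutive_ends M v g h"
  have *: "\<exists>d'>0. subpath 0 a k ` {0..d'} \<subseteq> k ` {0..d}" if "d > 0" for d and k :: "real \<Rightarrow> real^3"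
    using that assms by (intro exI[of _ "d / a"]) (simp add: subpath_initial)
  show "consecutive_ends M v (subpath 0 a g) (subpath 0 a h)" by (rule consecutive_ends_initial[OF L * *])
qed

text \<open>Two parametrizations of the same edge from the same vertex have the same initial germ, unless the
  edge is a loop run through in opposite directions.\<close>

definition germ_le :: "(real \<Rightarrow> real^3) \<Rightarrow> (real \<Rightarrow> real^3) \<Rightarrow> bool" where
  "germ_le g h \<longleftrightarrow> (\<forall>d>0. \<exists>d'>0. g ` {0..d'} \<subseteq> h ` {0..d})"

text \<open>Near the starting vertex only the two end pieces of \<open>h\<close> remain, and an
  initial piece of \<open>g\<close> without the vertex is connected, so it lies in one of them. The
  alternative found for end pieces of length 1/4 persists for all shorter ones, because those two
  pieces have no common point on the edge.\<close>

lemma germ_le_dichotomy: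
  assumes M: "is_map M" and e: "e \<in> edges M" and g: "edge_path M e g" and h: "edge_path M e h"
    and gh: "pathstart g = pathstart h"
  shows "germ_le g h \<or> (pathfinish h = pathstart h \<and> germ_le g (reversepath h))"
proof -
  note G = edge_pathD[OF M g e] and H = edge_pathD[OF M h e]
  define v where "v = pathstart h"
  have v: "g 0 = v" "h 0 = v" "v \<in> verts M" using gh H(3) by (auto simp: v_def pathstart_def)
  have ge: "g s \<in> e" if "s \<in> {0<..<1}" for s using that G(5) by blast
  have he: "h s \<in> e" if "s \<in> {0<..<1}" for s using that H(5) by blast
  have hv: "h s \<noteq> v" if "s \<in> {0<..<1}" for s using he[OF that] v(3) H(10) by auto
  \<comment> \<open>for small \<open>d\<close> the set \<open>h ` {d..1-d}\<close> is a compact set avoiding \<open>v\<close>, and the initial piece of \<open>g\<close>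
    is a connected subset of the rest\<close>
  have split: "\<exists>\<delta>>0. \<delta> < 1 \<and> (g ` {0<..\<delta>} \<subseteq> h ` {0..d} \<or> g ` {0<..\<delta>} \<subseteq> h ` {1-d..1})"
    if d: "0 < d" "d < 1/2" for d
  proof -
    have "closed (h ` {d..1-d})" using d by (intro continuous_on_initial_segment(3)[OF H(2)]) auto
    moreover have "v \<notin> h ` {d..1-d}"
    proof
      assume "v \<in> h ` {d..1-d}"
      then obtain s where "s \<in> {d..1-d}" "v = h s" by blast
      then show False using hv[of s] d by auto
    qed
    ultimately obtain \<epsilon> where \<epsilon>: "\<epsilon> > 0" "ball v \<epsilon> \<inter> h ` {d..1-d} = {}"
      using openE[of "- h ` {d..1-d}" v] by (metis Compl_iff disjoint_eq_subset_Compl open_Compl)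
    obtain \<delta> where \<delta>: "0 < \<delta>" "\<delta> \<le> 1/2" "g ` {0..\<delta>} \<subseteq> ball v \<epsilon>"
    proof -
      have "continuous_on {0..1} g" using G(2) by (simp add: path_def)
      then obtain \<delta>0 where \<delta>0: "\<delta>0 > 0" "\<And>x. x \<in> {0..1} \<Longrightarrow> dist x 0 < \<delta>0 \<Longrightarrow> dist (g x) (g 0) < \<epsilon>"
        using \<epsilon>(1) unfolding continuous_on_iff by (metis atLeastAtMost_iff order_refl zero_le_one)
      have "g ` {0..min (1/2) (\<delta>0/2)} \<subseteq> ball v \<epsilon>"
        using \<delta>0 v by (auto simp: dist_commute)
      then show ?thesis using that[of "min (1/2) (\<delta>0/2)"] \<delta>0(1) by auto
    qed
    have sub: "g ` {0<..\<delta>} \<subseteq> h ` {0..d} \<union> h ` {1-d..1}"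
    proof
      fix x assume "x \<in> g ` {0<..\<delta>}"
      then obtain s where s: "s \<in> {0<..\<delta>}" "x = g s" by blast
      have "g s \<in> g ` {0..\<delta>}" using s by simp
      then have "x \<in> ball v \<epsilon>" using s \<delta>(3) by blast
      have "x \<in> e" using ge[of s] s \<delta> by auto
      then obtain r where r: "r \<in> {0<..<1}" "x = h r" using H(5) by blast
      have "r \<notin> {d..1-d}" using \<epsilon>(2) \<open>x \<in> ball v \<epsilon>\<close> r(2) by blast
      then have "r \<in> {0..d} \<or> r \<in> {1-d..1}" using r(1) by auto
      then show "x \<in> h ` {0..d} \<union> h ` {1-d..1}" using r(2) by blast
    qed
    have int: "h ` {0..d} \<inter> h ` {1-d..1} \<inter> g ` {0<..\<delta>} = {}"
    proof (rule ccontr)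
      assume "\<not> ?thesis"
      then obtain x r s t where x: "r \<in> {0..d}" "x = h r" "s \<in> {1-d..1}" "x = h s" "t \<in> {0<..\<delta>}" "x = g t"
        by blast
      then have "x \<in> e" using ge[of t] \<delta> by auto
      then have "x \<notin> verts M" using H(10) by blast
      then have "r \<noteq> 0" using x v by auto
      then have "r \<in> {0<..<1}" using x d by auto
      then have "s = r" using simple_path_interior_eqD[OF H(1), of s r] x d by auto
      then show False using x d by auto
    qed
    have "connected (g ` {0<..\<delta>})"
      using G(2) \<delta> by (intro connected_continuous_image) (auto simp: path_def intro: continuous_on_subset)
    moreover have "closed (h ` {0..d})" "closed (h ` {1-d..1})"
      using d by (auto intro!: continuous_on_initial_segment(3)[OF H(2)])
    ultimately have "h ` {0..d} \<inter> g ` {0<..\<delta>} = {} \<or> h ` {1-d..1} \<inter> g ` {0<..\<delta>} = {}"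
      using sub int by (auto simp: connected_closed)
    then have "g ` {0<..\<delta>} \<subseteq> h ` {0..d} \<or> g ` {0<..\<delta>} \<subseteq> h ` {1-d..1}" using sub by blast
    then show ?thesis using \<delta> by (intro exI[of _ \<delta>]) auto
  qed
  obtain \<delta>0 where \<delta>0: "\<delta>0 > 0" "\<delta>0 < 1" "g ` {0<..\<delta>0} \<subseteq> h ` {0..1/4} \<or> g ` {0<..\<delta>0} \<subseteq> h ` {1-1/4..1}"
    using split[of "1/4"] by auto
  have g0e: "g s \<in> e" if "s \<in> {0<..\<delta>0}" for s using that \<delta>0 ge by auto
  have disj: False if D: "x \<in> e" "x \<in> h ` {0..1/4}" "x \<in> h ` {1-1/4..1}" for x
  proof -
    obtain r s where rs: "r \<in> {0..1/4}" "x = h r" "s \<in> {1-1/4..1}" "x = h s" using D(2,3) by blast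
    have "r \<noteq> 0" using rs D(1) v H(10) by auto
    then have "s = r" using simple_path_interior_eqD[OF H(1), of s r] rs by auto
    then show False using rs by auto
  qed
  show ?thesis
    using \<delta>0(3)
  proof
    assume A: "g ` {0<..\<delta>0} \<subseteq> h ` {0..1/4}"
    have "germ_le g h"
      unfolding germ_le_def
    proof (intro allI impI)
      fix d :: real assume d: "0 < d"
      define d1 where "d1 = min d (1/4)"
      have d1: "0 < d1" "d1 < 1/2" using d by (auto simp: d1_def)
      obtain \<delta> where \<delta>: "\<delta> > 0" "\<delta> < 1" "g ` {0<..\<delta>} \<subseteq> h ` {0..d1} \<or> g ` {0<..\<delta>} \<subseteq> h ` {1-d1..1}"
        using split[OF d1] by blast
      define s where "s = min \<delta> \<delta>0"
      have s: "s \<in> {0<..\<delta>}" "s \<in> {0<..\<delta>0}" using \<delta> \<delta>0 by (auto simp: s_def)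
      have "\<not> g ` {0<..\<delta>} \<subseteq> h ` {1-d1..1}"
      proof
        assume B: "g ` {0<..\<delta>} \<subseteq> h ` {1-d1..1}"
        have "h ` {1-d1..1} \<subseteq> h ` {1-1/4..1}" by (intro image_mono) (auto simp: d1_def)
        then have "g s \<in> h ` {1-1/4..1}" using B s by blast
        then show False using disj[of "g s"] g0e[OF s(2)] A s(2) by blast
      qed
      then have C: "g ` {0<..\<delta>} \<subseteq> h ` {0..d1}" using \<delta>(3) by blast
      have "g ` {0..\<delta>} \<subseteq> h ` {0..d}"
      proof
        fix x assume "x \<in> g ` {0..\<delta>}"
        then obtain t where t: "t \<in> {0..\<delta>}" "x = g t" by blast
        show "x \<in> h ` {0..d}"
        proof (cases "t = 0")
          case True
          then have "x = h 0" using t v by simp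
          then show ?thesis using d by (intro image_eqI[of _ _ 0]) auto
        next
          case False
          then have "x \<in> h ` {0..d1}" using t C by auto
          moreover have "h ` {0..d1} \<subseteq> h ` {0..d}" by (intro image_mono) (auto simp: d1_def)
          ultimately show ?thesis by blast
        qed
      qed
      then show "\<exists>d'>0. g ` {0..d'} \<subseteq> h ` {0..d}" using \<delta>(1) by blast
    qed
    then show ?thesis ..
  next
    assume A: "g ` {0<..\<delta>0} \<subseteq> h ` {1-1/4..1}"
    have fin: "h 1 = v"
    proof (rule ccontr)
      assume ne: "h 1 \<noteq> v"
      have "closed (h ` {1-1/4..1})" by (intro continuous_on_initial_segment(3)[OF H(2)]) auto
      moreover have "g ` closure {0<..\<delta>0} \<subseteq> closure (g ` {0<..\<delta>0})"
        using G(2) \<delta>0 by (intro image_closure_subset)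
          (auto simp: path_def intro: closure_subset[THEN subsetD] continuous_on_subset)
      moreover have "0 \<in> closure {0<..\<delta>0}" using \<delta>0(1) by (simp add: closure_greaterThanAtMost)
      ultimately have "g 0 \<in> h ` {1-1/4..1}" using closure_minimal[OF A] by blast
      then obtain r where r: "r \<in> {1-1/4..1}" "v = h r" using v by auto
      then have "r \<noteq> 1" using ne by auto
      then show False using hv[of r] r by auto
    qed
    have "germ_le g (reversepath h)"
      unfolding germ_le_def
    proof (intro allI impI)
      fix d :: real assume d: "0 < d"
      define d1 where "d1 = min d (1/4)"
      have d1: "0 < d1" "d1 < 1/2" using d by (auto simp: d1_def)
      obtain \<delta> where \<delta>: "\<delta> > 0" "\<delta> < 1" "g ` {0<..\<delta>} \<subseteq> h ` {0..d1} \<or> g ` {0<..\<delta>} \<subseteq> h ` {1-d1..1}"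
        using split[OF d1] by blast
      define s where "s = min \<delta> \<delta>0"
      have s: "s \<in> {0<..\<delta>}" "s \<in> {0<..\<delta>0}" using \<delta> \<delta>0 by (auto simp: s_def)
      have "\<not> g ` {0<..\<delta>} \<subseteq> h ` {0..d1}"
      proof
        assume B: "g ` {0<..\<delta>} \<subseteq> h ` {0..d1}"
        have "h ` {0..d1} \<subseteq> h ` {0..1/4}" by (intro image_mono) (auto simp: d1_def)
        then have "g s \<in> h ` {0..1/4}" using B s by blast
        then show False using disj[of "g s"] g0e[OF s(2)] A s(2) by blast
      qed
      then have C: "g ` {0<..\<delta>} \<subseteq> h ` {1-d1..1}" using \<delta>(3) by blast
      have "g ` {0..\<delta>} \<subseteq> reversepath h ` {0..d}"
      proof
        fix x assume "x \<in> g ` {0..\<delta>}"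
        then obtain t where t: "t \<in> {0..\<delta>}" "x = g t" by blast
        show "x \<in> reversepath h ` {0..d}"
        proof (cases "t = 0")
          case True
          then have "x = reversepath h 0" using t v fin by (simp add: reversepath_def)
          then show ?thesis using d by (intro image_eqI[of _ _ 0]) auto
        next
          case False
          then have "x \<in> h ` {1-d1..1}" using t C by auto
          then obtain r where r: "r \<in> {1-d1..1}" "x = h r" by blast
          then have "x = reversepath h (1 - r)" "1 - r \<in> {0..d}" by (auto simp: reversepath_def d1_def)
          then show ?thesis by blast
        qed
      qed
      then show "\<exists>d'>0. g ` {0..d'} \<subseteq> reversepath h ` {0..d}" using \<delta>(1) by blast
    qed
    then show ?thesis using fin v by (auto simp: pathfinish_def pathstart_def)
  qed
qed

text \<open>Composing the two comparisons puts early points of \<open>g\<close> among its late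
  points, which a simple path forbids.\<close>

lemma germ_le_loop_exclusive:
  assumes M: "is_map M" and e: "e \<in> edges M" and g: "edge_path M e g" and h: "edge_path M e h"
    and "germ_le g h" "germ_le h (reversepath g)"
  shows False
proof -
  note G = edge_pathD[OF M g e] and H = edge_pathD[OF M h e]
  obtain d1 where d1: "d1 > 0" "h ` {0..d1} \<subseteq> reversepath g ` {0..1/4}"
    using assms(6) unfolding germ_le_def by (meson zero_less_divide_1_iff zero_less_numeral)
  obtain d2 where d2: "d2 > 0" "g ` {0..d2} \<subseteq> h ` {0..d1}"
    using assms(5) d1(1) unfolding germ_le_def by blast
  define s where "s = min d2 (1/4)"
  have s: "s \<in> {0..d2}" "s \<in> {0<..<1}" "s \<le> 1/4" using d2(1) by (auto simp: s_def)
  have "g s \<in> reversepath g ` {0..1/4}" using d1(2) d2(2) s(1) by blast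
  then obtain t where t: "t \<in> {0..1/4}" "g s = g (1 - t)" by (auto simp: reversepath_def)
  then have "1 - t = s" using simple_path_interior_eqD[OF G(1), of "1 - t" s] s(2) by auto
  then show False using t s(3) by auto
qed

text \<open>Applied in both directions the dichotomy might give mismatched alternatives;
  \<open>germ_le_loop_exclusive\<close> rules out exactly this.\<close>

lemma germ_equivalent:
  assumes M: "is_map M" and e: "e \<in> edges M" and g: "edge_path M e g" and h: "edge_path M e h"
    and gh: "pathstart g = pathstart h"
  obtains "germ_le g h" "germ_le h g"
  | "pathfinish h = pathstart h" "germ_le g (reversepath h)" "germ_le (reversepath h) g"
proof -
  have rr: "reversepath (reversepath h) = h" by simp
  consider "germ_le g h" | "pathfinish h = pathstart h" "germ_le g (reversepath h)"
    using germ_le_dichotomy[OF M e g h gh] by blast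
  then show thesis
  proof cases
    case 1
    have "\<not> germ_le h (reversepath g)"
      using germ_le_loop_exclusive[OF M e g h 1] by blast
    then have "germ_le h g" using germ_le_dichotomy[OF M e h g gh[symmetric]] by blast
    then show ?thesis using 1 that(1) by blast
  next
    case 2
    note h' = edge_path_reversepath[OF h]
    have st: "pathstart (reversepath h) = pathstart g" using 2 gh by simp
    have "\<not> germ_le (reversepath h) (reversepath g)"
      using germ_le_loop_exclusive[OF M e g h' 2(2)] by blast
    then have "germ_le (reversepath h) g" using germ_le_dichotomy[OF M e h' g st] by blast
    then show ?thesis using 2 that(2) by blast
  qed
qed

lemma consecutive_ends_germ:
  assumes "germ_le g g'" "germ_le g' g" "germ_le h h'" "germ_le h' h"
  shows "consecutive_ends M v g h \<longleftrightarrow> consecutive_ends M v g' h'"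
proof
  assume "consecutive_ends M v g h"
  then show "consecutive_ends M v g' h'"
    by (rule consecutive_ends_initial) (use assms in \<open>auto simp: germ_le_def\<close>)
next
  assume "consecutive_ends M v g' h'"
  then show "consecutive_ends M v g h"
    by (rule consecutive_ends_initial) (use assms in \<open>auto simp: germ_le_def\<close>)
qed

section \<open>Going straight through a vertex\<close>

lemma anti_anti [simp]: "anti (anti g) = g"
  by simp

lemma reversepath_anti: "reversepath (anti g) = anti (reversepath g)"
  by (simp add: reversepath_def)

lemma reversepath_ne:
  assumes "simple_path g"
  shows "reversepath g \<noteq> g"
proof
  assume "reversepath g = g"
  then have "reversepath g (1/4) = g (1/4)" by simp
  then have "g (3/4) = g (1/4)" by (simp add: reversepath_def)
  then show False using simple_path_interior_eqD[OF assms, of "3/4" "1/4"] by simp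
qed

section \<open>Darts of an antipodally symmetric map\<close>

locale symmetric_map =
  fixes M :: sphere_map
  assumes map: "is_map M" and reg: "four_regular M" and sym: "antipodally_symmetric M"
begin

lemma verts_uminus: "x \<in> verts M \<Longrightarrow> - x \<in> verts M"
  using sym unfolding antipodally_symmetric_def antipode_def by blast

lemma edges_antipode: "e \<in> edges M \<Longrightarrow> antipode ` e \<in> edges M"
  using sym unfolding antipodally_symmetric_def by blast

lemma support_uminus: "x \<in> support M \<Longrightarrow> - x \<in> support M"
  unfolding support_def using verts_uminus edges_antipode by (force simp: antipode_def)

lemma support_uminus_iff: "- x \<in> support M \<longleftrightarrow> x \<in> support M"
  using support_uminus[of x] support_uminus[of "- x"] by auto

definition par :: "(real^3) set \<Rightarrow> real \<Rightarrow> real^3" where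
  "par e = (SOME g. edge_path M e g)"

text \<open>Selects one edge from each antipodal pair: an edge and its antipode span the same
  unordered pair, so \<open>SOME\<close> picks the same member for both. This makes
  \<open>edge_par\<close> equivariant under the antipodal map.\<close>

definition chosen :: "(real^3) set \<Rightarrow> bool" where
  "chosen e \<longleftrightarrow> (SOME x. x \<in> {e, antipode ` e}) = e"

definition edge_par :: "(real^3) set \<Rightarrow> real \<Rightarrow> real^3" where
  "edge_par e = (if chosen e then par e else anti (par (antipode ` e)))"

definition darts :: "(real \<Rightarrow> real^3) set" where
  "darts = edge_par ` edges M \<union> (reversepath \<circ> edge_par) ` edges M"

definition dart_edge :: "(real \<Rightarrow> real^3) \<Rightarrow> (real^3) set" where
  "dart_edge d = d ` {0<..<1}"

definition darts_at :: "real^3 \<Rightarrow> (real \<Rightarrow> real^3) set" where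
  "darts_at v = {d \<in> darts. pathstart d = v}"

lemma par: "e \<in> edges M \<Longrightarrow> edge_path M e (par e)"
  unfolding par_def using edge_path_exists[OF map] by (rule someI_ex)

lemma chosen_antipode:
  assumes "e \<in> edges M"
  shows "chosen (antipode ` e) \<longleftrightarrow> \<not> chosen e"
proof -
  define s where "s = (SOME x. x \<in> {e, antipode ` e})"
  have "s \<in> {e, antipode ` e}" unfolding s_def by (rule someI[of _ e]) simp
  moreover have "{antipode ` e, antipode ` antipode ` e} = {e, antipode ` e}" by auto
  then have "chosen (antipode ` e) \<longleftrightarrow> s = antipode ` e" unfolding chosen_def s_def by simp
  moreover have "chosen e \<longleftrightarrow> s = e" unfolding chosen_def s_def by simp
  ultimately show ?thesis using antipode_edge_ne[OF map sym assms] by auto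
qed

lemma edge_par_antipode: "e \<in> edges M \<Longrightarrow> edge_par (antipode ` e) = anti (edge_par e)"
  using chosen_antipode[of e] by (simp add: edge_par_def)

lemma edge_par: "e \<in> edges M \<Longrightarrow> edge_path M e (edge_par e)"
  using par[of e] edge_path_anti[OF sym par[OF edges_antipode], of e] by (simp add: edge_par_def)

lemma dart_edge_edge_par: "e \<in> edges M \<Longrightarrow> dart_edge (edge_par e) = e"
  using edge_par[of e] by (simp add: dart_edge_def edge_path_def)

lemma dart_edge_reversepath [simp]: "dart_edge (reversepath d) = dart_edge d"
  by (simp add: dart_edge_def reversepath_image_open)

lemma dart_edge_anti [simp]: "dart_edge (anti d) = antipode ` dart_edge d"
  by (simp add: dart_edge_def antipode_image_comp)

lemma darts_cases:
  assumes "d \<in> darts"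
  obtains e where "e \<in> edges M" "d = edge_par e" | e where "e \<in> edges M" "d = reversepath (edge_par e)"
  using assms by (auto simp: darts_def)

lemma dart_path:
  assumes "d \<in> darts"
  shows "edge_path M (dart_edge d) d" "dart_edge d \<in> edges M"
  using assms
  by (cases rule: darts_cases; simp add: dart_edge_edge_par edge_par edge_path_reversepath)+

lemma reversepath_darts: "d \<in> darts \<Longrightarrow> reversepath d \<in> darts"
  by (erule darts_cases) (auto simp: darts_def)

lemma anti_darts:
  assumes "d \<in> darts"
  shows "anti d \<in> darts"
  using assms
proof (cases rule: darts_cases)
  case (1 e)
  then have "anti d = edge_par (antipode ` e)" using edge_par_antipode by simp
  then show ?thesis using edges_antipode[OF 1(1)] by (simp add: darts_def)
next
  case (2 e)
  then have "anti d = reversepath (edge_par (antipode ` e))"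
    using edge_par_antipode[OF 2(1)] reversepath_anti[of "edge_par e"] by simp
  then show ?thesis using edges_antipode[OF 2(1)] by (simp add: darts_def)
qed

lemma dart_simple: "d \<in> darts \<Longrightarrow> simple_path d"
  using dart_path(1) by (auto simp: edge_path_def)

lemma dart_edge_eqD:
  assumes "d \<in> darts" "d' \<in> darts" "dart_edge d = dart_edge d'"
  shows "d' = d \<or> d' = reversepath d"
  using assms(1)
proof (cases rule: darts_cases)
  case (1 e)
  from assms(2) show ?thesis
    by (cases rule: darts_cases) (use 1 assms(3) in \<open>auto simp: dart_edge_edge_par\<close>)
next
  case (2 e)
  from assms(2) show ?thesis
    by (cases rule: darts_cases) (use 2 assms(3) in \<open>auto simp: dart_edge_edge_par\<close>)
qed

lemma finite_darts: "finite darts"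
  using map_finite(2)[OF map] by (simp add: darts_def)

lemma dart_exists: "e \<in> edges M \<Longrightarrow> \<exists>d\<in>darts. dart_edge d = e"
  using dart_edge_edge_par by (auto simp: darts_def)

lemma dart_start: "d \<in> darts \<Longrightarrow> pathstart d \<in> verts M" "d \<in> darts \<Longrightarrow> pathfinish d \<in> verts M"
  using dart_path by (auto simp: edge_path_def)

lemma dart_support: "d \<in> darts \<Longrightarrow> path_image d \<subseteq> support M"
  using edge_pathD(8)[OF map dart_path] .

text \<open>The two summands of \<open>degree_at\<close> are the sizes of the union and of the
  intersection of the set of edges starting at \<open>v\<close> and the set of edges finishing
  there. By inclusion-exclusion their sum counts darts, a loop giving two.\<close>

lemma card_darts_at:
  assumes v: "v \<in> verts M"
  shows "card (darts_at v) = 4"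
proof -
  let ?A = "{e \<in> edges M. pathstart (edge_par e) = v}" and ?B = "{e \<in> edges M. pathfinish (edge_par e) = v}"
  have ends: "closure e \<inter> verts M = {pathstart (edge_par e), pathfinish (edge_par e)}" if "e \<in> edges M" for e
    using edge_pathD(7,9)[OF map edge_par[OF that] that] by simp
  have fin: "finite ?A" "finite ?B" using map_finite(2)[OF map] by auto
  have inj: "inj_on edge_par (edges M)" by (metis inj_on_def dart_edge_edge_par)
  then have inj': "inj_on (reversepath \<circ> edge_par) (edges M)"
    by (rule comp_inj_on) (rule inj_on_inverseI[of _ reversepath], simp)
  have eq: "darts_at v = edge_par ` ?A \<union> (reversepath \<circ> edge_par) ` ?B"
    by (auto simp: darts_at_def darts_def)
  have dis: "edge_par ` ?A \<inter> (reversepath \<circ> edge_par) ` ?B = {}"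
  proof (rule ccontr)
    assume "\<not> ?thesis"
    then obtain e e' where e: "e \<in> edges M" "e' \<in> edges M" "edge_par e = reversepath (edge_par e')" by auto
    then have "dart_edge (edge_par e) = dart_edge (edge_par e')" by simp
    then have "e = e'" using e(1,2) by (metis dart_edge_edge_par)
    moreover have "simple_path (edge_par e)" using edge_par[OF e(1)] by (simp add: edge_path_def)
    ultimately show False using reversepath_ne e(3) by metis
  qed
  have "card (darts_at v) = card (edge_par ` ?A) + card ((reversepath \<circ> edge_par) ` ?B)"
    unfolding eq using fin dis by (intro card_Un_disjoint) auto
  also have "card (edge_par ` ?A) = card ?A" by (intro card_image inj_on_subset[OF inj]) auto
  also have "card ((reversepath \<circ> edge_par) ` ?B) = card ?B" by (intro card_image inj_on_subset[OF inj']) auto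
  also have "card ?A + card ?B = card (?A \<union> ?B) + card (?A \<inter> ?B)" by (rule card_Un_Int[OF fin])
  also have "?A \<union> ?B = {e \<in> edges M. v \<in> closure e}"
  proof -
    have "v \<in> closure e \<longleftrightarrow> pathstart (edge_par e) = v \<or> pathfinish (edge_par e) = v" if "e \<in> edges M" for e
    proof -
      have "v \<in> closure e \<longleftrightarrow> v \<in> closure e \<inter> verts M" using v by blast
      also have "\<dots> \<longleftrightarrow> pathstart (edge_par e) = v \<or> pathfinish (edge_par e) = v"
        unfolding ends[OF that] by auto
      finally show ?thesis .
    qed
    then show ?thesis by blast
  qed
  also have "?A \<inter> ?B = {e \<in> edges M. closure e \<inter> verts M = {v}}"
  proof -
    have "closure e \<inter> verts M = {v} \<longleftrightarrow> pathstart (edge_par e) = v \<and> pathfinish (edge_par e) = v" if "e \<in> edges M" for e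
      unfolding ends[OF that] by auto
    then show ?thesis by blast
  qed
  finally show ?thesis using reg v by (simp add: four_regular_def degree_at_def)
qed

lemma edge_halves:
  assumes "e \<in> edges M" "x \<in> e"
  shows "\<exists>d\<in>darts. x \<in> d ` {0..1/2}"
proof -
  obtain s where s: "s \<in> {0<..<1}" "x = edge_par e s"
    using assms(2) dart_edge_edge_par[OF assms(1)] unfolding dart_edge_def by (metis imageE)
  show ?thesis
  proof (cases "s \<le> 1/2")
    case True
    then show ?thesis using s assms(1) by (intro bexI[of _ "edge_par e"]) (auto simp: darts_def)
  next
    case False
    then have "x = reversepath (edge_par e) (1 - s)" "1 - s \<in> {0..1/2}"
      using s by (auto simp: reversepath_def)
    then show ?thesis using assms(1) by (intro bexI[of _ "reversepath (edge_par e)"]) (auto simp: darts_def)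
  qed
qed

text \<open>Legs of length \<open>1/3\<close> rather than \<open>1/2\<close> keep the two ends of a loop from meeting in its middle.\<close>

lemma vertex_cycle:
  assumes v: "v \<in> verts M"
  obtains d1 d2 d3 d4 where "darts_at v = {d1, d2, d3, d4}" "distinct [d1, d2, d3, d4]"
    "consecutive_ends M v d1 d2" "consecutive_ends M v d2 d3" "consecutive_ends M v d3 d4" "consecutive_ends M v d4 d1"
    "\<not> consecutive_ends M v d1 d3" "\<not> consecutive_ends M v d2 d4"
proof -
  obtain p where p: "p \<in> sphere 0 1" "p \<notin> support M" using support_ne_sphere[OF map reg] by blast
  obtain u w where "stereo p u w" using ex_stereo[OF p(1)] by blast
  then interpret stereo p u w .
  have supp: "support M \<subseteq> sphere 0 1 - {p}" using map_finite(4)[OF map] p by blast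
  have vs: "v \<in> support M" using v by (simp add: support_def)
  define leg where "leg d = subpath 0 (1/3) d" for d :: "real \<Rightarrow> real^3"
  have leg: "arc (leg d)" "pathstart (leg d) = v" "path_image (leg d) \<subseteq> path_image d"
    "path_image (leg d) = d ` {0..1/3}" "path_image (leg d) \<subseteq> support M" if "d \<in> darts_at v" for d
  proof -
    have d: "d \<in> darts" "pathstart d = v" using that by (auto simp: darts_at_def)
    show "arc (leg d)" unfolding leg_def using dart_simple[OF d(1)] by (intro arc_simple_path_subpath_interior) auto
    show "pathstart (leg d) = v" using d(2) by (simp add: leg_def) (simp add: pathstart_def)
    show s: "path_image (leg d) \<subseteq> path_image d" unfolding leg_def by (intro path_image_subpath_subset) auto
    show "path_image (leg d) = d ` {0..1/3}" by (simp add: leg_def path_image_subpath)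
    show "path_image (leg d) \<subseteq> support M" using s dart_support[OF d(1)] by blast
  qed
  have legI: "path_image (leg d) \<inter> path_image (leg d') = {v}"
    if D: "d \<in> darts_at v" "d' \<in> darts_at v" "d \<noteq> d'" for d d'
  proof -
    have d: "d \<in> darts" "d 0 = v" "d' \<in> darts" "d' 0 = v" using D by (auto simp: darts_at_def pathstart_def)
    have "x = v" if x: "x \<in> path_image (leg d)" "x \<in> path_image (leg d')" for x
    proof (rule ccontr)
      assume xv: "x \<noteq> v"
      obtain s s' where s: "s \<in> {0..1/3}" "x = d s" "s' \<in> {0..1/3}" "x = d' s'"
        using x leg(4) D by blast
      have "s \<noteq> 0" "s' \<noteq> 0" using s d xv by auto
      then have s01: "s \<in> {0<..<1}" "s' \<in> {0<..<1}" using s by auto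
      then have "x \<in> dart_edge d" "x \<in> dart_edge d'"
        unfolding dart_edge_def using s(2,4) by blast+
      then have "dart_edge d = dart_edge d'"
        using edges_disjoint[OF map] dart_path(2) d by blast
      then have "d' = reversepath d" using dart_edge_eqD[OF d(1,3)] D(3) by auto
      then have "d s = d (1 - s')" using s by (simp add: reversepath_def)
      then have "1 - s' = s" using simple_path_interior_eqD[OF dart_simple[OF d(1)], of "1 - s'" s] s01 by auto
      then show False using s by auto
    qed
    moreover have "v \<in> path_image (leg d)" "v \<in> path_image (leg d')"
      using pathstart_in_path_image leg(2) D by metis+
    ultimately show ?thesis by blast
  qed
  have proj_inj: "inj_on proj (sphere 0 1 - {p})" by (rule inj_on_inverseI[of _ lift]) simp
  define f where "f d = proj \<circ> leg d" for d
  have imf: "path_image (f d) = proj ` path_image (leg d)" for d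
    by (simp add: f_def path_image_compose)
  have farc: "arc (f d)" "pathstart (f d) = proj v" "path_image (f d) \<subseteq> proj ` support M" if "d \<in> darts_at v" for d
  proof -
    have sub: "path_image (leg d) \<subseteq> sphere 0 1 - {p}" using leg(5)[OF that] supp by blast
    have "path (f d)" unfolding f_def
      using continuous_on_subset[OF continuous_on_proj sub] leg(1)[OF that]
      by (intro path_continuous_image) (auto simp: arc_imp_path)
    moreover have "inj_on (f d) {0..1}" unfolding f_def
    proof (rule comp_inj_on)
      show "inj_on (leg d) {0..1}" using leg(1)[OF that] by (simp add: arc_def)
      show "inj_on proj (leg d ` {0..1})"
        using proj_inj sub unfolding path_image_def by (rule inj_on_subset)
    qed
    ultimately show "arc (f d)" by (simp add: arc_def)
    show "pathstart (f d) = proj v" using leg(2)[OF that] by (simp add: f_def pathstart_compose)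
    show "path_image (f d) \<subseteq> proj ` support M" unfolding imf using leg(5)[OF that] by blast
  qed
  have fI: "path_image (f d) \<inter> path_image (f d') = {proj v}"
    if D: "d \<in> darts_at v" "d' \<in> darts_at v" "d \<noteq> d'" for d d'
  proof -
    have "proj ` path_image (leg d) \<inter> proj ` path_image (leg d') = proj ` (path_image (leg d) \<inter> path_image (leg d'))"
    proof (rule inj_on_image_Int[symmetric])
      show "inj_on proj (sphere 0 1 - {p})" by (rule proj_inj)
    qed (use leg(5) D supp in blast)+
    then show ?thesis unfolding imf using legI[OF D] by simp
  qed
  have finj: "inj_on f (darts_at v)"
  proof (rule inj_onI)
    fix d d' assume D: "d \<in> darts_at v" "d' \<in> darts_at v" "f d = f d'"
    show "d = d'"
    proof (rule ccontr)
      assume "d \<noteq> d'"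
      then have "path_image (f d) = {proj v}" using fI[OF D(1,2)] D(3) by simp
      then have "pathstart (f d) = pathfinish (f d)"
        using pathstart_in_path_image[of "f d"] pathfinish_in_path_image[of "f d"] by simp
      then show False using arc_distinct_ends[OF farc(1)[OF D(1)]] by simp
    qed
  qed
  have fin: "finite (darts_at v)" using finite_darts by (simp add: darts_at_def)
  obtain ds where ds: "set ds = darts_at v" "distinct ds" using finite_distinct_list[OF fin] by blast
  then have "length ds = 4" using card_darts_at[OF v] distinct_card by metis
  then obtain a1 a2 a3 a4 where "ds = [a1, a2, a3, a4]"
    by (auto simp: numeral_eq_Suc length_Suc_conv)
  then have a: "darts_at v = {a1, a2, a3, a4}" "distinct [a1, a2, a3, a4]" using ds by auto
  define L where "L = f ` darts_at v"
  have L: "L = {f a1, f a2, f a3, f a4}" unfolding L_def a(1) by simp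
  have Ld: "distinct [f a1, f a2, f a3, f a4]"
    using a finj by (auto simp: inj_on_def)
  \<comment> \<open>All of the map except the legs: the other vertices, the halves of edges leaving
    other vertices, and the parameters from 1/3 to 1/2 of every dart. It is compact and avoids
    \<open>v\<close>, so its projection misses a disc around \<open>proj v\<close>.\<close>
  define X where "X = (verts M - {v}) \<union> (\<Union>d\<in>darts - darts_at v. d ` {0..1/2}) \<union> (\<Union>d\<in>darts. d ` {1/3..1/2})"
  have seg: "compact (d ` {a..b})" if "d \<in> darts" "0 \<le> a" "b \<le> 1" for d a b
    using continuous_on_initial_segment(1)[of d a b] simple_path_imp_path[OF dart_simple] that by blast
  have cX: "compact X" unfolding X_def
    using finite_darts map_finite(1)[OF map] seg
    by (intro compact_Un compact_UN) (auto intro: finite_imp_compact)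
  have vd: "d s \<noteq> v" if "d \<in> darts" "s \<in> {0<..<1}" for d s
  proof -
    have "d s \<in> dart_edge d" using that by (auto simp: dart_edge_def)
    then show ?thesis using edge_pathD(10)[OF map dart_path[OF that(1)]] v by blast
  qed
  have vX: "v \<notin> X"
  proof
    assume "v \<in> X"
    then consider d s where "d \<in> darts - darts_at v" "s \<in> {0..1/2}" "v = d s"
      | d s where "d \<in> darts" "s \<in> {1/3..1/2}" "v = d s" by (auto simp: X_def)
    then show False
    proof cases
      case 1
      then have "s \<noteq> 0" by (auto simp: darts_at_def pathstart_def)
      then show ?thesis using vd[of d s] 1 by auto
    next
      case 2
      then show ?thesis using vd[of d s] by auto
    qed
  qed
  have cover: "support M \<subseteq> X \<union> (\<Union>d\<in>darts_at v. path_image (leg d))"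
  proof
    fix x assume "x \<in> support M"
    then consider "x \<in> verts M" | e where "e \<in> edges M" "x \<in> e" by (auto simp: support_def)
    then show "x \<in> X \<union> (\<Union>d\<in>darts_at v. path_image (leg d))"
    proof cases
      case 1
      have "a1 \<in> darts_at v" using a by simp
      then have "v \<in> path_image (leg a1)" using leg(2) pathstart_in_path_image by metis
      then show ?thesis using 1 \<open>a1 \<in> darts_at v\<close> by (auto simp: X_def)
    next
      case 2
      then obtain d where d: "d \<in> darts" "x \<in> d ` {0..1/2}" using edge_halves by blast
      have "{0..1/2} = {0..1/3} \<union> {1/3..1/2::real}" by auto
      then have "d ` {0..1/2} = d ` {0..1/3} \<union> d ` {1/3..1/2}" by (simp only: image_Un)
      then show ?thesis using d leg(4)[of d] by (cases "d \<in> darts_at v") (auto simp: X_def)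
    qed
  qed
  have XS: "X \<subseteq> support M"
  proof -
    have "d ` {a..b} \<subseteq> support M" if "d \<in> darts" "0 \<le> a" "b \<le> 1" for d a b
      using dart_support[OF that(1)] that by (force simp: path_image_def)
    then have "(\<Union>d\<in>darts - darts_at v. d ` {0..1/2}) \<subseteq> support M" "(\<Union>d\<in>darts. d ` {1/3..1/2}) \<subseteq> support M"
      by (intro UN_least; simp)+
    moreover have "verts M - {v} \<subseteq> support M" by (auto simp: support_def)
    ultimately show ?thesis unfolding X_def by blast
  qed
  have cK: "compact (proj ` X)" "closed (proj ` support M)"
  proof -
    show 1: "compact (proj ` X)"
      using continuous_on_subset[OF continuous_on_proj, of X] XS supp cX by (intro compact_continuous_image) auto
    have "support M = X \<union> (\<Union>d\<in>darts_at v. path_image (leg d))" using cover XS leg(5) by blast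
    then have "proj ` support M = proj ` X \<union> (\<Union>d\<in>darts_at v. path_image (f d))" by (auto simp: imf)
    moreover have "closed (\<Union>d\<in>darts_at v. path_image (f d))"
      using fin farc(1) by (intro closed_UN) (auto intro: closed_arc_image)
    ultimately show "closed (proj ` support M)" using compact_imp_closed[OF 1] by (auto intro: closed_Un)
  qed
  have "proj v \<notin> proj ` X"
  proof
    assume "proj v \<in> proj ` X"
    then obtain x where x: "x \<in> X" "proj v = proj x" by blast
    then have "v = x" using proj_eq_iff[of v x] XS supp vs by blast
    then show False using x vX by blast
  qed
  then obtain \<epsilon> where \<epsilon>: "\<epsilon> > 0" "ball (proj v) \<epsilon> \<inter> proj ` X = {}"
    using ex_ball_avoiding[OF compact_imp_closed[OF cK(1)]] by blast
  have near: "proj ` support M \<inter> ball (proj v) \<epsilon> \<subseteq> (\<Union>g\<in>L. path_image g)"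
  proof
    fix z assume z: "z \<in> proj ` support M \<inter> ball (proj v) \<epsilon>"
    then obtain x where x: "x \<in> support M" "z = proj x" by blast
    then have "x \<notin> X" using z \<epsilon> by blast
    then obtain d where "d \<in> darts_at v" "x \<in> path_image (leg d)" using cover x by blast
    then show "z \<in> (\<Union>g\<in>L. path_image g)" using x by (auto simp: L_def imf)
  qed
  have sd: "star_data (proj ` support M) (proj v) L"
    unfolding star_data_def
  proof (intro conjI ballI impI)
    show "finite L" "L \<noteq> {}" using L by auto
    show "\<exists>\<epsilon>>0. proj ` support M \<inter> ball (proj v) \<epsilon> \<subseteq> (\<Union>g\<in>L. path_image g)" using \<epsilon>(1) near by blast
    fix g assume g: "g \<in> L"
    then obtain d where d: "d \<in> darts_at v" "g = f d" by (auto simp: L_def)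
    show "arc g" "pathstart g = proj v" "path_image g \<subseteq> proj ` support M" using farc[OF d(1)] d(2) by auto
    fix h assume h: "h \<in> L" "g \<noteq> h"
    then obtain d' where d': "d' \<in> darts_at v" "h = f d'" by (auto simp: L_def)
    then have "d \<noteq> d'" using h d by auto
    then show "path_image g \<inter> path_image h = {proj v}" using fI[OF d(1) d'(1)] d d' by simp
  qed (rule cK(2))
  have tr: "germ_consecutive (proj ` support M) (proj v) (f d) (f d') \<longleftrightarrow> consecutive_ends M v d d'"
    if D: "d \<in> darts_at v" "d' \<in> darts_at v" for d d'
    using consecutive_ends_proj[OF supp vs leg(5)[OF D(1)] leg(5)[OF D(2)]] consecutive_ends_subpath[of "1/3" M v d d']
    by (simp add: f_def leg_def)
  obtain g1 g2 g3 g4 where g: "L = {g1, g2, g3, g4}" "distinct [g1, g2, g3, g4]"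
    "germ_consecutive (proj ` support M) (proj v) g1 g2" "germ_consecutive (proj ` support M) (proj v) g2 g3"
    "germ_consecutive (proj ` support M) (proj v) g3 g4" "germ_consecutive (proj ` support M) (proj v) g4 g1"
    "\<not> germ_consecutive (proj ` support M) (proj v) g1 g3" "\<not> germ_consecutive (proj ` support M) (proj v) g2 g4"
    by (rule germ_consecutive_cycle[OF sd L Ld])
  have "g1 \<in> L" "g2 \<in> L" "g3 \<in> L" "g4 \<in> L" using g(1) by auto
  then obtain d1 d2 d3 d4 where d: "d1 \<in> darts_at v" "g1 = f d1" "d2 \<in> darts_at v" "g2 = f d2"
    "d3 \<in> darts_at v" "g3 = f d3" "d4 \<in> darts_at v" "g4 = f d4" unfolding L_def by blast
  have "darts_at v \<subseteq> {d1, d2, d3, d4}"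
  proof
    fix x assume x: "x \<in> darts_at v"
    then have "f x \<in> {f d1, f d2, f d3, f d4}" using g(1) d L_def by blast
    then show "x \<in> {d1, d2, d3, d4}" using inj_onD[OF finj _ x] d by blast
  qed
  then have eq: "darts_at v = {d1, d2, d3, d4}" using d by blast
  have "distinct [d1, d2, d3, d4]" using g(2) d by auto
  then show ?thesis
    using that[OF eq] g(3-8) d tr by simp
qed

text \<open>An end is consecutive to itself and to its two neighbours in the cycle, which leaves
  only the one across.\<close>

lemma ex1_opposite:
  assumes d: "d \<in> darts"
  shows "\<exists>!h. h \<in> darts_at (pathstart d) \<and> \<not> consecutive_ends M (pathstart d) d h"
proof -
  define v where "v = pathstart d"
  have v: "v \<in> verts M" using dart_start[OF d] by (simp add: v_def)
  obtain d1 d2 d3 d4 where D: "darts_at v = {d1, d2, d3, d4}" "distinct [d1, d2, d3, d4]"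
    "consecutive_ends M v d1 d2" "consecutive_ends M v d2 d3" "consecutive_ends M v d3 d4" "consecutive_ends M v d4 d1"
    "\<not> consecutive_ends M v d1 d3" "\<not> consecutive_ends M v d2 d4"
    using vertex_cycle[OF v] by blast
  have "d \<in> {d1, d2, d3, d4}" using d D(1) by (auto simp: darts_at_def v_def)
  then consider "d = d1" | "d = d2" | "d = d3" | "d = d4" by blast
  moreover have self: "consecutive_ends M v d1 d1" "consecutive_ends M v d2 d2" "consecutive_ends M v d3 d3"
      "consecutive_ends M v d4 d4"
    using D(3-6) consecutive_ends_self by blast+
  moreover have sy: "consecutive_ends M v d2 d1" "consecutive_ends M v d3 d2" "consecutive_ends M v d4 d3"
      "consecutive_ends M v d1 d4"
    using D(3-6) consecutive_ends_sym by blast+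
  moreover have nsy: "\<not> consecutive_ends M v d3 d1" "\<not> consecutive_ends M v d4 d2"
    using D(7,8) consecutive_ends_sym by blast+
  ultimately show ?thesis
    unfolding v_def[symmetric] D(1)
  proof cases
    case 1
    show "\<exists>!h. h \<in> {d1, d2, d3, d4} \<and> \<not> consecutive_ends M v d h"
      by (rule ex1I[of _ d3]) (use 1 D(3,6,7) self sy in blast)+
  next
    case 2
    show "\<exists>!h. h \<in> {d1, d2, d3, d4} \<and> \<not> consecutive_ends M v d h"
      by (rule ex1I[of _ d4]) (use 2 D(4,8) self sy in blast)+
  next
    case 3
    show "\<exists>!h. h \<in> {d1, d2, d3, d4} \<and> \<not> consecutive_ends M v d h"
      by (rule ex1I[of _ d1]) (use 3 D(5) nsy self sy in blast)+
  next
    case 4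
    show "\<exists>!h. h \<in> {d1, d2, d3, d4} \<and> \<not> consecutive_ends M v d h"
      by (rule ex1I[of _ d2]) (use 4 D(6) nsy self sy in blast)+
  qed
qed

section \<open>The opposite dart and its symmetries\<close>

definition opp :: "(real \<Rightarrow> real^3) \<Rightarrow> (real \<Rightarrow> real^3)" where
  "opp d = (THE h. h \<in> darts_at (pathstart d) \<and> \<not> consecutive_ends M (pathstart d) d h)"

lemma opp:
  assumes "d \<in> darts"
  shows "opp d \<in> darts" "pathstart (opp d) = pathstart d" "\<not> consecutive_ends M (pathstart d) d (opp d)"
  using theI'[OF ex1_opposite[OF assms]] unfolding opp_def[symmetric] by (auto simp: darts_at_def)

lemma opp_unique:
  assumes "d \<in> darts" "h \<in> darts" "pathstart h = pathstart d" "\<not> consecutive_ends M (pathstart d) d h"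
  shows "h = opp d"
  using ex1_opposite[OF assms(1)] opp[OF assms(1)] assms by (auto simp: darts_at_def)

lemma opp_opp:
  assumes "d \<in> darts"
  shows "opp (opp d) = d"
proof -
  have "\<not> consecutive_ends M (pathstart (opp d)) (opp d) d"
    using opp[OF assms] consecutive_ends_sym by metis
  then show ?thesis using opp_unique[OF opp(1)[OF assms] assms] opp(2)[OF assms] by simp
qed

lemma opp_ne:
  assumes "d \<in> darts"
  shows "opp d \<noteq> d"
proof
  assume eq: "opp d = d"
  obtain d1 d2 d3 d4 where D: "darts_at (pathstart d) = {d1, d2, d3, d4}" "distinct [d1, d2, d3, d4]"
    using vertex_cycle[OF dart_start(1)[OF assms]] by metis
  obtain h where h: "h \<in> darts_at (pathstart d)" "h \<noteq> d"
    using D by (metis distinct_length_2_or_more insertCI)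
  then have "consecutive_ends M (pathstart d) d h"
    using opp_unique[OF assms] eq by (auto simp: darts_at_def)
  then show False using opp(3)[OF assms] eq consecutive_ends_self by metis
qed

lemma consecutive_ends_anti:
  assumes "consecutive_ends M v g h"
  shows "consecutive_ends M (- v) (anti g) (anti h)"
  unfolding consecutive_ends_def
proof (intro allI impI)
  fix U :: "(real^3) set" assume U: "open U \<and> - v \<in> U"
  have "open (uminus ` U)" "v \<in> uminus ` U" using U open_negations by (auto intro: image_eqI[of _ _ "- v"])
  then obtain W d where W: "connected W" "W \<subseteq> uminus ` U \<inter> (sphere 0 1 - support M)" "d > 0"
    "g ` {0..d} \<subseteq> closure W" "h ` {0..d} \<subseteq> closure W"
    using assms unfolding consecutive_ends_def by meson
  have con: "connected (uminus ` W)"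
    using W(1) by (rule connected_continuous_image[rotated]) (intro continuous_intros)
  have sub: "uminus ` W \<subseteq> U \<inter> (sphere 0 1 - support M)"
  proof
    fix x assume "x \<in> uminus ` W"
    then obtain y where y: "y \<in> W" "x = - y" by blast
    then have "y \<in> uminus ` U" "y \<in> sphere 0 1" "y \<notin> support M" using W(2) by auto
    moreover from this obtain w where "w \<in> U" "y = - w" by blast
    ultimately show "x \<in> U \<inter> (sphere 0 1 - support M)"
      using y(2) support_uminus_iff[of y] by simp
  qed
  have cl: "anti k ` {0..d} \<subseteq> closure (uminus ` W)" if "k ` {0..d} \<subseteq> closure W" for k
  proof -
    have "uminus ` closure W \<subseteq> closure (uminus ` W)"
      by (intro image_closure_subset closed_closure closure_subset) (intro continuous_intros)
    then show ?thesis using that by blast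
  qed
  show "\<exists>W. connected W \<and> W \<subseteq> U \<inter> (sphere 0 1 - support M) \<and>
           (\<exists>d>0. anti g ` {0..d} \<subseteq> closure W \<and> anti h ` {0..d} \<subseteq> closure W)"
    using con sub cl[OF W(4)] cl[OF W(5)] W(3) by blast
qed

lemma pathstart_anti: "pathstart (anti g) = - pathstart g"
  by (simp add: pathstart_def)

lemma opp_anti:
  assumes d: "d \<in> darts"
  shows "opp (anti d) = anti (opp d)"
proof -
  have "\<not> consecutive_ends M (pathstart (anti d)) (anti d) (anti (opp d))"
  proof
    assume "consecutive_ends M (pathstart (anti d)) (anti d) (anti (opp d))"
    from consecutive_ends_anti[OF this] have "consecutive_ends M (pathstart d) d (opp d)"
      by (simp add: pathstart_anti)
    then show False using opp(3)[OF d] by blast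
  qed
  then show ?thesis
    using opp_unique[OF anti_darts[OF d] anti_darts[OF opp(1)[OF d]]] opp(2)[OF d] by (simp add: pathstart_anti)
qed

text \<open>Loops are the reason for comparing germs: the starting vertex alone does not tell which
  of the two darts of a loop \<open>g\<close> follows.\<close>

lemma dart_of_germ:
  assumes e: "e \<in> edges M" and g: "edge_path M e g"
  shows "\<exists>d\<in>darts. dart_edge d = e \<and> pathstart d = pathstart g \<and> germ_le d g \<and> germ_le g d"
proof -
  obtain h where h: "h \<in> darts" "dart_edge h = e" "pathstart h = pathstart g"
  proof -
    let ?h = "edge_par e"
    have "{pathstart g, pathfinish g} = {pathstart ?h, pathfinish ?h}"
      using edge_pathD(7,9)[OF map g e] edge_pathD(7,9)[OF map edge_par[OF e] e] by simp
    then have "pathstart g \<in> {pathstart ?h, pathfinish ?h}" by (metis insertI1)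
    then have "pathstart ?h = pathstart g \<or> pathstart (reversepath ?h) = pathstart g" by auto
    then show ?thesis
      using that[of ?h] that[of "reversepath ?h"] dart_edge_edge_par[OF e] e by (auto simp: darts_def)
  qed
  have hp: "edge_path M e h" using dart_path(1)[OF h(1)] h(2) by simp
  show ?thesis
  proof (cases rule: germ_equivalent[OF map e g hp h(3)[symmetric]])
    case 1
    then show ?thesis using h by blast
  next
    case 2
    have "pathstart (reversepath h) = pathstart g" using 2 h by simp
    then show ?thesis using 2 h reversepath_darts[OF h(1)] by (intro bexI[of _ "reversepath h"]) auto
  qed
qed

text \<open>Consecutiveness depends only on germs, so the arbitrary parametrizations in
  \<open>straight\<close> can be replaced by darts; the second dart is then forced to be
  \<open>opp\<close> of the first.\<close>

lemma straight_iff: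
  "(e, e') \<in> straight M \<longleftrightarrow> (\<exists>d\<in>darts. dart_edge d = e \<and> dart_edge (opp d) = e')"
proof
  assume "(e, e') \<in> straight M"
  then obtain v g h where vgh: "e \<in> edges M" "e' \<in> edges M" "v \<in> verts M" "edge_path M e g" "edge_path M e' h"
    "pathstart g = v" "pathstart h = v" "\<not> consecutive_ends M v g h"
    by (auto simp: straight_def)
  obtain d where d: "d \<in> darts" "dart_edge d = e" "pathstart d = v" "germ_le d g" "germ_le g d"
    using dart_of_germ[OF vgh(1,4)] vgh(6) by blast
  obtain d' where d': "d' \<in> darts" "dart_edge d' = e'" "pathstart d' = v" "germ_le d' h" "germ_le h d'"
    using dart_of_germ[OF vgh(2,5)] vgh(7) by blast
  have "\<not> consecutive_ends M v d d'"
    using vgh(8) consecutive_ends_germ[OF d(4,5) d'(4,5)] by blast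
  then have "d' = opp d" using opp_unique[OF d(1) d'(1)] d(3) d'(3) by simp
  then show "\<exists>d\<in>darts. dart_edge d = e \<and> dart_edge (opp d) = e'" using d d' by blast
next
  assume "\<exists>d\<in>darts. dart_edge d = e \<and> dart_edge (opp d) = e'"
  then obtain d where d: "d \<in> darts" "dart_edge d = e" "dart_edge (opp d) = e'" by blast
  then show "(e, e') \<in> straight M"
    unfolding straight_def
    using dart_path[OF d(1)] dart_path[OF opp(1)[OF d(1)]] opp[OF d(1)] dart_start(1)[OF d(1)] by blast
qed

end

section \<open>Component curves and their winding numbers\<close>

text \<open>The least period comes together with injectivity below it, so that sums over an orbit
  can be rewritten as sums over an index range.\<close>

lemma funpow_orbit_period:
  assumes fin: "finite D" and fD: "\<And>x. x \<in> D \<Longrightarrow> f x \<in> D" and inj: "inj_on f D" and d: "d \<in> D"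
  obtains l where "0 < l" "(f ^^ l) d = d" "inj_on (\<lambda>k. (f ^^ k) d) {..<l}"
    "range (\<lambda>k. (f ^^ k) d) = (\<lambda>k. (f ^^ k) d) ` {..<l}"
proof -
  have mem: "(f ^^ k) d \<in> D" for k by (induction k) (auto simp: d fD)
  have cancel: "i = 0 \<or> (f ^^ (j - i)) d = d" if "(f ^^ i) d = (f ^^ j) d" "i \<le> j" for i j
    using that
  proof (induction i arbitrary: j)
    case (Suc i)
    then obtain j' where j: "j = Suc j'" by (cases j) auto
    have "(f ^^ i) d = (f ^^ j') d"
      using inj_onD[OF inj _ mem[of i] mem[of j']] Suc.prems j by simp
    then show ?case using Suc.IH[of j'] Suc.prems j by (cases "i = 0") auto
  qed simp
  have "\<not> inj (\<lambda>k. (f ^^ k) d)"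
  proof
    assume "inj (\<lambda>k. (f ^^ k) d)"
    then have "infinite (range (\<lambda>k. (f ^^ k) d))" using range_inj_infinite by blast
    moreover have "range (\<lambda>k. (f ^^ k) d) \<subseteq> D" using mem by auto
    ultimately show False using fin finite_subset by blast
  qed
  then obtain i j where ij: "i < j" "(f ^^ i) d = (f ^^ j) d"
    by (metis (mono_tags, lifting) injI linorder_neqE_nat)
  define P where "P n \<longleftrightarrow> 0 < n \<and> (f ^^ n) d = d" for n
  have "\<exists>n. P n"
  proof (cases "i = 0")
    case True then show ?thesis using ij by (auto simp: P_def intro!: exI[of _ j])
  next
    case False then show ?thesis using cancel[OF ij(2)] ij(1) by (auto simp: P_def intro!: exI[of _ "j - i"])
  qed
  define l where "l = (LEAST n. P n)"
  have l: "P l" unfolding l_def using \<open>\<exists>n. P n\<close> by (rule LeastI_ex)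
  have least: "n < l \<Longrightarrow> \<not> P n" for n unfolding l_def by (rule not_less_Least)
  have "inj_on (\<lambda>k. (f ^^ k) d) {..<l}"
  proof (rule linorder_inj_onI)
    fix i j assume ij: "i < j" "i \<in> {..<l}" "j \<in> {..<l}"
    show "(f ^^ i) d \<noteq> (f ^^ j) d"
    proof
      assume eq: "(f ^^ i) d = (f ^^ j) d"
      have "P (j - i)"
      proof (cases "i = 0")
        case True then show ?thesis using eq ij by (simp add: P_def)
      next
        case False then show ?thesis using cancel[OF eq] ij by (simp add: P_def)
      qed
      moreover have "j - i < l" using ij by auto
      ultimately show False using least by blast
    qed
  qed auto
  moreover have "range (\<lambda>k. (f ^^ k) d) = (\<lambda>k. (f ^^ k) d) ` {..<l}"
  proof
    show "range (\<lambda>k. (f ^^ k) d) \<subseteq> (\<lambda>k. (f ^^ k) d) ` {..<l}"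
    proof
      fix x assume "x \<in> range (\<lambda>k. (f ^^ k) d)"
      then obtain k where "x = (f ^^ k) d" by blast
      moreover have "(f ^^ (k mod l)) d = (f ^^ k) d" using l by (intro funpow_mod_eq) (simp add: P_def)
      moreover have "k mod l < l" using l by (simp add: P_def)
      ultimately show "x \<in> (\<lambda>k. (f ^^ k) d) ` {..<l}" by (intro image_eqI[of _ _ "k mod l"]) auto
    qed
  qed auto
  ultimately show ?thesis using that l by (auto simp: P_def)
qed

text \<open>Removing one orbit at a time: an orbit of two elements contributes two terms of equal
  parity, a fixed point an even term.\<close>

lemma even_sum_involution:
  fixes h :: "'a \<Rightarrow> int"
  assumes "finite K" "\<And>k. k \<in> K \<Longrightarrow> a k \<in> K" "\<And>k. k \<in> K \<Longrightarrow> a (a k) = k"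
    "\<And>k. k \<in> K \<Longrightarrow> even (h (a k)) = even (h k)" "\<And>k. k \<in> K \<Longrightarrow> a k = k \<Longrightarrow> even (h k)"
  shows "even (sum h K)"
  using assms
proof (induction "card K" arbitrary: K rule: less_induct)
  case less
  show ?case
  proof (cases "K = {}")
    case False
    then obtain k where k: "k \<in> K" by blast
    define K' where "K' = K - {k, a k}"
    have "card K' < card K" unfolding K'_def using less.prems(1) k by (intro psubset_card_mono) auto
    moreover have "a x \<in> K'" if "x \<in> K'" for x
    proof -
      have x: "x \<in> K" "x \<noteq> k" "x \<noteq> a k" using that by (auto simp: K'_def)
      have "a x \<noteq> k" using less.prems(3)[OF x(1)] x(3) by auto
      moreover have "a x \<noteq> a k" using less.prems(3)[OF x(1)] less.prems(3)[OF k] x(2) by metis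
      ultimately show ?thesis using less.prems(2)[OF x(1)] by (simp add: K'_def)
    qed
    ultimately have "even (sum h K')"
      using less.prems by (intro less.hyps) (auto simp: K'_def)
    moreover have "even (sum h {k, a k})"
    proof (cases "a k = k")
      case True then show ?thesis using less.prems(5)[OF k] by simp
    next
      case False
      then have "sum h {k, a k} = h k + h (a k)" by simp
      then show ?thesis using less.prems(4)[OF k] by simp
    qed
    moreover have "sum h K = sum h K' + sum h {k, a k}"
      unfolding K'_def using less.prems(1,2) k by (intro sum.subset_diff) auto
    ultimately show ?thesis by simp
  qed simp
qed

text \<open>For \<open>z\<close> farther out than the whole path, \<open>1 - w / z\<close> stays in
  the right half-plane, where \<open>Ln\<close> is continuous. Even for an open path the winding
  number is then a difference of values at its ends, ready to telescope.\<close>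

lemma winding_number_far:
  assumes g: "path \<gamma>" and far: "\<And>w. w \<in> path_image \<gamma> \<Longrightarrow> cmod w < cmod z"
  shows "winding_number \<gamma> z = (Ln (1 - pathfinish \<gamma> / z) - Ln (1 - pathstart \<gamma> / z)) / (2 * of_real pi * \<i>)"
proof -
  have z0: "z \<noteq> 0" using far[OF pathstart_in_path_image] by auto
  have pos: "0 < Re (1 - w / z)" if "cmod w < cmod z" for w
  proof -
    have "Re (w / z) \<le> cmod (w / z)" by (rule complex_Re_le_cmod)
    also have "\<dots> < 1" using that z0 by (simp add: norm_divide)
    finally show ?thesis by simp
  qed
  have nz: "1 - w / z \<noteq> 0" if "cmod w < cmod z" for w using pos[OF that] by (metis less_irrefl zero_complex.sel(1))
  \<comment> \<open>Since \<open>\<gamma> t - z\<close> is the product of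
    \<open>1 - \<gamma> t / z\<close> and \<open>- z\<close>, this is a logarithm of it; the
    constant summand cancels between the ends.\<close>
  define q where "q t = Ln (1 - \<gamma> t / z) + Ln (- z)" for t
  have "path q"
  proof -
    have "continuous_on {0..1} \<gamma>" using g by (simp add: path_def)
    moreover have "1 - \<gamma> t / z \<notin> \<real>\<^sub>\<le>\<^sub>0" if "t \<in> {0..1}" for t
      using pos[OF far, of "\<gamma> t"] that by (auto simp: path_image_def complex_nonpos_Reals_iff)
    ultimately show ?thesis unfolding path_def q_def[abs_def] using z0 by (intro continuous_intros) auto
  qed
  have "winding_number \<gamma> z = winding_number (\<lambda>t. \<gamma> t - z) 0" by (rule winding_number_offset)
  also have "\<dots> = winding_number (exp \<circ> q) 0"
  proof (rule winding_number_cong)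
    fix t :: real assume "0 \<le> t" "t \<le> 1"
    then have "\<gamma> t \<in> path_image \<gamma>" by (auto simp: path_image_def)
    then have "exp (q t) = (1 - \<gamma> t / z) * (- z)"
      using nz[OF far] z0 by (simp add: q_def exp_add)
    also have "\<dots> = \<gamma> t - z" using z0 by (simp add: field_simps)
    finally show "\<gamma> t - z = (exp \<circ> q) t" by simp
  qed
  also have "\<dots> = (pathfinish q - pathstart q) / (2 * of_real pi * \<i>)"
    using \<open>path q\<close> by (rule winding_number_compose_exp)
  finally show ?thesis by (simp add: q_def pathstart_def pathfinish_def)
qed

text \<open>If \<open>q\<close> is a continuous logarithm of \<gamma>, then
  \<open>of_real pi * \<i> - cnj q\<close> is one of the image path: the argument is shifted by pi
  and the logarithm of the modulus changes sign. The winding number of an open path has an imaginary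
  part that measures this modulus, hence the conjugate.\<close>

lemma winding_number_antipode:
  assumes "path \<gamma>" "0 \<notin> path_image \<gamma>"
  shows "winding_number (\<lambda>t. - 1 / cnj (\<gamma> t)) 0 = cnj (winding_number \<gamma> 0)"
proof -
  have "continuous_on {0..1} \<gamma>" using assms(1) by (simp add: path_def)
  moreover have "\<gamma> t \<noteq> 0" if "t \<in> {0..1}" for t using assms(2) that by (force simp: path_image_def)
  moreover have "contractible {0..1::real}" by (intro convex_imp_contractible) simp
  ultimately obtain q where q1: "continuous_on {0..1} q" and q3: "\<And>t. t \<in> {0..1} \<Longrightarrow> \<gamma> t = exp (q t)"
    using continuous_logarithm_on_contractible[of "{0..1}" \<gamma>] by metis
  have pq: "path q" using q1 by (simp add: path_def)
  have "winding_number \<gamma> 0 = winding_number (exp \<circ> q) 0"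
    using q3 by (intro winding_number_cong) simp
  then have q2: "winding_number \<gamma> 0 = (pathfinish q - pathstart q) / (2 * of_real pi * \<i>)"
    using winding_number_compose_exp[OF pq] by simp
  define r where "r t = of_real pi * \<i> - cnj (q t)" for t
  have "path r" using q1 by (auto simp: path_def r_def[abs_def] intro!: continuous_intros)
  have "winding_number (\<lambda>t. - 1 / cnj (\<gamma> t)) 0 = winding_number (exp \<circ> r) 0"
  proof (rule winding_number_cong)
    fix t :: real assume "0 \<le> t" "t \<le> 1"
    then have "cnj (\<gamma> t) = exp (cnj (q t))" using q3[of t] by (simp add: exp_cnj)
    then show "- 1 / cnj (\<gamma> t) = (exp \<circ> r) t"
      by (simp add: r_def exp_diff)
  qed
  also have "\<dots> = (pathfinish r - pathstart r) / (2 * of_real pi * \<i>)"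
    using \<open>path r\<close> by (rule winding_number_compose_exp)
  also have "pathfinish r - pathstart r = - cnj (pathfinish q - pathstart q)"
    by (simp add: r_def pathstart_def pathfinish_def)
  also have "\<dots> / (2 * of_real pi * \<i>) = cnj (winding_number \<gamma> 0)"
    unfolding q2 by (simp add: diff_divide_distrib)
  finally show ?thesis .
qed

lemma exp_2pi_i_eq_1_imp_Ints:
  assumes "exp (2 * of_real pi * \<i> * w) = 1"
  shows "w \<in> \<int>"
proof -
  obtain n :: int where n: "Re (2 * of_real pi * \<i> * w) = 0" "Im (2 * of_real pi * \<i> * w) = of_int (2 * n) * pi"
    using assms exp_eq_1 by blast
  then have "Re w = of_int n" "Im w = 0" by auto
  then have "w = of_int n" by (simp add: complex_eq_iff)
  then show ?thesis by simp
qed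

lemma sum_lessThan_add:
  "(\<Sum>i<m + n. f i) = (\<Sum>i<m. f i) + (\<Sum>i<n. f (i + m))" for f :: "nat \<Rightarrow> 'a::comm_monoid_add"
  by (induction n) (simp_all add: ac_simps)

section \<open>Component curves as cycles of darts\<close>

context symmetric_map
begin

text \<open>\<open>opp\<close> pairs outgoing ends, so the dart is first reversed to become an
  outgoing end at its own finish.\<close>

definition nxt :: "(real \<Rightarrow> real^3) \<Rightarrow> (real \<Rightarrow> real^3)" where
  "nxt d = opp (reversepath d)"

definition orb :: "(real \<Rightarrow> real^3) \<Rightarrow> (real \<Rightarrow> real^3) set" where
  "orb d = range (\<lambda>k. (nxt ^^ k) d)"

lemma nxt_darts: "d \<in> darts \<Longrightarrow> nxt d \<in> darts"
  unfolding nxt_def by (intro opp(1) reversepath_darts)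

lemma pathstart_nxt: "d \<in> darts \<Longrightarrow> pathstart (nxt d) = pathfinish d"
  unfolding nxt_def using opp(2)[OF reversepath_darts] by simp

text \<open>Reversal conjugates \<open>nxt\<close> to its inverse, because \<open>opp\<close> is an
  involution. The two descent arguments on orbits below rest on this identity.\<close>

lemma nxt_rev_nxt: "d \<in> darts \<Longrightarrow> nxt (reversepath (nxt d)) = reversepath d"
  unfolding nxt_def using opp_opp[OF reversepath_darts] by simp

lemma nxt_anti: "d \<in> darts \<Longrightarrow> nxt (anti d) = anti (nxt d)"
  unfolding nxt_def reversepath_anti using opp_anti[OF reversepath_darts] .

lemma nxt_inj: "inj_on nxt darts"
  by (rule inj_on_inverseI[of _ "\<lambda>d. reversepath (opp d)"])
     (simp add: nxt_def opp_opp reversepath_darts)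

lemma nxt_surj:
  assumes "d \<in> darts"
  obtains d' where "d' \<in> darts" "nxt d' = d"
  using that[of "reversepath (opp d)"] assms opp(1) opp_opp reversepath_darts by (simp add: nxt_def)

lemma funpow_darts: "d \<in> darts \<Longrightarrow> (nxt ^^ k) d \<in> darts"
  by (induction k) (auto simp: nxt_darts)

lemma funpow_anti: "d \<in> darts \<Longrightarrow> (nxt ^^ k) (anti d) = anti ((nxt ^^ k) d)"
proof (induction k)
  case (Suc k)
  then show ?case using nxt_anti[OF funpow_darts[of d k]] by simp
qed simp

lemma orbI: "(nxt ^^ k) x = y \<Longrightarrow> y \<in> orb x"
  by (auto simp: orb_def)

lemma orb_subset: "d \<in> darts \<Longrightarrow> orb d \<subseteq> darts"
  using funpow_darts by (auto simp: orb_def)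

lemma self_in_orb: "d \<in> orb d"
  unfolding orb_def by (rule range_eqI[of _ _ 0]) simp

lemma nxt_in_orb: "x \<in> orb d \<Longrightarrow> nxt x \<in> orb d"
proof -
  assume "x \<in> orb d"
  then obtain k where "x = (nxt ^^ k) d" by (auto simp: orb_def)
  then have "nxt x = (nxt ^^ Suc k) d" by simp
  then show ?thesis unfolding orb_def by blast
qed

lemma funpow_in_orb: "x \<in> orb d \<Longrightarrow> (nxt ^^ k) x \<in> orb d"
  by (induction k) (auto simp: nxt_in_orb)

text \<open>Forward orbits of an injective self-map of a finite set are cycles, so each element of
  an orbit generates it.\<close>

lemma orb_eq:
  assumes d: "d \<in> darts" and x: "x \<in> orb d"
  shows "orb x = orb d"
proof -
  obtain l where l: "0 < l" "(nxt ^^ l) d = d" "orb d = (\<lambda>k. (nxt ^^ k) d) ` {..<l}"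
    using funpow_orbit_period[OF finite_darts nxt_darts nxt_inj d] unfolding orb_def by metis
  obtain k where k: "k < l" "x = (nxt ^^ k) d" using x l(3) by auto
  have "(nxt ^^ (l - k)) x = (nxt ^^ (l - k + k)) d" unfolding k(2) funpow_add comp_apply ..
  then have "d = (nxt ^^ (l - k)) x" using k(1) l(2) by simp
  then have dx: "d \<in> orb x" unfolding orb_def by blast
  have "orb x \<subseteq> orb d" using funpow_in_orb[OF x] by (auto simp: orb_def[of x])
  moreover have "orb d \<subseteq> orb x" using funpow_in_orb[OF dx] by (auto simp: orb_def[of d])
  ultimately show ?thesis by blast
qed

lemma prev_in_orb:
  assumes d: "d \<in> darts" and x: "x \<in> orb d"
  shows "reversepath (opp x) \<in> orb d"
proof -
  have xd: "x \<in> darts" using orb_subset[OF d] x by blast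
  obtain y where y: "y = reversepath (opp x)" "y \<in> darts" "nxt y = x"
    using xd opp(1) opp_opp reversepath_darts by (simp add: nxt_def)
  then have "x \<in> orb y" using nxt_in_orb[OF self_in_orb] by metis
  then have "orb x = orb y" using orb_eq[OF y(2)] by blast
  then show ?thesis using orb_eq[OF d x] self_in_orb[of y] y(1) by blast
qed

lemma orb_anti: "d \<in> darts \<Longrightarrow> orb (anti d) = anti ` orb d"
  using funpow_anti by (auto simp: orb_def)

lemma orb_reversepath:
  assumes d: "d \<in> darts"
  shows "orb (reversepath d) = reversepath ` orb d"
proof -
  have sub: "reversepath ` orb c \<subseteq> orb (reversepath c)" if c: "c \<in> darts" for c
  proof
    fix y assume "y \<in> reversepath ` orb c"
    then obtain k where y: "y = reversepath ((nxt ^^ k) c)" by (auto simp: orb_def)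
    have "(nxt ^^ k) y = reversepath c"
      unfolding y
    proof (induction k)
      case (Suc k)
      have a: "(nxt ^^ Suc k) z = (nxt ^^ k) (nxt z)" for z by (simp only: funpow_Suc_right comp_apply)
      have b: "(nxt ^^ Suc k) c = nxt ((nxt ^^ k) c)" by simp
      have "(nxt ^^ Suc k) (reversepath ((nxt ^^ Suc k) c)) = (nxt ^^ k) (nxt (reversepath ((nxt ^^ Suc k) c)))"
        by (rule a)
      also have "\<dots> = (nxt ^^ k) (reversepath ((nxt ^^ k) c))"
        unfolding b nxt_rev_nxt[OF funpow_darts[OF c]] ..
      also have "\<dots> = reversepath c" by (rule Suc)
      finally show ?case .
    qed simp
    then have "reversepath c \<in> orb y" by (rule orbI)
    moreover have "y \<in> darts" unfolding y using funpow_darts[OF c] reversepath_darts by blast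
    ultimately show "y \<in> orb (reversepath c)" using orb_eq self_in_orb by metis
  qed
  have "orb (reversepath d) \<subseteq> reversepath ` orb d"
  proof
    fix y assume "y \<in> orb (reversepath d)"
    then have "reversepath y \<in> orb d" using sub[OF reversepath_darts[OF d]] by auto
    then show "y \<in> reversepath ` orb d" by (metis image_eqI reversepath_reversepath)
  qed
  then show ?thesis using sub[OF d] by blast
qed

text \<open>If the reversal of \<open>d\<close> were reached after \<open>k\<close> steps, the
  reversal of \<open>nxt d\<close> would be reached from \<open>nxt d\<close> after
  \<open>k - 2\<close>. The descent ends with a dart equal to its reversal or with a fixed point of
  \<open>opp\<close>, both impossible. Hence a curve uses each of its edges in one direction
  only.\<close>

lemma reversepath_notin_orb:
  assumes "d \<in> darts"
  shows "reversepath d \<notin> orb d"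
proof -
  have "\<forall>d\<in>darts. reversepath d \<noteq> (nxt ^^ k) d" for k
  proof (induction k rule: nat_less_induct)
    case (1 k)
    show ?case
    proof
      fix d assume d: "d \<in> darts"
      consider "k = 0" | "k = 1" | j where "k = Suc (Suc j)" by (metis One_nat_def not0_implies_Suc)
      then show "reversepath d \<noteq> (nxt ^^ k) d"
      proof cases
        case 1 then show ?thesis using reversepath_ne[OF dart_simple[OF d]] by simp
      next
        case 2 then show ?thesis using opp_ne[OF reversepath_darts[OF d]] by (simp add: nxt_def)
      next
        case 3
        show ?thesis
        proof
          assume "reversepath d = (nxt ^^ k) d"
          then have "nxt (reversepath (nxt d)) = nxt ((nxt ^^ j) (nxt d))"
            using nxt_rev_nxt[OF d] 3 by (simp add: funpow_swap1)
          then have "reversepath (nxt d) = (nxt ^^ j) (nxt d)"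
            using inj_onD[OF nxt_inj] nxt_darts[OF d] reversepath_darts funpow_darts by metis
          moreover have "j < k" using 3 by simp
          ultimately show False using 1 nxt_darts[OF d] by blast
        qed
      qed
    qed
  qed
  then show ?thesis using assms by (auto simp: orb_def)
qed

lemma vert_uminus_ne: "x \<in> verts M \<Longrightarrow> - x \<noteq> x"
  using map_finite(4)[OF map] sphere_uminus_ne[of x] by (auto simp: support_def)

text \<open>The antipodal map acts on a self-antipodal curve preserving its direction: otherwise it would
  reflect the cyclic sequence of darts, hence fix an edge or a vertex.\<close>

lemma anti_notin_orb_reversepath:
  assumes "d \<in> darts"
  shows "anti d \<notin> orb (reversepath d)"
proof -
  have "\<forall>d\<in>darts. anti d \<noteq> (nxt ^^ k) (reversepath d)" for k
  proof (induction k rule: nat_less_induct)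
    case (1 k)
    show ?case
    proof
      fix d assume d: "d \<in> darts"
      consider "k = 0" | "k = 1" | j where "k = Suc (Suc j)" by (metis One_nat_def not0_implies_Suc)
      then show "anti d \<noteq> (nxt ^^ k) (reversepath d)"
      proof cases
        case 1
        have "dart_edge (anti d) \<noteq> dart_edge (reversepath d)"
          using antipode_edge_ne[OF map sym dart_path(2)[OF d]] by simp
        then show ?thesis using 1 by (metis funpow_0)
      next
        case 2
        have "pathstart (anti d) \<noteq> pathstart (opp d)"
          using vert_uminus_ne[OF dart_start(1)[OF d]] opp(2)[OF d] by (simp add: pathstart_anti)
        then show ?thesis using 2 by (auto simp: nxt_def)
      next
        case 3
        show ?thesis
        proof
          assume eq: "anti d = (nxt ^^ k) (reversepath d)"
          \<comment> \<open>Passing to the predecessor of \<open>d\<close> shortens the distance at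
            both ends, again by two steps.\<close>
          obtain c where c: "c \<in> darts" "nxt c = d" using nxt_surj[OF d] by blast
          have "(nxt ^^ k) (reversepath d) = nxt ((nxt ^^ j) (nxt (reversepath d)))"
            using 3 by (simp add: funpow_swap1)
          also have "nxt (reversepath d) = reversepath c" using nxt_rev_nxt[OF c(1)] c(2) by simp
          finally have "nxt (anti c) = nxt ((nxt ^^ j) (reversepath c))"
            using eq nxt_anti[OF c(1)] c(2) by simp
          then have "anti c = (nxt ^^ j) (reversepath c)"
            using inj_onD[OF nxt_inj] anti_darts[OF c(1)] reversepath_darts[OF c(1)] funpow_darts by metis
          moreover have "j < k" using 3 by simp
          ultimately show False using 1 c(1) by blast
        qed
      qed
    qed
  qed
  then show ?thesis using assms by (auto simp: orb_def)
qed

text \<open>\<open>straight\<close> permits leaving an edge at either end, so it leads from a dart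
  to the next or to the previous one; the latter is in the forward orbit too, since orbits are
  cycles.\<close>

lemma component_orb:
  assumes d: "d \<in> darts"
  shows "(straight M)\<^sup>* `` {dart_edge d} = dart_edge ` orb d"
proof
  show "(straight M)\<^sup>* `` {dart_edge d} \<subseteq> dart_edge ` orb d"
  proof
    fix e assume "e \<in> (straight M)\<^sup>* `` {dart_edge d}"
    then have "(dart_edge d, e) \<in> (straight M)\<^sup>*" by simp
    then show "e \<in> dart_edge ` orb d"
    proof (induction rule: rtrancl_induct)
      case base then show ?case using self_in_orb by blast
    next
      case (step e e')
      obtain x where x: "x \<in> darts" "dart_edge x = e" "dart_edge (opp x) = e'" using step(2) straight_iff by blast
      obtain y where y: "y \<in> orb d" "e = dart_edge y" using step(3) by blast
      have yd: "y \<in> darts" using y orb_subset[OF d] by blast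
      consider "x = y" | "x = reversepath y" using dart_edge_eqD[OF yd x(1)] x y by auto
      then show ?case
      proof cases
        case 1
        then have "e' = dart_edge (reversepath (opp y))" using x by simp
        then show ?thesis using prev_in_orb[OF d y(1)] by blast
      next
        case 2
        then have "e' = dart_edge (nxt y)" using x by (simp add: nxt_def)
        then show ?thesis using nxt_in_orb[OF y(1)] by blast
      qed
    qed
  qed
  show "dart_edge ` orb d \<subseteq> (straight M)\<^sup>* `` {dart_edge d}"
  proof
    fix e assume "e \<in> dart_edge ` orb d"
    then obtain k where e: "e = dart_edge ((nxt ^^ k) d)" by (auto simp: orb_def)
    have "(dart_edge d, dart_edge ((nxt ^^ k) d)) \<in> (straight M)\<^sup>*"
    proof (induction k)
      case (Suc k)
      have "(dart_edge ((nxt ^^ k) d), dart_edge ((nxt ^^ Suc k) d)) \<in> straight M"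
        using straight_iff reversepath_darts[OF funpow_darts[OF d]]
        by (auto simp: nxt_def intro!: bexI[of _ "reversepath ((nxt ^^ k) d)"])
      then show ?case using Suc by (rule rtrancl_into_rtrancl[rotated])
    qed simp
    then show "e \<in> (straight M)\<^sup>* `` {dart_edge d}" using e by simp
  qed
qed

definition comps :: "(real^3) set set set" where
  "comps = edges M // (straight M)\<^sup>*"

lemma comps_eq: "comps = (\<lambda>d. dart_edge ` orb d) ` darts"
proof -
  have "comps = (\<lambda>e. (straight M)\<^sup>* `` {e}) ` edges M" by (auto simp: comps_def quotient_def)
  also have "edges M = dart_edge ` darts" using dart_exists dart_path(2) by blast
  also have "(\<lambda>e. (straight M)\<^sup>* `` {e}) ` dart_edge ` darts = (\<lambda>d. dart_edge ` orb d) ` darts"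
    unfolding image_image by (intro image_cong refl component_orb)
  finally show ?thesis .
qed

lemma finite_comps: "finite comps"
  unfolding comps_eq using finite_darts by simp

lemma comps_eqI:
  assumes "d \<in> darts" "d' \<in> darts" "x \<in> orb d" "y \<in> orb d'" "dart_edge x = dart_edge y"
  shows "dart_edge ` orb d = dart_edge ` orb d'"
proof -
  have "x \<in> darts" "y \<in> darts" using assms orb_subset by blast+
  then have "dart_edge ` orb x = dart_edge ` orb y"
    using component_orb assms(5) by metis
  then show ?thesis unfolding orb_eq[OF assms(1,3)] orb_eq[OF assms(2,4)] .
qed

lemma dart_edge_inj_orb:
  assumes "d \<in> darts"
  shows "inj_on dart_edge (orb d)"
proof (rule inj_onI)
  fix x y assume xy: "x \<in> orb d" "y \<in> orb d" "dart_edge x = dart_edge y"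
  then have xd: "x \<in> darts" "y \<in> darts" using orb_subset[OF assms] by blast+
  have "y \<noteq> reversepath x"
    using reversepath_notin_orb[OF xd(1)] orb_eq[OF assms xy(1)] xy(2) by auto
  then show "x = y" using dart_edge_eqD[OF xd xy(3)] by auto
qed

definition rep :: "(real^3) set set \<Rightarrow> real \<Rightarrow> real^3" where
  "rep k = (SOME d. d \<in> darts \<and> dart_edge ` orb d = k)"

lemma rep:
  assumes "k \<in> comps"
  shows "rep k \<in> darts" "dart_edge ` orb (rep k) = k"
proof -
  have "\<exists>d. d \<in> darts \<and> dart_edge ` orb d = k" using assms by (auto simp: comps_eq)
  then have "rep k \<in> darts \<and> dart_edge ` orb (rep k) = k" unfolding rep_def by (rule someI_ex)
  then show "rep k \<in> darts" "dart_edge ` orb (rep k) = k" by auto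
qed

text \<open>A choice of direction for every component. The set is closed under \<open>nxt\<close>
  and contains exactly one dart of each edge.\<close>

definition orientation :: "(real \<Rightarrow> real^3) set" where
  "orientation = (\<Union>k\<in>comps. orb (rep k))"

lemma orientation_subset: "orientation \<subseteq> darts"
  using rep(1) orb_subset by (auto simp: orientation_def)

lemma orientation_nxt: "d \<in> orientation \<Longrightarrow> nxt d \<in> orientation"
  using nxt_in_orb by (auto simp: orientation_def)

lemma orientation_exists:
  assumes "e \<in> edges M"
  shows "\<exists>d\<in>orientation. dart_edge d = e"
proof -
  obtain d where d: "d \<in> darts" "dart_edge d = e" using dart_exists[OF assms] by blast
  define k where "k = dart_edge ` orb d"
  have k: "k \<in> comps" using d by (auto simp: comps_eq k_def)
  have "e \<in> k" using d self_in_orb by (auto simp: k_def)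
  then have "e \<in> dart_edge ` orb (rep k)" using rep(2)[OF k] by simp
  then show ?thesis using k by (auto simp: orientation_def)
qed

lemma orb_rep_disjoint:
  assumes "k \<in> comps" "k' \<in> comps" "x \<in> orb (rep k)" "y \<in> orb (rep k')" "dart_edge x = dart_edge y"
  shows "k = k'"
  using comps_eqI[OF rep(1)[OF assms(1)] rep(1)[OF assms(2)] assms(3-5)]
  unfolding rep(2)[OF assms(1)] rep(2)[OF assms(2)] .

lemma orientation_inj: "inj_on dart_edge orientation"
proof (rule inj_onI)
  fix x y assume xy: "x \<in> orientation" "y \<in> orientation" "dart_edge x = dart_edge y"
  then obtain k k' where k: "k \<in> comps" "x \<in> orb (rep k)" "k' \<in> comps" "y \<in> orb (rep k')"
    by (auto simp: orientation_def)
  have "k = k'" using orb_rep_disjoint[OF k(1,3,2,4) xy(3)] .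
  have "x \<in> orb (rep k)" "y \<in> orb (rep k)" using k(2,4) \<open>k = k'\<close> by simp_all
  then show "x = y" using dart_edge_inj_orb[OF rep(1)[OF k(1)]] xy(3) by (simp add: inj_on_def)
qed

lemma sum_orientation: "sum f orientation = (\<Sum>k\<in>comps. sum f (orb (rep k)))"
  unfolding orientation_def
proof (rule sum.UNION_disjoint)
  show "\<forall>k\<in>comps. finite (orb (rep k))" using rep(1) orb_subset finite_darts finite_subset by metis
  show "\<forall>k\<in>comps. \<forall>k'\<in>comps. k \<noteq> k' \<longrightarrow> orb (rep k) \<inter> orb (rep k') = {}"
    using orb_rep_disjoint by blast
qed (rule finite_comps)

end

section \<open>Winding numbers of the projected curves\<close>

locale projected_map = symmetric_map M + stereo p u v for M :: sphere_map and p u v :: "real^3" +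
  assumes p_sphere: "p \<in> sphere 0 1" and p_off: "p \<notin> support M"
begin

abbreviation K :: "complex set" where "K \<equiv> proj ` support M"

text \<open>Taken dart by dart, and darts need not be closed, so the value is a complex number;
  integers arise only from sums over sets of darts closed under \<open>nxt\<close>.\<close>

definition wind :: "(real \<Rightarrow> real^3) \<Rightarrow> complex \<Rightarrow> complex" where
  "wind d z = winding_number (proj \<circ> d) z"

lemma supp: "support M \<subseteq> sphere 0 1 - {p}"
  using map_finite(4)[OF map] p_off by blast

lemma proj_dart:
  assumes "d \<in> darts"
  shows "path (proj \<circ> d)" "path_image (proj \<circ> d) \<subseteq> K"
    "pathstart (proj \<circ> d) = proj (pathstart d)" "pathfinish (proj \<circ> d) = proj (pathfinish d)"
proof -
  have "path_image d \<subseteq> sphere 0 1 - {p}" using dart_support[OF assms] supp by blast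
  then show "path (proj \<circ> d)"
    using simple_path_imp_path[OF dart_simple[OF assms]] continuous_on_proj
    by (intro path_continuous_image) (auto intro: continuous_on_subset)
  show "path_image (proj \<circ> d) \<subseteq> K" using dart_support[OF assms] by (auto simp: path_image_compose)
qed (simp_all add: pathstart_compose pathfinish_compose)

lemma proj_start_in_K: "d \<in> darts \<Longrightarrow> proj (pathstart d) \<in> K" "d \<in> darts \<Longrightarrow> proj (pathfinish d) \<in> K"
  using dart_start by (auto simp: support_def)

lemma wind_reversepath:
  assumes "d \<in> darts" "z \<notin> K"
  shows "wind (reversepath d) z = - wind d z"
proof -
  have "proj \<circ> reversepath d = reversepath (proj \<circ> d)" by (simp add: reversepath_def comp_def)
  then show ?thesis
    using winding_number_reversepath[OF proj_dart(1)[OF assms(1)], of z] proj_dart(2)[OF assms(1)] assms(2)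
    by (auto simp: wind_def)
qed

lemma exp_wind:
  assumes "d \<in> darts" "z \<notin> K"
  shows "exp (2 * of_real pi * \<i> * wind d z) = (proj (pathfinish d) - z) / (proj (pathstart d) - z)"
proof -
  have "proj (pathstart d) - z \<noteq> 0" using proj_start_in_K(1)[OF assms(1)] assms(2) by auto
  moreover have "z \<notin> path_image (proj \<circ> d)" using proj_dart(2)[OF assms(1)] assms(2) by blast
  ultimately show ?thesis
    using winding_number_exp_2pi[OF proj_dart(1)[OF assms(1)], of z] proj_dart(3,4)[OF assms(1)]
    by (simp add: wind_def field_simps)
qed

text \<open>The exponentials multiply to a quotient of two products over the same points, because
  \<open>nxt\<close> permutes \<open>A\<close> and matches finishes with starts. In this way no
  closed path has to be assembled from the darts.\<close>

lemma sum_wind_Ints: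
  assumes A: "A \<subseteq> darts" "\<And>d. d \<in> A \<Longrightarrow> nxt d \<in> A" and z: "z \<notin> K"
  shows "(\<Sum>d\<in>A. wind d z) \<in> \<int>"
proof -
  have fin: "finite A" using A(1) finite_darts finite_subset by blast
  have bij: "bij_betw nxt A A"
    using inj_on_subset[OF nxt_inj A(1)] A(2) fin endo_inj_surj[of A nxt] by (auto simp: bij_betw_def)
  have ne: "(\<Prod>d\<in>A. proj (pathstart d) - z) \<noteq> 0"
    using fin proj_start_in_K(1) A(1) z by (auto simp: prod_zero_iff)
  have "exp (2 * of_real pi * \<i> * (\<Sum>d\<in>A. wind d z)) = (\<Prod>d\<in>A. exp (2 * of_real pi * \<i> * wind d z))"
    using fin by (simp add: sum_distrib_left exp_sum)
  also have "\<dots> = (\<Prod>d\<in>A. (proj (pathfinish d) - z) / (proj (pathstart d) - z))"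
    using exp_wind A(1) z by (intro prod.cong) auto
  also have "\<dots> = (\<Prod>d\<in>A. proj (pathfinish d) - z) / (\<Prod>d\<in>A. proj (pathstart d) - z)"
    by (rule prod_dividef)
  also have "(\<Prod>d\<in>A. proj (pathfinish d) - z) = (\<Prod>d\<in>A. proj (pathstart (nxt d)) - z)"
    using pathstart_nxt A(1) by (intro prod.cong) auto
  also have "\<dots> = (\<Prod>d\<in>A. proj (pathstart d) - z)"
    by (rule prod.reindex_bij_betw[OF bij])
  also have "\<dots> / \<dots> = 1" using ne by simp
  finally show ?thesis by (rule exp_2pi_i_eq_1_imp_Ints)
qed

text \<open>The differences of logarithms given by \<open>winding_number_far\<close> cancel along
  the cycles of \<open>nxt\<close>.\<close>

lemma sum_wind_far:
  assumes A: "A \<subseteq> darts" "\<And>d. d \<in> A \<Longrightarrow> nxt d \<in> A" and far: "\<And>w. w \<in> K \<Longrightarrow> cmod w < cmod z"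
  shows "(\<Sum>d\<in>A. wind d z) = 0"
proof -
  have fin: "finite A" using A(1) finite_darts finite_subset by blast
  have bij: "bij_betw nxt A A"
    using inj_on_subset[OF nxt_inj A(1)] A(2) fin endo_inj_surj[of A nxt] by (auto simp: bij_betw_def)
  define L where "L d = Ln (1 - proj (pathstart d) / z) / (2 * of_real pi * \<i>)" for d
  have "wind d z = L (nxt d) - L d" if "d \<in> A" for d
  proof -
    have d: "d \<in> darts" using that A by blast
    have "cmod w < cmod z" if "w \<in> path_image (proj \<circ> d)" for w
      using far that proj_dart(2)[OF d] by blast
    then show ?thesis
      unfolding wind_def L_def
      by (subst winding_number_far[OF proj_dart(1)[OF d]])
         (simp_all add: proj_dart(3,4)[OF d] pathstart_nxt[OF d] diff_divide_distrib)
  qed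
  then have "(\<Sum>d\<in>A. wind d z) = (\<Sum>d\<in>A. L (nxt d) - L d)" by (intro sum.cong) auto
  also have "\<dots> = (\<Sum>d\<in>A. L (nxt d)) - (\<Sum>d\<in>A. L d)" by (rule sum_subtractf)
  also have "(\<Sum>d\<in>A. L (nxt d)) = (\<Sum>d\<in>A. L d)" by (rule sum.reindex_bij_betw[OF bij])
  finally show ?thesis by simp
qed

lemma zero_notin_K: "0 \<notin> K"
proof
  assume "0 \<in> K"
  then obtain x where x: "x \<in> support M" "proj x = 0" by auto
  have "x \<in> sphere 0 1 - {p}" using x(1) supp by blast
  then have "x = - p" using proj_eq_0_iff[of x] x(2) by blast
  then show False using x p_off support_uminus_iff[of p] by simp
qed

lemma proj_uminus_support: "x \<in> support M \<Longrightarrow> proj (- x) = - 1 / cnj (proj x)"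
proof (rule proj_uminus)
  assume x: "x \<in> support M"
  show "x \<in> sphere 0 1 - {p}" using x supp by blast
  show "x \<noteq> - p" using x p_off support_uminus_iff[of p] by auto
qed

lemma wind_anti:
  assumes d: "d \<in> darts"
  shows "wind (anti d) 0 = cnj (wind d 0)"
proof -
  have "wind (anti d) 0 = winding_number (\<lambda>t. - 1 / cnj ((proj \<circ> d) t)) 0"
    unfolding wind_def
  proof (rule winding_number_cong)
    fix t :: real assume "0 \<le> t" "t \<le> 1"
    then have "d t \<in> support M" using dart_support[OF d] by (auto simp: path_image_def)
    then show "(proj \<circ> anti d) t = - 1 / cnj ((proj \<circ> d) t)" using proj_uminus_support by simp
  qed
  also have "\<dots> = cnj (wind d 0)"
    unfolding wind_def
  proof (rule winding_number_antipode)
    show "path (proj \<circ> d)" by (rule proj_dart(1)[OF d])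
    show "0 \<notin> path_image (proj \<circ> d)" using proj_dart(2)[OF d] zero_notin_K by blast
  qed
  finally show ?thesis .
qed

definition comp_wind :: "(real^3) set set \<Rightarrow> complex" where
  "comp_wind k = (\<Sum>d\<in>orb (rep k). wind d 0)"

lemma comp_wind_Ints: "k \<in> comps \<Longrightarrow> comp_wind k \<in> \<int>"
  unfolding comp_wind_def by (intro sum_wind_Ints orb_subset rep(1) zero_notin_K nxt_in_orb)

lemma antipode_comp:
  assumes "d \<in> darts"
  shows "(\<lambda>e. antipode ` e) ` dart_edge ` orb d = dart_edge ` orb (anti d)"
  unfolding orb_anti[OF assms] image_image by simp

lemma antipode_comps: "k \<in> comps \<Longrightarrow> (\<lambda>e. antipode ` e) ` k \<in> comps"
  using antipode_comp anti_darts by (auto simp: comps_eq)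

text \<open>The sign compares two independent choices of direction: the antipode of one
  representative may run along the other representative or against it.\<close>

lemma comp_wind_antipode:
  assumes k: "k \<in> comps"
  defines "k' \<equiv> (\<lambda>e. antipode ` e) ` k"
  shows "comp_wind k' = comp_wind k \<or> comp_wind k' = - comp_wind k"
proof -
  note r = rep[OF k]
  have k': "k' \<in> comps" unfolding k'_def by (rule antipode_comps[OF k])
  note r' = rep[OF k']
  \<comment> \<open>An integer equals its conjugate, which absorbs the conjugation in
    \<open>wind_anti\<close>.\<close>
  have real: "cnj (comp_wind k) = comp_wind k" using comp_wind_Ints[OF k] by (auto elim: Ints_cases)
  have eq: "dart_edge ` orb (rep k') = dart_edge ` orb (anti (rep k))"
    using r'(2) antipode_comp[OF r(1)] r(2) by (simp add: k'_def)
  have "dart_edge (rep k') \<in> dart_edge ` orb (anti (rep k))" using eq self_in_orb by blast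
  then obtain y where y: "y \<in> orb (anti (rep k))" "dart_edge (rep k') = dart_edge y" by blast
  have ad: "anti (rep k) \<in> darts" by (rule anti_darts[OF r(1)])
  have yd: "y \<in> darts" using y(1) orb_subset[OF ad] by blast
  have sum_anti: "(\<Sum>d\<in>orb (anti (rep k)). wind d 0) = comp_wind k"
  proof -
    have "inj_on anti (orb (rep k))" by (rule inj_on_inverseI[of _ anti]) simp
    then have "(\<Sum>d\<in>orb (anti (rep k)). wind d 0) = (\<Sum>d\<in>orb (rep k). wind (anti d) 0)"
      unfolding orb_anti[OF r(1)] by (simp add: sum.reindex)
    also have "\<dots> = (\<Sum>d\<in>orb (rep k). cnj (wind d 0))"
      using wind_anti orb_subset[OF r(1)] by (intro sum.cong) auto
    also have "\<dots> = cnj (comp_wind k)" by (simp add: comp_wind_def)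
    finally show ?thesis using real by simp
  qed
  consider "rep k' = y" | "rep k' = reversepath y" using dart_edge_eqD[OF yd r'(1)] y(2) by auto
  then show ?thesis
  proof cases
    case 1
    then have "orb (rep k') = orb (anti (rep k))" using orb_eq[OF ad y(1)] by simp
    then show ?thesis using sum_anti by (simp add: comp_wind_def)
  next
    case 2
    have "orb (rep k') = reversepath ` orb (anti (rep k))"
      using 2 orb_reversepath[OF yd] orb_eq[OF ad y(1)] by simp
    moreover have "inj_on reversepath (orb (anti (rep k)))" by (rule inj_on_inverseI[of _ reversepath]) simp
    ultimately have "comp_wind k' = (\<Sum>d\<in>orb (anti (rep k)). wind (reversepath d) 0)"
      unfolding comp_wind_def by (simp add: sum.reindex)
    also have "\<dots> = (\<Sum>d\<in>orb (anti (rep k)). - wind d 0)"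
      using wind_reversepath[OF _ zero_notin_K] orb_subset[OF ad] by (intro sum.cong) auto
    also have "\<dots> = - comp_wind k" using sum_anti by (simp add: sum_negf)
    finally show ?thesis by blast
  qed
qed

text \<open>Half of a self-antipodal curve leads from a point \<open>s\<close> to \<open>-1 / cnj s\<close>, so its winding number
  is half an odd integer; the other half contributes the conjugate.\<close>

lemma comp_wind_self_antipodal:
  assumes k: "k \<in> comps" and self: "(\<lambda>e. antipode ` e) ` k = k"
  shows "\<exists>n::int. odd n \<and> comp_wind k = of_int n"
proof -
  define d where "d = rep k"
  have d: "d \<in> darts" "dart_edge ` orb d = k" using rep[OF k] by (auto simp: d_def)
  have "dart_edge ` orb (anti d) = k" using antipode_comp[OF d(1)] self d(2) by simp
  moreover have "dart_edge (anti d) \<in> dart_edge ` orb (anti d)" by (rule imageI[OF self_in_orb])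
  ultimately have "dart_edge (anti d) \<in> dart_edge ` orb d" unfolding d(2) by simp
  then obtain y where y: "y \<in> orb d" "dart_edge (anti d) = dart_edge y" by blast
  have yd: "y \<in> darts" using y orb_subset[OF d(1)] by blast
  have "anti d \<noteq> reversepath y"
    using anti_notin_orb_reversepath[OF d(1)] orb_reversepath[OF d(1)] y(1) by auto
  then have "anti d \<in> orb d" using dart_edge_eqD[OF yd anti_darts[OF d(1)]] y by auto
  moreover obtain l where l: "0 < l" "(nxt ^^ l) d = d" "inj_on (\<lambda>k. (nxt ^^ k) d) {..<l}"
      "orb d = (\<lambda>k. (nxt ^^ k) d) ` {..<l}"
    using funpow_orbit_period[OF finite_darts nxt_darts nxt_inj d(1)] unfolding orb_def by metis
  ultimately obtain m where m: "m < l" "anti d = (nxt ^^ m) d" by auto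
  have "anti d \<noteq> d"
  proof
    assume "anti d = d"
    then have "pathstart (anti d) = pathstart d" by simp
    then show False using vert_uminus_ne[OF dart_start(1)[OF d(1)]] by (simp add: pathstart_anti)
  qed
  then have m0: "0 < m" using m by (cases m) auto
  have "(nxt ^^ (m + m)) d = (nxt ^^ m) (anti d)" using m by (simp add: funpow_add)
  also have "\<dots> = d" using funpow_anti[OF d(1), of m] m(2) by (metis anti_anti)
  finally have mm: "(nxt ^^ (m + m)) d = d" .
  have ml: "(m + m) mod l = 0"
  proof -
    have "(nxt ^^ ((m + m) mod l)) d = (nxt ^^ 0) d" using funpow_mod_eq[OF l(2), of "m + m"] mm by simp
    then show ?thesis using inj_onD[OF l(3)] l(1) by simp
  qed
  \<comment> \<open>\<open>l\<close> divides \<open>m + m\<close> while \<open>0 < m\<close> and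
    \<open>m < l\<close>, so the antipodal map shifts the curve by exactly half its period.\<close>
  have lm: "l = m + m"
  proof -
    obtain q where q: "m + m = l * q" using ml by (metis mod_0_imp_dvd dvdE)
    have "m + m < l * 2" using m(1) by simp
    then have "l * q < l * 2" unfolding q .
    then have "q < 2" using mult_less_cancel1 by blast
    moreover have "q \<noteq> 0" using q m0 by (cases q) auto
    ultimately have "q = 1" by simp
    then show ?thesis using q by simp
  qed
  define X where "X = (\<Sum>i<m. wind ((nxt ^^ i) d) 0)"
  have "comp_wind k = (\<Sum>i<m + m. wind ((nxt ^^ i) d) 0)"
    unfolding comp_wind_def d_def[symmetric] l(4) using l(3) lm by (simp add: sum.reindex)
  also have "\<dots> = X + (\<Sum>i<m. wind ((nxt ^^ (i + m)) d) 0)"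
    unfolding X_def by (rule sum_lessThan_add)
  also have "(\<Sum>i<m. wind ((nxt ^^ (i + m)) d) 0) = (\<Sum>i<m. cnj (wind ((nxt ^^ i) d) 0))"
  proof (rule sum.cong)
    fix i
    have "(nxt ^^ (i + m)) d = anti ((nxt ^^ i) d)"
      using funpow_anti[OF d(1), of i] m(2) by (simp add: funpow_add)
    then show "wind ((nxt ^^ (i + m)) d) 0 = cnj (wind ((nxt ^^ i) d) 0)"
      using wind_anti[OF funpow_darts[OF d(1)]] by simp
  qed simp
  also have "\<dots> = cnj X" by (simp add: X_def)
  finally have W: "comp_wind k = of_real (2 * Re X)" by (simp add: complex_add_cnj)
  obtain n :: int where n: "comp_wind k = of_int n" using comp_wind_Ints[OF k] by (auto elim: Ints_cases)
  then have ReX: "Re X = of_int n / 2" using W by (simp add: complex_eq_iff)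
  define s where "s = proj (pathstart d)"
  have s0: "s \<noteq> 0" using proj_start_in_K(1)[OF d(1)] zero_notin_K by (auto simp: s_def)
  have tele: "exp (2 * of_real pi * \<i> * (\<Sum>i<j. wind ((nxt ^^ i) d) 0)) = proj (pathstart ((nxt ^^ j) d)) / s" for j
  proof (induction j)
    case 0 then show ?case using s0 by (simp add: s_def)
  next
    case (Suc j)
    define c where "c = (nxt ^^ j) d"
    have c: "c \<in> darts" unfolding c_def by (rule funpow_darts[OF d(1)])
    have "proj (pathstart c) \<noteq> 0" using proj_start_in_K(1)[OF c] zero_notin_K by auto
    then show ?case
      using Suc exp_wind[OF c zero_notin_K] pathstart_nxt[OF c]
      by (simp add: c_def[symmetric] distrib_left exp_add)
  qed
  \<comment> \<open>The quotient of the two end points is a negative real, so the cosine of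
    \<open>2 * pi * Re X\<close> is negative. As \<open>Re X\<close> is \<open>n / 2\<close>, this
    excludes even \<open>n\<close>.\<close>
  have "exp (2 * of_real pi * \<i> * X) = proj (- pathstart d) / s"
    unfolding X_def tele using m(2) by (metis pathstart_anti)
  also have "proj (- pathstart d) = - 1 / cnj s"
    unfolding s_def using dart_start(1)[OF d(1)] by (intro proj_uminus_support) (simp add: support_def)
  also have "- 1 / cnj s / s = of_real (- 1 / (cmod s)\<^sup>2)"
    using complex_norm_square[of s] by (simp add: mult.commute)
  finally have "Re (exp (2 * of_real pi * \<i> * X)) < 0" using s0 by simp
  then have neg: "cos (2 * pi * Re X) < 0"
    by (simp add: Re_exp mult_less_0_iff)
  have "odd n"
  proof
    assume "even n"
    then obtain j where "n = 2 * j" by blast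
    then have "cos (2 * pi * Re X) = cos (2 * pi * of_int j)" using ReX by simp
    also have "\<dots> = 1" by (rule cos_int_2pin)
    finally show False using neg by simp
  qed
  then show ?thesis using n by blast
qed

definition N :: "complex \<Rightarrow> complex" where
  "N z = (\<Sum>d\<in>orientation. wind d z)"

lemma N_Ints: "z \<notin> K \<Longrightarrow> N z \<in> \<int>"
  unfolding N_def by (intro sum_wind_Ints orientation_subset orientation_nxt)

lemma N_far: "(\<And>w. w \<in> K \<Longrightarrow> cmod w < cmod z) \<Longrightarrow> N z = 0"
  unfolding N_def by (intro sum_wind_far orientation_subset orientation_nxt)

lemma N_zero_parity: "\<exists>n::int. N 0 = of_int n \<and> (even n \<longleftrightarrow> even (card comps))"
proof -
  have "\<forall>k\<in>comps. \<exists>n::int. comp_wind k = of_int n" using comp_wind_Ints by (auto elim: Ints_cases)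
  then obtain w :: "(real^3) set set \<Rightarrow> int" where w: "\<And>k. k \<in> comps \<Longrightarrow> comp_wind k = of_int (w k)" by metis
  have "N 0 = (\<Sum>k\<in>comps. comp_wind k)" unfolding N_def comp_wind_def by (rule sum_orientation)
  also have "\<dots> = of_int (\<Sum>k\<in>comps. w k)" using w by simp
  finally have N0: "N 0 = of_int (\<Sum>k\<in>comps. w k)" .
  \<comment> \<open>Adding 1 makes the terms of self-antipodal components even, as required at the
    fixed points of the involution; the added ones count the components.\<close>
  have "even (\<Sum>k\<in>comps. w k + 1)"
  proof (rule even_sum_involution[where a = "\<lambda>k. (\<lambda>e. antipode ` e) ` k"])
    fix k assume k: "k \<in> comps"
    show "(\<lambda>e. antipode ` e) ` k \<in> comps" by (rule antipode_comps[OF k])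
    show "(\<lambda>e. antipode ` e) ` (\<lambda>e. antipode ` e) ` k = k" by (simp add: image_image antipode_def)
    have "w ((\<lambda>e. antipode ` e) ` k) = w k \<or> w ((\<lambda>e. antipode ` e) ` k) = - w k"
      using comp_wind_antipode[OF k] w[OF k] w[OF antipode_comps[OF k]]
      by (metis of_int_eq_iff of_int_minus)
    then show "even (w ((\<lambda>e. antipode ` e) ` k) + 1) = even (w k + 1)" by auto
    show "even (w k + 1)" if "(\<lambda>e. antipode ` e) ` k = k"
      using comp_wind_self_antipodal[OF k that] w[OF k] by auto
  qed (rule finite_comps)
  then have "even ((\<Sum>k\<in>comps. w k) + int (card comps))" by (simp add: sum.distrib)
  then have "even (\<Sum>k\<in>comps. w k) \<longleftrightarrow> even (card comps)" by simp
  then show ?thesis using N0 by blast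
qed

end

section \<open>Parity of the winding number and the coloring\<close>

lemma subpath_subpath: "subpath 0 s (subpath a b g) = subpath a (a + s * (b - a)) g"
  by (rule ext) (simp add: subpath_def algebra_simps)

lemma Ints_eq_if_close:
  fixes a b :: complex
  assumes "a \<in> \<int>" "b \<in> \<int>" "cmod (a - b) < 1"
  shows "a = b"
proof -
  obtain m n :: int where mn: "a = of_int m" "b = of_int n" using assms by (auto elim!: Ints_cases)
  then have "cmod (of_int (m - n)) < 1" using assms(3) by simp
  then have "\<bar>m - n\<bar> < 1" by (simp only: norm_of_int)
  then show ?thesis using mn by simp
qed

definition even_int :: "complex \<Rightarrow> bool" where
  "even_int w \<longleftrightarrow> (\<exists>n::int. w = of_int (2 * n))"

lemma even_int_of_int: "even_int (of_int n) \<longleftrightarrow> even n"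
proof -
  have "(of_int n :: complex) = of_int (2 * k) \<longleftrightarrow> n = 2 * k" for k by (rule of_int_eq_iff)
  then show ?thesis unfolding even_int_def dvd_def by simp
qed

lemma even_int_add:
  assumes "a \<in> \<int>" "b \<in> \<int>"
  shows "even_int (a + b) \<longleftrightarrow> (even_int a \<longleftrightarrow> even_int b)"
proof -
  obtain m n :: int where mn: "a = of_int m" "b = of_int n" using assms by (auto elim!: Ints_cases)
  have "even_int (a + b) \<longleftrightarrow> even (m + n)" unfolding mn of_int_add[symmetric] by (rule even_int_of_int)
  then show ?thesis unfolding mn even_int_of_int by simp
qed

section \<open>Faces and the local constancy of \<open>N\<close>\<close>

context projected_map
begin

lemma K_compact: "compact K"
proof -
  have eq: "support M = verts M \<union> (\<Union>d\<in>darts. path_image d)"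
  proof
    show "support M \<subseteq> verts M \<union> (\<Union>d\<in>darts. path_image d)"
    proof
      fix x assume "x \<in> support M"
      then consider "x \<in> verts M" | e where "e \<in> edges M" "x \<in> e" by (auto simp: support_def)
      then show "x \<in> verts M \<union> (\<Union>d\<in>darts. path_image d)"
      proof cases
        case 2
        obtain d where d: "d \<in> darts" "dart_edge d = e" using dart_exists[OF 2(1)] by blast
        then have "x \<in> path_image d" using edge_pathD(6)[OF map dart_path[OF d(1)]] 2 by blast
        then show ?thesis using d by blast
      qed blast
    qed
    have "verts M \<subseteq> support M" by (auto simp: support_def)
    then show "verts M \<union> (\<Union>d\<in>darts. path_image d) \<subseteq> support M" using dart_support by blast
  qed
  have "compact (support M)"
    unfolding eq using finite_darts map_finite(1)[OF map] simple_path_imp_path[OF dart_simple]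
    by (intro compact_Un compact_UN compact_path_image finite_imp_compact) auto
  then show ?thesis
    by (intro compact_continuous_image continuous_on_subset[OF continuous_on_proj supp])
qed

lemma K_closed: "closed K"
  using K_compact by (rule compact_imp_closed)

lemma lift_in_support_iff: "lift z \<in> support M \<longleftrightarrow> z \<in> K"
proof
  show "lift z \<in> support M \<Longrightarrow> z \<in> K" by (metis imageI proj_lift)
  assume "z \<in> K"
  then obtain x where x: "x \<in> support M" "z = proj x" by blast
  then have "lift z = x" using supp lift_proj[of x] by blast
  then show "lift z \<in> support M" using x by simp
qed

lemma wind_continuous:
  assumes "d \<in> darts" "z \<notin> path_image (proj \<circ> d)"
  shows "continuous (at z) (wind d)"
  using continuous_at_winding_number[OF proj_dart(1)[OF assms(1)] assms(2)]
  by (simp add: wind_def[abs_def])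

text \<open>Off \<open>K\<close> a sum of winding numbers of open paths is continuous, and here its
  values are integers.\<close>

lemma N_local:
  assumes z: "z \<notin> K"
  obtains \<delta> where "0 < \<delta>" "\<And>w. w \<in> ball z \<delta> \<Longrightarrow> w \<notin> K \<and> N w = N z"
proof -
  have "continuous (at z) N"
    unfolding N_def[abs_def] using orientation_subset proj_dart(2) z
    by (intro continuous_sum wind_continuous) auto
  then obtain \<delta>1 where \<delta>1: "\<delta>1 > 0" "\<And>w. dist w z < \<delta>1 \<Longrightarrow> dist (N w) (N z) < 1"
    unfolding continuous_at_eps_delta by (metis zero_less_one)
  obtain \<delta>2 where \<delta>2: "\<delta>2 > 0" "ball z \<delta>2 \<inter> K = {}" using ex_ball_avoiding[OF K_closed z] by blast
  show ?thesis
  proof (rule that[of "min \<delta>1 \<delta>2"])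
    show "0 < min \<delta>1 \<delta>2" using \<delta>1 \<delta>2 by simp
    fix w assume w: "w \<in> ball z (min \<delta>1 \<delta>2)"
    then have wK: "w \<notin> K" using \<delta>2(2) by auto
    have "dist (N w) (N z) < 1" using w \<delta>1(2)[of w] by (simp add: dist_commute)
    then have "N w = N z" using Ints_eq_if_close[OF N_Ints[OF wK] N_Ints[OF z]] by (simp add: dist_norm)
    then show "w \<notin> K \<and> N w = N z" using wK by blast
  qed
qed

definition face_at :: "real^3 \<Rightarrow> (real^3) set" where
  "face_at x = connected_component_set (sphere 0 1 - support M) x"

lemma face_at_in_faces: "x \<in> sphere 0 1 - support M \<Longrightarrow> face_at x \<in> faces M"
  unfolding face_at_def faces_def components_def by blast

lemma face_at_self: "x \<in> sphere 0 1 - support M \<Longrightarrow> x \<in> face_at x"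
  by (simp add: face_at_def connected_component_refl)

lemma faces_eq_face_at: "f \<in> faces M \<Longrightarrow> x \<in> f \<Longrightarrow> face_at x = f"
  unfolding face_at_def faces_def components_def using connected_component_eq by blast

lemma lift_off: "z \<notin> K \<Longrightarrow> lift z \<in> sphere 0 1 - support M"
  using lift_in_sphere[of z] lift_in_support_iff[of z] by blast

lemma face_at_lift_eq:
  assumes "connected_component (- K) x y"
  shows "face_at (lift x) = face_at (lift y)"
proof -
  obtain T where T: "connected T" "T \<subseteq> - K" "x \<in> T" "y \<in> T"
    using assms by (auto simp: connected_component_def)
  have "connected (lift ` T)"
    using T(1) continuous_on_subset[OF continuous_on_lift] by (intro connected_continuous_image) auto
  moreover have "lift ` T \<subseteq> sphere 0 1 - support M" using T(2) lift_off by blast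
  ultimately have "connected_component (sphere 0 1 - support M) (lift x) (lift y)"
    unfolding connected_component_def using T(3,4) by blast
  then show ?thesis unfolding face_at_def by (intro connected_component_eq[symmetric]) simp
qed

lemma K_bound:
  obtains R where "0 < R" "\<And>w. w \<in> K \<Longrightarrow> cmod w < R"
proof -
  have "bounded K" using K_compact by (rule compact_imp_bounded)
  then obtain R where R: "0 < R" "\<And>w. w \<in> K \<Longrightarrow> cmod w \<le> R" by (auto simp: bounded_pos)
  show ?thesis
  proof (rule that[of "R + 1"])
    show "cmod w < R + 1" if "w \<in> K" for w using R(2)[OF that] by simp
  qed (use R in simp)
qed

text \<open>The value \<open>0\<close> of \<open>N\<close> near infinity makes it locally constant on each face, including the
  one that contains the centre of projection.\<close>

lemma N_face_constant:
  assumes f: "f \<in> faces M" and x: "x \<in> f - {p}" and y: "y \<in> f - {p}"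
  shows "N (proj x) = N (proj y)"
proof -
  obtain R where R: "0 < R" "\<And>w. w \<in> K \<Longrightarrow> cmod w < R" using K_bound by blast
  define N' where "N' x = (if x = p then 0 else N (proj x))" for x
  have fs: "f \<subseteq> sphere 0 1 - support M" "connected f"
    using f in_components_subset in_components_connected unfolding faces_def by blast+
  have "N' constant_on f"
  proof (rule locally_constant_imp_constant[OF fs(2)])
    fix a assume a: "a \<in> f"
    show "\<exists>T. openin (top_of_set f) T \<and> a \<in> T \<and> (\<forall>x\<in>T. N' x = N' a)"
    proof (cases "a = p")
      case True
      have cl: "compact (lift ` cball 0 R)"
        using continuous_on_subset[OF continuous_on_lift] by (intro compact_continuous_image) auto
      define T where "T = f \<inter> - (lift ` cball 0 R)"
      have "openin (top_of_set f) T" unfolding T_def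
        using compact_imp_closed[OF cl] by (intro openin_open_Int) auto
      moreover have "p \<notin> lift ` cball 0 R" by (metis DiffD2 imageE singletonI lift_in_sphere)
      then have "a \<in> T" using a True by (simp add: T_def)
      moreover have "N' x = N' a" if x: "x \<in> T" for x
      proof (cases "x = p")
        case False
        then have "x \<in> sphere 0 1 - {p}" using x fs by (auto simp: T_def)
        then have "lift (proj x) = x" by (rule lift_proj)
        then have "proj x \<notin> cball 0 R" using x unfolding T_def by (metis ComplD IntD2 image_eqI)
        then have "R < cmod (proj x)" by simp
        then have "N (proj x) = 0" using R(2) by (intro N_far) force
        then show ?thesis using False True by (simp add: N'_def)
      qed (use True in simp)
      ultimately show ?thesis by blast
    next
      case False
      have aS: "a \<in> sphere 0 1 - {p}" "a \<notin> support M" using a fs False by auto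
      have aK: "proj a \<notin> K" using aS lift_in_support_iff[of "proj a"] lift_proj[OF aS(1)] by simp
      obtain \<delta> where \<delta>: "0 < \<delta>" "\<And>w. w \<in> ball (proj a) \<delta> \<Longrightarrow> w \<notin> K \<and> N w = N (proj a)"
        using N_local[OF aK] by blast
      have "continuous_on (f - {p}) proj"
        using fs by (intro continuous_on_subset[OF continuous_on_proj]) auto
      then have "openin (top_of_set (f - {p})) ((f - {p}) \<inter> proj -` ball (proj a) \<delta>)"
        by (intro continuous_openin_preimage_gen) auto
      moreover have "openin (top_of_set f) (f - {p})" by (intro openin_delete openin_subtopology_self)
      ultimately have "openin (top_of_set f) ((f - {p}) \<inter> proj -` ball (proj a) \<delta>)" by (rule openin_trans)
      moreover have "a \<in> (f - {p}) \<inter> proj -` ball (proj a) \<delta>" using a False \<delta>(1) by simp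
      moreover have "N' x = N' a" if x: "x \<in> (f - {p}) \<inter> proj -` ball (proj a) \<delta>" for x
      proof -
        have "x \<noteq> p" "proj x \<in> ball (proj a) \<delta>" using x by auto
        then show ?thesis using \<delta>(2)[of "proj x"] False by (simp add: N'_def)
      qed
      ultimately show ?thesis by blast
    qed
  qed
  then have "N' x = N' y" using x y unfolding constant_on_def by auto
  then show ?thesis using x y by (simp add: N'_def)
qed

text \<open>The legs run from parameter \<open>t0\<close> half of the way to either end of the edge.
  This keeps them arcs that meet only in their common start even if the edge is a loop.\<close>

lemma edge_star:
  assumes d: "d \<in> darts" and t0: "t0 \<in> {0<..<1}"
  defines "\<gamma> \<equiv> proj \<circ> d" and "a \<equiv> subpath t0 (t0/2) (proj \<circ> d)" and "b \<equiv> subpath t0 ((1 + t0)/2) (proj \<circ> d)"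
  shows "star_data K (proj (d t0)) {a, b}" "a \<noteq> b"
proof -
  have t: "0 < t0" "t0 < 1" using t0 by auto
  note dp = dart_path[OF d]
  note E = edge_pathD[OF map dp]
  have dS: "d ` {0..1} \<subseteq> sphere 0 1 - {p}" using dart_support[OF d] supp by (auto simp: path_image_def)
  have \<gamma>inj: "s = s'" if s: "s \<in> {0..1}" "s' \<in> {0<..<1}" "\<gamma> s = \<gamma> s'" for s s'
  proof -
    have "s' \<in> {0..1}" using s(2) by auto
    then have "d s \<in> sphere 0 1 - {p}" "d s' \<in> sphere 0 1 - {p}" using dS s(1) by blast+
    then have "d s = d s'" using s(3) proj_eq_iff by (simp add: \<gamma>_def)
    then show ?thesis using simple_path_interior_eqD[OF E(1)] s by blast
  qed
  have p\<gamma>: "path \<gamma>" unfolding \<gamma>_def by (rule proj_dart(1)[OF d])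
  have arcs: "arc (subpath t0 q \<gamma>)" if q: "q \<in> {0<..<1}" "q \<noteq> t0" for q
    unfolding arc_subpath_eq
  proof (intro conjI)
    show "path (subpath t0 q \<gamma>)" using p\<gamma> t q by (intro path_subpath) auto
    have "closed_segment t0 q \<subseteq> {0<..<1}" using t q by (auto simp: closed_segment_eq_real_ivl)
    moreover have "{0<..<1} \<subseteq> {0..1::real}" by auto
    ultimately show "inj_on \<gamma> (closed_segment t0 q)" using \<gamma>inj by (intro inj_onI) blast
  qed (use q in simp)
  have ima: "path_image a = \<gamma> ` {t0/2..t0}" and imb: "path_image b = \<gamma> ` {t0..(1+t0)/2}"
    using t by (simp_all add: a_def b_def \<gamma>_def path_image_subpath)
  have arca: "arc a" and arcb: "arc b" using arcs[of "t0/2"] arcs[of "(1+t0)/2"] t by (auto simp: a_def b_def \<gamma>_def)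
  have st: "pathstart a = \<gamma> t0" "pathstart b = \<gamma> t0" by (simp_all add: a_def b_def \<gamma>_def)
  have I: "path_image a \<inter> path_image b = {\<gamma> t0}"
  proof -
    have "x = \<gamma> t0" if X: "x \<in> \<gamma> ` {t0/2..t0}" "x \<in> \<gamma> ` {t0..(1+t0)/2}" for x
    proof -
      obtain s s' where s: "s \<in> {t0/2..t0}" "x = \<gamma> s" "s' \<in> {t0..(1+t0)/2}" "x = \<gamma> s'" using X by blast
      have "s \<in> {0..1}" "s' \<in> {0<..<1}" using s(1,3) t by auto
      then have "s = s'" using \<gamma>inj[of s s'] s(2,4) by simp
      then have "s = t0" using s(1,3) by simp
      then show ?thesis using s by simp
    qed
    moreover have "\<gamma> t0 \<in> path_image a" "\<gamma> t0 \<in> path_image b" unfolding ima imb using t by auto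
    ultimately show ?thesis unfolding ima imb by blast
  qed
  show "a \<noteq> b"
  proof
    assume "a = b"
    then have "path_image a = {\<gamma> t0}" using I by simp
    then have "pathfinish a = pathstart a"
      using pathfinish_in_path_image[of a] pathstart_in_path_image[of a] by simp
    then show False using arc_distinct_ends[OF arca] by simp
  qed
  have abK: "path_image a \<subseteq> K" "path_image b \<subseteq> K"
    using proj_dart(2)[OF d] t unfolding ima imb by (auto simp: \<gamma>_def path_image_def)
  \<comment> \<open>As at a vertex, \<open>X\<close> is the compact remainder of the map, which a
    small disc misses.\<close>
  define X where "X = verts M \<union> (\<Union>e'\<in>edges M - {dart_edge d}. closure e') \<union> d ` {0..t0/2} \<union> d ` {(1+t0)/2..1}"
  have ed: "d s \<in> dart_edge d" if "s \<in> {0<..<1}" for s using that by (auto simp: dart_edge_def)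
  have Xsub: "X \<subseteq> support M"
  proof -
    have "closure e' \<subseteq> support M" if "e' \<in> edges M" for e'
      using edge_pathD(7,8)[OF map edge_par[OF that] that] by simp
    moreover have "d ` {0..t0/2} \<subseteq> support M" "d ` {(1+t0)/2..1} \<subseteq> support M"
      using dart_support[OF d] t by (auto simp: path_image_def)
    moreover have "verts M \<subseteq> support M" by (auto simp: support_def)
    ultimately show ?thesis unfolding X_def by blast
  qed
  have cX: "compact X"
  proof -
    have "compact (closure e')" if "e' \<in> edges M - {dart_edge d}" for e'
    proof -
      have e': "e' \<in> edges M" using that by blast
      show ?thesis using edge_pathD(2,7)[OF map edge_par[OF e'] e'] compact_path_image by metis
    qed
    then have "compact (\<Union>e'\<in>edges M - {dart_edge d}. closure e')"
      using map_finite(2)[OF map] by (intro compact_UN) auto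
    moreover have "compact (d ` {0..t0/2})" "compact (d ` {(1+t0)/2..1})"
      using t by (auto intro!: continuous_on_initial_segment(1)[OF E(2)])
    moreover have "compact (verts M)" using map_finite(1)[OF map] by (rule finite_imp_compact)
    ultimately show ?thesis unfolding X_def by (intro compact_Un)
  qed
  have zX: "d t0 \<notin> X"
  proof
    assume "d t0 \<in> X"
    then consider "d t0 \<in> verts M" | e' where "e' \<in> edges M" "e' \<noteq> dart_edge d" "d t0 \<in> closure e'"
      | s where "s \<in> {0..t0/2}" "d t0 = d s" | s where "s \<in> {(1+t0)/2..1}" "d t0 = d s"
      unfolding X_def by blast
    then show False
    proof cases
      case 1 then show ?thesis using ed[OF t0] E(10) by blast
    next
      case 2
      have "d t0 \<in> e' \<union> verts M"
        using 2(3) edge_pathD(3,4,6,7)[OF map edge_par[OF 2(1)] 2(1)] by auto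
      then show ?thesis using edges_disjoint[OF map dp(2) 2(1) ed[OF t0]] 2(2) ed[OF t0] E(10) by blast
    next
      case 3
      then have "s = t0" using simple_path_interior_eqD[OF E(1), of s t0] t by simp
      then show ?thesis using 3(1) t by simp
    next
      case 4
      then have "s = t0" using simple_path_interior_eqD[OF E(1), of s t0] t by simp
      then show ?thesis using 4(1) t by simp
    qed
  qed
  have nX: "proj (d t0) \<notin> proj ` X"
  proof
    assume "proj (d t0) \<in> proj ` X"
    then obtain x where x: "x \<in> X" "proj (d t0) = proj x" by blast
    have "t0 \<in> {0..1}" using t by simp
    then have "d t0 \<in> sphere 0 1 - {p}" "x \<in> sphere 0 1 - {p}" using dS x(1) Xsub supp by blast+
    then have "d t0 = x" using x(2) proj_eq_iff by blast
    then show False using x zX by blast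
  qed
  have clX: "closed (proj ` X)"
    using cX continuous_on_subset[OF continuous_on_proj] Xsub supp
    by (intro compact_imp_closed compact_continuous_image) auto
  obtain \<epsilon> where \<epsilon>: "\<epsilon> > 0" "ball (proj (d t0)) \<epsilon> \<inter> proj ` X = {}"
    using ex_ball_avoiding[OF clX nX] by blast
  have near: "K \<inter> ball (proj (d t0)) \<epsilon> \<subseteq> (\<Union>g\<in>{a, b}. path_image g)"
  proof
    fix w assume w: "w \<in> K \<inter> ball (proj (d t0)) \<epsilon>"
    then obtain x where x: "x \<in> support M" "w = proj x" by blast
    have xX: "x \<notin> X" using x w \<epsilon> by blast
    then obtain e' where e': "e' \<in> edges M" "x \<in> e'" using x by (auto simp: support_def X_def)
    have "e' = dart_edge d"
      using xX e' closure_subset[of e'] unfolding X_def by blast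
    then obtain s where s: "s \<in> {0<..<1}" "x = d s" using e' by (auto simp: dart_edge_def)
    have "s \<notin> {0..t0/2}" "s \<notin> {(1+t0)/2..1}" using xX s(2) unfolding X_def by blast+
    then have "s \<in> {t0/2..t0} \<or> s \<in> {t0..(1+t0)/2}" using s(1) by auto
    moreover have "w = \<gamma> s" using x s by (simp add: \<gamma>_def)
    ultimately show "w \<in> (\<Union>g\<in>{a, b}. path_image g)" using ima imb by auto
  qed
  have z: "\<gamma> t0 = proj (d t0)" by (simp add: \<gamma>_def)
  show "star_data K (proj (d t0)) {a, b}"
    unfolding star_data_def
  proof (intro conjI)
    show "\<forall>g\<in>{a, b}. arc g \<and> pathstart g = proj (d t0) \<and> path_image g \<subseteq> K"
      using arca arcb st abK z by simp
    show "\<forall>g\<in>{a, b}. \<forall>h\<in>{a, b}. g \<noteq> h \<longrightarrow> path_image g \<inter> path_image h = {proj (d t0)}"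
      using I z by (simp add: Int_commute)
    show "\<exists>\<epsilon>>0. K \<inter> ball (proj (d t0)) \<epsilon> \<subseteq> (\<Union>g\<in>{a, b}. path_image g)" using \<epsilon>(1) near by blast
  qed (simp_all add: K_closed)
qed

end

lemma closure_Int_ball_mono:
  assumes "A \<inter> ball z r \<subseteq> closure (S \<inter> ball z r)" "r' \<le> r"
  shows "A \<inter> ball z r' \<subseteq> closure (S \<inter> ball z r')"
proof -
  have "closure (S \<inter> ball z r) \<subseteq> closure S" by (intro closure_mono) auto
  moreover have "ball z r' \<subseteq> ball z r" using assms(2) by (rule subset_ball)
  ultimately have "A \<inter> ball z r' \<subseteq> ball z r' \<inter> closure S" using assms(1) by blast
  also have "\<dots> \<subseteq> closure (ball z r' \<inter> S)" by (rule open_Int_closure_subset) simp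
  finally show ?thesis by (simp add: Int_commute)
qed

section \<open>The jump of \<open>N\<close> across an edge\<close>

context projected_map
begin

text \<open>Near an interior point of an edge, \<open>N\<close> differs by a continuous integer-valued function from
  the winding number of the Jordan curve that bounds one of the two sides.\<close>

lemma N_jump:
  assumes d: "d \<in> orientation" and t0: "t0 \<in> {0<..<1}"
    and \<alpha>: "0 < \<alpha>" "\<alpha> < t0" and \<tau>: "t0 < \<tau>" "\<tau> < 1" and r: "0 < r"
  defines "z \<equiv> proj (d t0)" and "a \<equiv> subpath t0 \<alpha> (proj \<circ> d)" and "b \<equiv> subpath t0 \<tau> (proj \<circ> d)"
  assumes ra: "radial_arc z r a" and rb: "radial_arc z r b" and I: "path_image a \<inter> path_image b = {z}"
    and S1: "sector z r S1 a b" and S2: "sector z r S2 a b" and S12: "S1 \<inter> S2 = {}"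
  obtains \<delta> where "0 < \<delta>"
    "\<And>x y. x \<in> S1 \<inter> ball z \<delta> - K \<Longrightarrow> y \<in> S2 \<inter> ball z \<delta> - K \<Longrightarrow> \<not> even_int (N x - N y)"
proof -
  define \<gamma> where "\<gamma> = proj \<circ> d"
  have dd: "d \<in> darts" using d orientation_subset by blast
  note E = edge_pathD[OF map dart_path[OF dd]]
  have p\<gamma>: "path \<gamma>" unfolding \<gamma>_def by (rule proj_dart(1)[OF dd])
  have im\<gamma>: "path_image \<gamma> \<subseteq> K" unfolding \<gamma>_def by (rule proj_dart(2)[OF dd])
  have t: "0 < t0" "t0 < 1" using t0 by auto
  have zK: "z \<in> K" using im\<gamma> t by (force simp: z_def \<gamma>_def path_image_def)
  obtain \<beta> where \<beta>: "arc \<beta>" "pathstart \<beta> = pathfinish a" "pathfinish \<beta> = pathfinish b" "path_image \<beta> \<subseteq> sphere z r"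
    and S1_eq: "S1 = inside (path_image a \<union> path_image b \<union> path_image \<beta>)"
    using S1 by (auto simp: sector_def)
  define J where "J = (a +++ \<beta>) +++ reversepath b"
  note J = sector_boundary[OF r ra rb I \<beta>, folded J_def]
  have SJ: "S1 = inside (path_image J)" using S1_eq J(4) by simp
  note p1 = sector_props[OF r ra rb I S1] and p2 = sector_props[OF r ra rb I S2]
  \<comment> \<open>Replacing the piece of \<open>d\<close> between \<alpha> and \<tau> by the
    circular arc \<beta> leaves \<open>F\<close>. All paths in \<open>F\<close> avoid
    \<open>z\<close>, so \<open>F\<close> is continuous there, and the whole jump of
    \<open>N\<close> is due to the Jordan curve \<open>J\<close>.\<close>
  define F where "F x = (\<Sum>d'\<in>orientation - {d}. wind d' x) + winding_number \<beta> x
     + winding_number (subpath 0 \<alpha> \<gamma>) x + winding_number (subpath \<tau> 1 \<gamma>) x" for x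
  have fin: "finite orientation" using orientation_subset finite_darts finite_subset by blast
  have NF: "N x = F x - winding_number J x" if x: "x \<in> ball z r" "x \<notin> K" for x
  proof -
    have xg: "x \<notin> path_image \<gamma>" using im\<gamma> x by blast
    have x\<beta>: "x \<notin> path_image \<beta>" using \<beta>(4) x(1) by auto
    have pa: "path a" "x \<notin> path_image a"
    proof -
      show "path a" unfolding a_def \<gamma>_def[symmetric] using p\<gamma> \<alpha> t by simp
      show "x \<notin> path_image a" unfolding a_def \<gamma>_def[symmetric]
        using xg path_image_subpath_subset[of t0 \<alpha> \<gamma>] \<alpha> t by auto
    qed
    have pb: "path b" "x \<notin> path_image b"
    proof -
      show "path b" unfolding b_def \<gamma>_def[symmetric] using p\<gamma> \<tau> t by simp
      show "x \<notin> path_image b" unfolding b_def \<gamma>_def[symmetric]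
        using xg path_image_subpath_subset[of t0 \<tau> \<gamma>] \<tau> t by auto
    qed
    have p\<beta>: "path \<beta>" using \<beta>(1) by (rule arc_imp_path)
    have ab: "path (a +++ \<beta>)" "x \<notin> path_image (a +++ \<beta>)"
      using pa p\<beta> x\<beta> \<beta>(2) by (auto simp: path_image_join)
    have "winding_number J x = winding_number (a +++ \<beta>) x + winding_number (reversepath b) x"
      unfolding J_def using ab pb \<beta>(3) by (intro winding_number_join) auto
    also have "winding_number (a +++ \<beta>) x = winding_number a x + winding_number \<beta> x"
      using pa p\<beta> x\<beta> \<beta>(2) by (intro winding_number_join) auto
    also have "winding_number (reversepath b) x = - winding_number b x"
      using pb by (rule winding_number_reversepath)
    finally have WJ: "winding_number J x = winding_number a x + winding_number \<beta> x - winding_number b x" by simp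
    have ra': "winding_number (subpath \<alpha> t0 \<gamma>) x = - winding_number a x"
      using winding_number_reversepath[OF pa] by (simp add: a_def \<gamma>_def reversepath_subpath)
    have "winding_number \<gamma> x = winding_number (subpath 0 1 \<gamma>) x" by simp
    also have "\<dots> = winding_number (subpath 0 \<alpha> \<gamma>) x + winding_number (subpath \<alpha> 1 \<gamma>) x"
      using \<alpha> t by (intro winding_number_subpath_combine[symmetric] p\<gamma> xg) auto
    also have "winding_number (subpath \<alpha> 1 \<gamma>) x = winding_number (subpath \<alpha> t0 \<gamma>) x + winding_number (subpath t0 1 \<gamma>) x"
      using \<alpha> t by (intro winding_number_subpath_combine[symmetric] p\<gamma> xg) auto
    also have "winding_number (subpath t0 1 \<gamma>) x = winding_number b x + winding_number (subpath \<tau> 1 \<gamma>) x"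
      unfolding b_def \<gamma>_def[symmetric] using \<tau> t by (intro winding_number_subpath_combine[symmetric] p\<gamma> xg) auto
    finally have "wind d x = winding_number (subpath 0 \<alpha> \<gamma>) x - winding_number a x + winding_number b x
        + winding_number (subpath \<tau> 1 \<gamma>) x"
      unfolding ra' wind_def \<gamma>_def[symmetric] by simp
    moreover have "N x = wind d x + (\<Sum>d'\<in>orientation - {d}. wind d' x)"
      unfolding N_def using fin d by (intro sum.remove) auto
    ultimately show ?thesis using WJ by (simp add: F_def)
  qed
  have dsup: "d s \<in> support M" if "s \<in> {0..1}" for s
    using dart_support[OF dd] that by (auto simp: path_image_def)
  have ze: "d t0 \<in> dart_edge d" using t0 by (auto simp: dart_edge_def)
  have zother: "z \<notin> path_image (proj \<circ> d')" if d': "d' \<in> orientation - {d}" for d'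
  proof
    assume "z \<in> path_image (proj \<circ> d')"
    then obtain y where y: "y \<in> path_image d'" "proj (d t0) = proj y"
      by (auto simp: path_image_compose z_def)
    have d'd: "d' \<in> darts" using d' orientation_subset by blast
    have "y \<in> support M" using y(1) dart_support[OF d'd] by blast
    moreover have "d t0 \<in> support M" using dsup[of t0] t by simp
    ultimately have "d t0 \<in> sphere 0 1 - {p}" "y \<in> sphere 0 1 - {p}" using supp by blast+
    then have "d t0 = y" using y(2) proj_eq_iff by blast
    then have "d t0 \<in> dart_edge d' \<union> verts M"
      using y(1) edge_pathD(3,4,6)[OF map dart_path[OF d'd]] by auto
    then have "dart_edge d' = dart_edge d"
      using edges_disjoint[OF map dart_path(2)[OF dd] dart_path(2)[OF d'd] ze] E(10) ze by blast
    then show False using orientation_inj d d' by (auto simp: inj_on_def)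
  qed
  have zsub: "z \<notin> \<gamma> ` {s0..s1}" if s: "{s0..s1} \<subseteq> {0..1}" "t0 \<notin> {s0..s1}" for s0 s1
  proof
    assume "z \<in> \<gamma> ` {s0..s1}"
    then obtain s where s': "s \<in> {s0..s1}" "proj (d t0) = proj (d s)" by (auto simp: z_def \<gamma>_def)
    have s01: "s \<in> {0..1}" using s' s by blast
    have "d s \<in> support M" "d t0 \<in> support M" using dsup[OF s01] dsup[of t0] t by auto
    then have "d t0 \<in> sphere 0 1 - {p}" "d s \<in> sphere 0 1 - {p}" using supp by blast+
    then have "d s = d t0" using s'(2) proj_eq_iff by metis
    then have "s = t0" using simple_path_interior_eqD[OF E(1) _ s01] t0 by blast
    then show False using s' s by blast
  qed
  have im_sub: "path_image (subpath 0 \<alpha> \<gamma>) = \<gamma> ` {0..\<alpha>}" "path_image (subpath \<tau> 1 \<gamma>) = \<gamma> ` {\<tau>..1}"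
    using \<alpha> \<tau> t by (simp_all add: path_image_subpath)
  have zim: "z \<notin> path_image (subpath 0 \<alpha> \<gamma>)" "z \<notin> path_image (subpath \<tau> 1 \<gamma>)"
    unfolding im_sub using zsub[of 0 \<alpha>] zsub[of \<tau> 1] \<alpha> \<tau> t by simp_all
  have z\<beta>: "z \<notin> path_image \<beta>" using \<beta>(4) r by auto
  have "continuous (at z) F"
    unfolding F_def[abs_def]
  proof (intro continuous_add continuous_sum)
    show "continuous (at z) (wind d')" if "d' \<in> orientation - {d}" for d'
      using wind_continuous[of d' z] that orientation_subset zother[OF that] by blast
    show "continuous (at z) (winding_number \<beta>)"
      using \<beta>(1) z\<beta> by (intro continuous_at_winding_number arc_imp_path)
    show "continuous (at z) (winding_number (subpath 0 \<alpha> \<gamma>))"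
      using p\<gamma> \<alpha> t by (intro continuous_at_winding_number zim) auto
    show "continuous (at z) (winding_number (subpath \<tau> 1 \<gamma>))"
      using p\<gamma> \<tau> t by (intro continuous_at_winding_number zim) auto
  qed
  moreover have "0 < (1/2::real)" by simp
  ultimately obtain \<delta>1 where \<delta>1: "\<delta>1 > 0" "\<And>w. dist w z < \<delta>1 \<Longrightarrow> dist (F w) (F z) < 1/2"
    unfolding continuous_at_eps_delta by meson
  define \<delta> where "\<delta> = min \<delta>1 r"
  have key: "\<not> even_int (N x - N y)" if x: "x \<in> S1 \<inter> ball z \<delta> - K" and y: "y \<in> S2 \<inter> ball z \<delta> - K" for x y
  proof -
    have xr: "x \<in> ball z r" "y \<in> ball z r" "x \<notin> K" "y \<notin> K" using x y by (auto simp: \<delta>_def)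
    have wx: "winding_number J x = 1 \<or> winding_number J x = -1"
      using simple_closed_path_winding_number_inside[OF J(1)] x SJ by blast
    have "y \<notin> path_image J" using y p2(4) xr(2) \<beta>(4) unfolding J(4) by auto
    moreover have "y \<notin> inside (path_image J)" using y S12 SJ by blast
    ultimately have "y \<in> outside (path_image J)" using inside_Un_outside[of "path_image J"] by blast
    then have wy: "winding_number J y = 0"
      using J(1-3) by (intro winding_number_zero_in_outside) (auto simp: simple_path_imp_path)
    have Nx: "N x = F x - winding_number J x" and Ny: "N y = F y"
      using NF[OF xr(1,3)] NF[OF xr(2,4)] wy by auto
    have "N x \<in> \<int>" "N y \<in> \<int>" using N_Ints xr by auto
    moreover have "winding_number J x \<in> \<int>" using wx by auto
    moreover have "F x = N x + winding_number J x" using Nx by simp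
    ultimately have "F x \<in> \<int>" "F y \<in> \<int>" using Ny by auto
    \<comment> \<open>Both values of \<open>F\<close> are within 1/2 of \<open>F z\<close>, so these
      two integers coincide. What remains is the winding number of \<open>J\<close>, which is 0 at
      \<open>y\<close> and 1 or -1 at \<open>x\<close>.\<close>
    moreover have "cmod (F x - F y) < 1"
    proof -
      have "dist x z < \<delta>1" "dist y z < \<delta>1" using x y by (auto simp: \<delta>_def dist_commute)
      then have "dist (F x) (F z) < 1/2" "dist (F y) (F z) < 1/2" using \<delta>1(2) by blast+
      moreover have "dist (F x) (F y) \<le> dist (F x) (F z) + dist (F y) (F z)" by (rule dist_triangle2)
      ultimately have "dist (F x) (F y) < 1" by linarith
      then show ?thesis by (simp add: dist_norm)
    qed
    ultimately have "F x = F y" by (rule Ints_eq_if_close)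
    then have "N x - N y = - winding_number J x" using Nx Ny by simp
    then have "N x - N y = of_int 1 \<or> N x - N y = of_int (-1)" using wx by auto
    then show ?thesis using even_int_of_int[of 1] even_int_of_int[of "-1"] by auto
  qed
  show ?thesis using that[of \<delta>] key \<delta>1(1) r by (auto simp: \<delta>_def)
qed

text \<open>The local picture at an interior point of an edge, kept free of paths: from here on only
  connectedness, closures and the parity of \<open>N\<close> matter.\<close>

definition sides :: "complex \<Rightarrow> real \<Rightarrow> complex set \<Rightarrow> complex set \<Rightarrow> bool" where
  "sides z r S1 S2 \<longleftrightarrow> 0 < r \<and> ball z r - K \<subseteq> S1 \<union> S2 \<and> (S1 \<union> S2) \<inter> ball z r \<inter> K = {} \<and>
     (\<forall>S\<in>{S1, S2}. \<forall>x\<in>S \<inter> ball z r. \<forall>y\<in>S \<inter> ball z r. connected_component (- K) x y) \<and>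
     (\<forall>S\<in>{S1, S2}. K \<inter> ball z r \<subseteq> closure (S \<inter> ball z r)) \<and>
     (\<forall>x\<in>S1 \<inter> ball z r. \<forall>y\<in>S2 \<inter> ball z r. \<not> even_int (N x - N y))"

lemma edge_sides:
  assumes e: "e \<in> edges M" and z: "z \<in> proj ` e"
  shows "\<exists>r S1 S2. sides z r S1 S2"
proof -
  obtain d where d: "d \<in> orientation" "dart_edge d = e" using orientation_exists[OF e] by blast
  have dd: "d \<in> darts" using d orientation_subset by blast
  obtain t0 where t0: "t0 \<in> {0<..<1}" "z = proj (d t0)" using z d(2) by (auto simp: dart_edge_def)
  define a where "a = subpath t0 (t0/2) (proj \<circ> d)"
  define b where "b = subpath t0 ((1 + t0)/2) (proj \<circ> d)"
  have star: "star_data K z {a, b}" "a \<noteq> b"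
    using edge_star[OF dd t0(1)] unfolding a_def b_def t0(2) by auto
  have "\<exists>r r' s t S1 S2. 0 < r \<and> 0 < r' \<and> 0 < s \<and> s < 1 \<and> 0 < t \<and> t < 1 \<and>
    radial_arc z r (subpath 0 s a) \<and> radial_arc z r (subpath 0 t b) \<and>
    sector z r S1 (subpath 0 s a) (subpath 0 t b) \<and> sector z r S2 (subpath 0 s a) (subpath 0 t b) \<and>
    S1 \<inter> S2 = {} \<and> ball z r' - K \<subseteq> S1 \<union> S2 \<and>
    (\<forall>S x y. S = S1 \<or> S = S2 \<longrightarrow> x \<in> S \<inter> ball z r' \<longrightarrow> y \<in> S \<inter> ball z r' \<longrightarrow> connected_component (- K) x y) \<and>
    (\<forall>S. S = S1 \<or> S = S2 \<longrightarrow> K \<inter> ball z r' \<subseteq> closure (S \<inter> ball z r'))"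
  proof (rule two_sides[OF star zero_less_one])
    fix r r' s t S1 S2
    assume A: "0 < r" "r < 1" "0 < r'" "r' < r" "0 < s" "s < 1" "0 < t" "t < 1"
      "radial_arc z r (subpath 0 s a)" "radial_arc z r (subpath 0 t b)"
      "sector z r S1 (subpath 0 s a) (subpath 0 t b)" "sector z r S2 (subpath 0 s a) (subpath 0 t b)"
      "S1 \<inter> S2 = {}" "ball z r' - K \<subseteq> S1 \<union> S2"
      and cc: "\<And>S x y. S = S1 \<or> S = S2 \<Longrightarrow> x \<in> S \<inter> ball z r' \<Longrightarrow> y \<in> S \<inter> ball z r' \<Longrightarrow> connected_component (- K) x y"
      and cl: "\<And>S. S = S1 \<or> S = S2 \<Longrightarrow> K \<inter> ball z r' \<subseteq> closure (S \<inter> ball z r')"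
    show ?thesis
      by (rule exI[of _ r], rule exI[of _ r'], rule exI[of _ s], rule exI[of _ t], rule exI[of _ S1], rule exI[of _ S2])
         (intro conjI allI impI A cc cl; assumption)
  qed
  then obtain r r' s t S1 S2 where ts: "0 < r" "0 < r'" "0 < s" "s < 1" "0 < t" "t < 1"
    "radial_arc z r (subpath 0 s a)" "radial_arc z r (subpath 0 t b)"
    "sector z r S1 (subpath 0 s a) (subpath 0 t b)"
    "sector z r S2 (subpath 0 s a) (subpath 0 t b)" "S1 \<inter> S2 = {}"
    "ball z r' - K \<subseteq> S1 \<union> S2"
    and cc': "\<forall>S x y. S = S1 \<or> S = S2 \<longrightarrow> x \<in> S \<inter> ball z r' \<longrightarrow> y \<in> S \<inter> ball z r' \<longrightarrow> connected_component (- K) x y"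
    and cl': "\<forall>S. S = S1 \<or> S = S2 \<longrightarrow> K \<inter> ball z r' \<subseteq> closure (S \<inter> ball z r')"
    by (elim exE conjE)
  note cc = cc'[rule_format] and cl = cl'[rule_format]
  \<comment> \<open>\<alpha> and \<tau> are the parameters at which the two legs first leave the
    disc, expressed in the original parametrization of the edge.\<close>
  define \<alpha> where "\<alpha> = t0 + s * (t0/2 - t0)"
  define \<tau> where "\<tau> = t0 + t * ((1 + t0)/2 - t0)"
  have t01: "0 < t0" "t0 < 1" using t0 by auto
  have \<alpha>: "0 < \<alpha>" "\<alpha> < t0"
  proof -
    have "\<alpha> = t0 * (1 - s/2)" by (simp add: \<alpha>_def algebra_simps)
    then show "0 < \<alpha>" "\<alpha> < t0" using t01 ts(3,4) by auto
  qed
  have \<tau>: "t0 < \<tau>" "\<tau> < 1"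
  proof -
    have eq: "\<tau> = t0 + (t/2) * (1 - t0)" by (simp add: \<tau>_def algebra_simps)
    have "0 < (t/2) * (1 - t0)" using t01 ts(5) by simp
    then show "t0 < \<tau>" using eq by simp
    have "(t/2) * (1 - t0) < 1 * (1 - t0)" using t01 ts(6) by (intro mult_strict_right_mono) auto
    then show "\<tau> < 1" using eq by simp
  qed
  have sub: "subpath 0 s a = subpath t0 \<alpha> (proj \<circ> d)" "subpath 0 t b = subpath t0 \<tau> (proj \<circ> d)"
    unfolding a_def b_def subpath_subpath \<alpha>_def \<tau>_def by simp_all
  have I: "path_image (subpath 0 s a) \<inter> path_image (subpath 0 t b) = {z}"
    using truncations_Int[OF star(1) _ _ star(2)] ts(3-6) by simp
  obtain \<delta> where \<delta>: "0 < \<delta>"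
    "\<And>x y. x \<in> S1 \<inter> ball z \<delta> - K \<Longrightarrow> y \<in> S2 \<inter> ball z \<delta> - K \<Longrightarrow> \<not> even_int (N x - N y)"
    using N_jump[OF d(1) t0(1) \<alpha> \<tau> ts(1), folded t0(2), folded sub, OF ts(7,8) I ts(9,10,11)] by blast
  define \<rho> where "\<rho> = min r' \<delta>"
  have sub1: "ball z \<rho> \<subseteq> ball z r'" "ball z \<rho> \<subseteq> ball z \<delta>" "\<rho> \<le> r'" by (auto simp: \<rho>_def)
  have SK: "(S1 \<union> S2) \<inter> ball z \<rho> \<inter> K = {}"
  proof -
    have "x \<notin> K" if "x \<in> S \<inter> ball z \<rho>" "S = S1 \<or> S = S2" for x S
    proof -
      \<comment> \<open>That a point is connected to itself in \<open>- K\<close> means that it is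
        off \<open>K\<close>.\<close>
      have "connected_component (- K) x x" using cc[OF that(2)] that(1) sub1(1) by blast
      then have "x \<in> - K" by (simp add: connected_component_refl_eq)
      then show ?thesis by simp
    qed
    then show ?thesis by blast
  qed
  have "sides z \<rho> S1 S2"
    unfolding sides_def
  proof (intro conjI)
    show "0 < \<rho>" using ts(2) \<delta>(1) by (simp add: \<rho>_def)
    show "ball z \<rho> - K \<subseteq> S1 \<union> S2" using ts(12) sub1(1) by blast
    show "(S1 \<union> S2) \<inter> ball z \<rho> \<inter> K = {}" by (rule SK)
    show "\<forall>S\<in>{S1, S2}. \<forall>x\<in>S \<inter> ball z \<rho>. \<forall>y\<in>S \<inter> ball z \<rho>. connected_component (- K) x y"
      using cc sub1(1) by blast
    show "\<forall>S\<in>{S1, S2}. K \<inter> ball z \<rho> \<subseteq> closure (S \<inter> ball z \<rho>)"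
      using closure_Int_ball_mono[OF cl sub1(3)] by blast
    show "\<forall>x\<in>S1 \<inter> ball z \<rho>. \<forall>y\<in>S2 \<inter> ball z \<rho>. \<not> even_int (N x - N y)"
      using \<delta>(2) sub1(2) SK by blast
  qed
  then show ?thesis by blast
qed

lemma sidesD:
  assumes "sides z r S1 S2" "S = S1 \<or> S = S2"
  shows "x \<in> S \<inter> ball z r \<Longrightarrow> y \<in> S \<inter> ball z r \<Longrightarrow> connected_component (- K) x y"
    "K \<inter> ball z r \<subseteq> closure (S \<inter> ball z r)" "x \<in> S \<inter> ball z r \<Longrightarrow> x \<notin> K" "0 < r"
  using assms unfolding sides_def by blast+

lemma sides_cover:
  assumes "sides z r S1 S2" "w \<in> ball z r" "w \<notin> K"
  shows "w \<in> S1 \<or> w \<in> S2"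
proof -
  have "ball z r - K \<subseteq> S1 \<union> S2" using assms(1) by (simp add: sides_def)
  then show ?thesis using assms(2,3) by blast
qed

lemma sides_jump:
  assumes "sides z r S1 S2" "x \<in> S1 \<inter> ball z r" "y \<in> S2 \<inter> ball z r"
  shows "\<not> even_int (N x - N y)"
proof -
  have "\<forall>x\<in>S1 \<inter> ball z r. \<forall>y\<in>S2 \<inter> ball z r. \<not> even_int (N x - N y)"
    using assms(1) by (simp add: sides_def)
  then show ?thesis using assms(2,3) by blast
qed

lemma edge_K: "e \<in> edges M \<Longrightarrow> proj ` e \<subseteq> K"
  by (auto simp: support_def)

text \<open>A preimage under \<open>lift\<close>, so that the face containing the centre
  \<open>p\<close> needs no special treatment.\<close>

definition plane_face :: "(real^3) set \<Rightarrow> complex set" where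
  "plane_face f = lift -` f"

lemma plane_face_off_K:
  assumes "f \<in> faces M" "w \<in> plane_face f"
  shows "w \<notin> K"
  using assms in_components_subset[of f "sphere 0 1 - support M"] lift_in_support_iff[of w]
  unfolding plane_face_def faces_def by blast

lemma plane_face_connected:
  assumes "f \<in> faces M" "x \<in> plane_face f" "connected_component (- K) x y"
  shows "y \<in> plane_face f"
proof -
  have y: "y \<notin> K" using connected_component_in[OF assms(3)] by simp
  have "lift x \<in> f" using assms(2) by (simp add: plane_face_def)
  then have "f = face_at (lift y)"
    using faces_eq_face_at[OF assms(1)] face_at_lift_eq[OF assms(3)] by metis
  then show ?thesis using face_at_self[OF lift_off[OF y]] by (simp add: plane_face_def)
qed

text \<open>A proper coloring speaks of edges inside closures of faces, whereas the local analysis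
  yields a single point. The points of the edge that lie in the closure of the face form a
  relatively closed set. It is also relatively open, since near such a point one side lies in the
  face and has the whole nearby edge in its closure. Connectedness of the edge does the
  rest.\<close>

lemma edge_subset_closure_face:
  assumes f: "f \<in> faces M" and e: "e \<in> edges M" and z: "z \<in> proj ` e" "z \<in> closure (plane_face f)"
  shows "e \<subseteq> closure f"
proof -
  define A where "A = proj ` e \<inter> closure (plane_face f)"
  have eS: "e \<subseteq> sphere 0 1 - {p}" using e supp by (auto simp: support_def)
  have con: "connected (proj ` e)"
  proof -
    obtain g where g: "edge_path M e g" using edge_path_exists[OF map e] by blast
    have "continuous_on {0<..<1} g"
      using edge_pathD(2)[OF map g e] by (auto simp: path_def intro: continuous_on_subset)
    then have "connected (g ` {0<..<1})" by (rule connected_continuous_image) simp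
    then have "connected e" using edge_pathD(5)[OF map g e] by simp
    then show ?thesis by (intro connected_continuous_image continuous_on_subset[OF continuous_on_proj eS])
  qed
  have "closedin (top_of_set (proj ` e)) A" unfolding A_def by (intro closedin_closed_Int) simp
  moreover have "openin (top_of_set (proj ` e)) A"
  proof (subst openin_subopen, intro ballI)
    fix w assume w: "w \<in> A"
    obtain r S1 S2 where s: "sides w r S1 S2" using edge_sides[OF e, of w] w unfolding A_def by blast
    have r: "0 < r" using s by (simp add: sides_def)
    have "w \<in> closure (plane_face f)" using w by (simp add: A_def)
    then have "\<exists>y\<in>plane_face f. dist y w < r" using r unfolding closure_approachable by blast
    then obtain x where x: "x \<in> plane_face f" "dist x w < r" by blast
    then have xr: "x \<in> ball w r" by (simp add: dist_commute)
    have "x \<in> S1 \<or> x \<in> S2" by (rule sides_cover[OF s xr plane_face_off_K[OF f x(1)]])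
    then obtain S where S: "S = S1 \<or> S = S2" "x \<in> S" by metis
    have "S \<inter> ball w r \<subseteq> plane_face f"
    proof
      fix y assume "y \<in> S \<inter> ball w r"
      then have "connected_component (- K) x y" using S(2) xr by (intro sidesD(1)[OF s S(1)]) auto
      then show "y \<in> plane_face f" by (rule plane_face_connected[OF f x(1)])
    qed
    then have "closure (S \<inter> ball w r) \<subseteq> closure (plane_face f)" by (rule closure_mono)
    then have "K \<inter> ball w r \<subseteq> closure (plane_face f)" using sidesD(2)[OF s S(1)] by blast
    then have "proj ` e \<inter> ball w r \<subseteq> A" using edge_K[OF e] unfolding A_def by blast
    moreover have "openin (top_of_set (proj ` e)) (proj ` e \<inter> ball w r)" by (intro openin_open_Int) simp
    moreover have "w \<in> proj ` e \<inter> ball w r" using w r by (simp add: A_def)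
    ultimately show "\<exists>T. openin (top_of_set (proj ` e)) T \<and> w \<in> T \<and> T \<subseteq> A" by blast
  qed
  moreover have "A \<noteq> {}" using z by (auto simp: A_def)
  ultimately have "A = proj ` e" using con unfolding connected_clopen by blast
  then have sub: "proj ` e \<subseteq> closure (plane_face f)" by (auto simp: A_def)
  show ?thesis
  proof
    fix x assume x: "x \<in> e"
    have "lift ` closure (plane_face f) \<subseteq> closure f"
      by (intro image_closure_subset[OF continuous_on_subset[OF continuous_on_lift]])
         (auto simp: plane_face_def intro: closure_subset[THEN subsetD])
    moreover have "lift (proj x) = x" using x eS by (intro lift_proj) blast
    ultimately show "x \<in> closure f" using sub x by (metis imageI subsetD)
  qed
qed

end

section \<open>Comparison of the colors with the parity of \<open>N\<close>\<close>

locale colored_map = projected_map +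
  fixes C :: "(real^3) set \<Rightarrow> color"
  assumes proper: "proper_coloring M C"
begin

definition col :: "complex \<Rightarrow> color" where
  "col z = C (face_at (lift z))"

definition agree :: "complex \<Rightarrow> complex \<Rightarrow> bool" where
  "agree x y \<longleftrightarrow> (col x = col y \<longleftrightarrow> even_int (N x - N y))"

text \<open>This is where two colors matter: two changes of color restore the first one, just as two
  odd numbers add up to an even one.\<close>

lemma agree_trans:
  assumes "x \<notin> K" "y \<notin> K" "w \<notin> K" "agree x y" "agree y w"
  shows "agree x w"
proof -
  have "N x - N y \<in> \<int>" "N y - N w \<in> \<int>" using N_Ints assms by auto
  then have "even_int ((N x - N y) + (N y - N w)) \<longleftrightarrow> (even_int (N x - N y) \<longleftrightarrow> even_int (N y - N w))"
    by (rule even_int_add)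
  then have "even_int (N x - N w) \<longleftrightarrow> (col x = col y \<longleftrightarrow> col y = col w)"
    using assms(4,5) by (simp add: agree_def)
  then show ?thesis
    unfolding agree_def by (cases "col x"; cases "col y"; cases "col w") auto
qed

lemma agree_sym:
  assumes "x \<notin> K" "y \<notin> K" "agree x y"
  shows "agree y x"
proof -
  have "even_int ((N x - N y) + (N y - N x)) \<longleftrightarrow> (even_int (N x - N y) \<longleftrightarrow> even_int (N y - N x))"
    using N_Ints assms by (intro even_int_add) auto
  moreover have "even_int 0" using even_int_of_int[of 0] by simp
  ultimately show ?thesis using assms(3) by (auto simp: agree_def)
qed

lemma agree_same:
  assumes "connected_component (- K) x y"
  shows "agree x y"
proof -
  have K: "x \<notin> K" "y \<notin> K" using connected_component_in[OF assms] by auto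
  have f: "face_at (lift x) = face_at (lift y)" by (rule face_at_lift_eq[OF assms])
  have "lift x \<in> face_at (lift x) - {p}" "lift y \<in> face_at (lift x) - {p}"
    using face_at_self[OF lift_off[OF K(1)]] face_at_self[OF lift_off[OF K(2)]] f lift_in_sphere by auto
  then have "N (proj (lift x)) = N (proj (lift y))"
    using N_face_constant[OF face_at_in_faces[OF lift_off[OF K(1)]]] by blast
  then have "N x - N y = 0" by simp
  then show ?thesis using f even_int_of_int[of 0] by (simp add: agree_def col_def)
qed

text \<open>The odd jump also shows that the two sides belong to different faces, as
  \<open>N\<close> is constant on a face; only with this does properness give different
  colors.\<close>

lemma agree_across_edge:
  assumes e: "e \<in> edges M" "z \<in> proj ` e" and s: "sides z r S1 S2"
    and x: "x \<in> S1 \<inter> ball z r" and y: "y \<in> S2 \<inter> ball z r"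
  shows "agree x y"
proof -
  have xK: "x \<notin> K" and yK: "y \<notin> K" using sidesD(3)[OF s] x y by blast+
  define f where "f = face_at (lift x)"
  define g where "g = face_at (lift y)"
  have fg: "f \<in> faces M" "g \<in> faces M" unfolding f_def g_def using face_at_in_faces lift_off xK yK by blast+
  have xf: "x \<in> plane_face f" "y \<in> plane_face g"
    using face_at_self lift_off xK yK by (auto simp: plane_face_def f_def g_def)
  have zK: "z \<in> K \<inter> ball z r" using e edge_K sidesD(4)[OF s] by auto
  have "S1 \<inter> ball z r \<subseteq> plane_face f"
    using sidesD(1)[OF s, of S1] plane_face_connected[OF fg(1) xf(1)] x by blast
  then have "z \<in> closure (plane_face f)" using sidesD(2)[OF s, of S1] zK closure_mono by blast
  then have ef: "e \<subseteq> closure f" by (rule edge_subset_closure_face[OF fg(1) e])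
  have "S2 \<inter> ball z r \<subseteq> plane_face g"
    using sidesD(1)[OF s, of S2] plane_face_connected[OF fg(2) xf(2)] y by blast
  then have "z \<in> closure (plane_face g)" using sidesD(2)[OF s, of S2] zK closure_mono by blast
  then have eg: "e \<subseteq> closure g" by (rule edge_subset_closure_face[OF fg(2) e])
  have odd: "\<not> even_int (N x - N y)" by (rule sides_jump[OF s x y])
  have "f \<noteq> g"
  proof
    assume "f = g"
    then have "lift x \<in> f - {p}" "lift y \<in> f - {p}" using xf lift_in_sphere by (auto simp: plane_face_def)
    then have "N (proj (lift x)) = N (proj (lift y))" by (rule N_face_constant[OF fg(1)])
    then have "N x - N y = 0" by simp
    then show False using odd even_int_of_int[of 0] by simp
  qed
  then have "C f \<noteq> C g" using proper fg e(1) ef eg unfolding proper_coloring_def by blast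
  then show ?thesis using odd by (simp add: agree_def col_def f_def g_def)
qed

text \<open>The plane without the finitely many vertices is connected, so agreement spreads through
  faces and across interiors of edges without ever passing a vertex.\<close>

lemma agree_all:
  assumes "x \<notin> K" "y \<notin> K"
  shows "agree x y"
proof -
  let ?S = "- (proj ` verts M)"
  have fin: "finite (proj ` verts M)" using map_finite(1)[OF map] by simp
  have VK: "proj ` verts M \<subseteq> K" by (auto simp: support_def)
  have "2 \<le> DIM(complex)" by simp
  then have con: "connected ?S"
    by (rule path_connected_imp_connected[OF path_connected_complement_countable[OF _ countable_finite[OF fin]]])
  have edge: "\<exists>e\<in>edges M. w \<in> proj ` e" if "w \<in> K" "w \<in> ?S" for w
    using that by (auto simp: support_def)
  have opS: "open ?S" using finite_imp_closed[OF fin] by auto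
  \<comment> \<open>Agreement is meaningful only off \<open>K\<close>. The predicate
    \<open>P\<close> of the induction rule lets it cross points of edges, near which there are
    always points off \<open>K\<close>.\<close>
  show ?thesis
  proof (rule connected_induction[OF con, where P = "\<lambda>w. w \<notin> K" and Q = "agree x" and a = x and b = y])
    fix T a assume T: "openin (top_of_set ?S) T" "a \<in> T"
    have opT: "open T" "T \<subseteq> ?S" using T opS openin_open_eq by auto
    show "\<exists>w. w \<in> T \<and> w \<notin> K"
    proof (cases "a \<in> K")
      case True
      obtain e where e: "e \<in> edges M" "a \<in> proj ` e" using edge[OF True] T opT by blast
      obtain r S1 S2 where s: "sides a r S1 S2" using edge_sides[OF e] by blast
      have "a \<in> closure (S1 \<inter> ball a r)" using sidesD(2,4)[OF s, of S1] True by auto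
      then have "T \<inter> (S1 \<inter> ball a r) \<noteq> {}"
        using opT(1) T(2) open_Int_closure_eq_empty[of T "S1 \<inter> ball a r"] by blast
      then show ?thesis using sidesD(3)[OF s, of S1] by blast
    qed (use T in blast)
  next
    fix a assume a: "a \<in> ?S"
    have "\<exists>r>0. \<forall>w\<in>ball a r - K. \<forall>w'\<in>ball a r - K. agree w w'"
    proof (cases "a \<in> K")
      case True
      obtain e where e: "e \<in> edges M" "a \<in> proj ` e" using edge[OF True a] by blast
      obtain r S1 S2 where s: "sides a r S1 S2" using edge_sides[OF e] by blast
      have "agree w w'" if w: "w \<in> ball a r - K" "w' \<in> ball a r - K" for w w'
      proof -
        have "w \<in> S1 \<or> w \<in> S2" "w' \<in> S1 \<or> w' \<in> S2" using sides_cover[OF s] w by auto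
        then consider "w \<in> S1" "w' \<in> S1" | "w \<in> S2" "w' \<in> S2" | "w \<in> S1" "w' \<in> S2" | "w \<in> S2" "w' \<in> S1" by blast
        then show ?thesis
        proof cases
          case 1 then show ?thesis using sidesD(1)[OF s, of S1] w by (intro agree_same) auto
        next
          case 2 then show ?thesis using sidesD(1)[OF s, of S2] w by (intro agree_same) auto
        next
          case 3 then show ?thesis using agree_across_edge[OF e s] w by blast
        next
          case 4
          then have "agree w' w" using agree_across_edge[OF e s] w by blast
          then show ?thesis using agree_sym w by blast
        qed
      qed
      moreover have "0 < r" using s by (simp add: sides_def)
      ultimately show ?thesis by blast
    next
      case False
      obtain r where r: "0 < r" "ball a r \<inter> K = {}" using ex_ball_avoiding[OF K_closed False] by blast
      have "agree w w'" if "w \<in> ball a r - K" "w' \<in> ball a r - K" for w w'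
      proof (rule agree_same)
        show "connected_component (- K) w w'"
          unfolding connected_component_def using that r by (intro exI[of _ "ball a r"]) auto
      qed
      then show ?thesis using r(1) by blast
    qed
    then obtain r where r: "0 < r" "\<And>w w'. w \<in> ball a r - K \<Longrightarrow> w' \<in> ball a r - K \<Longrightarrow> agree w w'"
      by blast
    show "\<exists>T. openin (top_of_set ?S) T \<and> a \<in> T \<and> (\<forall>w\<in>T. \<forall>w'\<in>T. w \<notin> K \<and> w' \<notin> K \<and> agree x w \<longrightarrow> agree x w')"
    proof (intro exI[of _ "?S \<inter> ball a r"] conjI ballI impI)
      show "openin (top_of_set ?S) (?S \<inter> ball a r)" by (intro openin_open_Int) simp
      show "a \<in> ?S \<inter> ball a r" using a r by simp
      fix w w' assume w: "w \<in> ?S \<inter> ball a r" "w' \<in> ?S \<inter> ball a r" "w \<notin> K \<and> w' \<notin> K \<and> agree x w"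
      then have "agree w w'" using r(2) by blast
      then show "agree x w'" using agree_trans[of x w w'] assms(1) w by blast
    qed
  next
    show "agree x x" using assms(1) by (intro agree_same) (simp add: connected_component_refl)
  qed (use assms VK in auto)
qed

text \<open>The outside of a large disc lifts to a connected set off the map with limit point
  \<open>p\<close>; adding the limit point keeps it connected, so all of it lies in the face of
  \<open>p\<close>.\<close>

lemma face_at_far:
  assumes R: "\<And>w. w \<in> K \<Longrightarrow> cmod w < R" and z: "R < cmod z"
  shows "face_at (lift z) = face_at p"
proof -
  define D where "D = - cball (0::complex) R"
  have con: "connected (lift ` D)"
    unfolding D_def using continuous_on_subset[OF continuous_on_lift] connected_complement_bounded_convex[of "cball (0::complex) R"]
    by (intro connected_continuous_image) auto
  have "D \<inter> K = {}" using R by (force simp: D_def)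
  then have off: "lift ` D \<subseteq> sphere 0 1 - support M" using lift_off by blast
  have "p \<in> closure (lift ` D)"
    unfolding closure_approachable
  proof (intro allI impI)
    fix \<epsilon> :: real assume \<epsilon>: "0 < \<epsilon>"
    \<comment> \<open>The first bound puts the point into \<open>D\<close>. The second is due to the
      squared distance of its lift from \<open>p\<close>, which is \<open>4 / (t^2 + 1)\<close> and
      hence less than \<open>(2 / t)^2\<close>.\<close>
    define t where "t = max (\<bar>R\<bar> + 1) (2 / \<epsilon> + 1)"
    have t: "R < t" "0 < t" "2 / \<epsilon> < t" by (auto simp: t_def)
    have t2: "t\<^sup>2 + 1 > 0" by (simp add: add_nonneg_pos)
    define w where "w = complex_of_real t"
    have cw: "cmod w = t" using t by (simp add: w_def)
    have "(dist (lift w) p)\<^sup>2 = (lift w - p) \<bullet> (lift w - p)" by (simp add: dist_norm power2_norm_eq_inner)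
    also have "\<dots> = lift w \<bullet> lift w - 2 * (lift w \<bullet> p) + p \<bullet> p"
      by (simp add: inner_diff_left inner_diff_right inner_commute)
    also have "lift w \<bullet> lift w = 1" using lift_in_sphere[of w] by (simp add: dot_square_norm)
    also have "lift w \<bullet> p = (t\<^sup>2 - 1) / (t\<^sup>2 + 1)" using lift_inner(3)[of w] cw by simp
    also have "1 - 2 * ((t\<^sup>2 - 1) / (t\<^sup>2 + 1)) + p \<bullet> p = 4 / (t\<^sup>2 + 1)"
      using t2 by (simp add: unit field_simps)
    also have "\<dots> < 4 / t\<^sup>2" using t(2) t2 by (intro divide_strict_left_mono) auto
    also have "\<dots> = (2 / t)\<^sup>2" by (simp add: power_divide)
    finally have "dist (lift w) p < 2 / t" by (rule power2_less_imp_less) (use t in simp)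
    also have "2 / t < \<epsilon>" using t(2,3) \<epsilon> by (simp add: field_simps)
    finally have "dist (lift w) p < \<epsilon>" .
    moreover have "w \<in> D" using cw t by (simp add: D_def)
    ultimately show "\<exists>y\<in>lift ` D. dist y p < \<epsilon>" by blast
  qed
  then have "connected (insert p (lift ` D))"
    by (intro connected_intermediate_closure[OF con]) (auto intro: closure_subset[THEN subsetD])
  moreover have "insert p (lift ` D) \<subseteq> sphere 0 1 - support M" using off p_sphere p_off by blast
  moreover have "lift z \<in> lift ` D" using z by (simp add: D_def)
  ultimately have "connected_component (sphere 0 1 - support M) p (lift z)"
    unfolding connected_component_def by blast
  then show ?thesis unfolding face_at_def by (intro connected_component_eq) simp
qed

lemma color_antipode:
  "C (face_at (- p)) = C (face_at p) \<longleftrightarrow> even (card comps)"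
proof -
  obtain R where R: "0 < R" "\<And>w. w \<in> K \<Longrightarrow> cmod w < R" using K_bound by blast
  define z where "z = complex_of_real (R + 1)"
  have cz: "cmod z = R + 1" using R(1) by (simp add: z_def)
  have zK: "z \<notin> K" using R(2)[of z] cz by auto
  have Nz: "N z = 0" using R(2) cz by (intro N_far) force
  have lift0: "lift 0 = - p" by (simp add: lift_def)
  have "agree 0 z" by (rule agree_all[OF zero_notin_K zK])
  then have "col 0 = col z \<longleftrightarrow> even_int (N 0)" using Nz by (simp add: agree_def)
  moreover have "col 0 = C (face_at (- p))" by (simp add: col_def lift0)
  moreover have "col z = C (face_at p)"
    using face_at_far[OF R(2), of z] cz by (simp add: col_def)
  moreover obtain n :: int where n: "N 0 = of_int n" "even n \<longleftrightarrow> even (card comps)" using N_zero_parity by blast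
  ultimately show ?thesis using even_int_of_int[of n] by simp
qed

lemma antipode_face_at:
  assumes x: "x \<in> sphere 0 1 - support M"
  shows "antipode ` face_at x = face_at (- x)"
proof -
  have sub: "antipode ` face_at y \<subseteq> face_at (- y)" if y: "y \<in> sphere 0 1 - support M" for y
  proof -
    have "connected (antipode ` face_at y)"
      unfolding face_at_def antipode_def[abs_def]
      by (intro connected_continuous_image continuous_intros) simp
    moreover have "antipode ` face_at y \<subseteq> sphere 0 1 - support M"
    proof
      fix w assume "w \<in> antipode ` face_at y"
      then obtain w' where w': "w' \<in> face_at y" "w = - w'" by (auto simp: antipode_def)
      have "w' \<in> sphere 0 1 - support M"
        using w'(1) connected_component_subset unfolding face_at_def by blast
      then show "w \<in> sphere 0 1 - support M" using w'(2) support_uminus_iff[of w'] by simp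
    qed
    moreover have "- y \<in> antipode ` face_at y" using face_at_self[OF y] by (force simp: antipode_def)
    ultimately show ?thesis unfolding face_at_def by (intro connected_component_maximal)
  qed
  have x': "- x \<in> sphere 0 1 - support M" using x support_uminus_iff[of x] by simp
  have "antipode ` antipode ` face_at (- x) \<subseteq> antipode ` face_at (- (- x))" by (rule image_mono[OF sub[OF x']])
  then have "face_at (- x) \<subseteq> antipode ` face_at x" by simp
  then show ?thesis using sub[OF x] by blast
qed

end

text \<open>The point \<open>x\<close> itself becomes the centre of projection. Every face thus gets
  its own projection, while \<open>comps\<close> is defined without one.\<close>

lemma (in symmetric_map) color_antipode_at:
  assumes C: "proper_coloring M C" and x: "x \<in> sphere 0 1 - support M"
    and f: "f \<in> faces M" "x \<in> f"
  shows "C (antipode ` f) = C f \<longleftrightarrow> even (card comps)"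
proof -
  obtain u v where "stereo x u v" using ex_stereo x by blast
  then interpret stereo x u v .
  interpret colored_map M x u v C
    using x C by unfold_locales auto
  have "f = face_at x" using faces_eq_face_at[OF f] by simp
  then show ?thesis using color_antipode antipode_face_at[OF x] by simp
qed

lemma (in symmetric_map) color_preserving_iff:
  assumes C: "proper_coloring M C"
  shows "color_preserving M C \<longleftrightarrow> even (card comps)"
proof -
  have faceD: "\<exists>x. x \<in> sphere 0 1 - support M \<and> x \<in> f" if "f \<in> faces M" for f
    using that in_components_nonempty in_components_subset unfolding faces_def by blast
  \<comment> \<open>One face must be exhibited for the forward direction, since
    \<open>color_preserving\<close> would hold vacuously without faces.\<close>
  obtain p where p: "p \<in> sphere 0 1 - support M" using support_ne_sphere[OF map reg] by blast
  define f where "f = connected_component_set (sphere 0 1 - support M) p"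
  have f: "f \<in> faces M" "p \<in> f" using p by (auto simp: f_def faces_def components_def connected_component_refl)
  show ?thesis
  proof
    assume "color_preserving M C"
    then have "C (antipode ` f) = C f" using f(1) by (simp add: color_preserving_def)
    then show "even (card comps)" using color_antipode_at[OF C p f] by simp
  next
    assume ev: "even (card comps)"
    show "color_preserving M C"
      unfolding color_preserving_def
    proof
      fix g assume g: "g \<in> faces M"
      then obtain x where "x \<in> sphere 0 1 - support M" "x \<in> g" using faceD by blast
      then show "C (antipode ` g) = C g" using color_antipode_at[OF C _ g] ev by blast
    qed
  qed
qed

theorem lemma4:
  fixes G M :: sphere_map
    and chiE :: "(real^3) set \<Rightarrow> sign"
    and C :: "(real^3) set \<Rightarrow> color"
    and D :: link_diagram
  assumes "is_map G"
    and "medial_map G M"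
    and "medial_coloring G M C"
    and "antipodally_symmetric M"
    and "D = diagram_of M C (medial_signature G chiE)"
  shows "even (card (link_components D)) \<longleftrightarrow> color_preserving M C"
proof -
  interpret symmetric_map M
    using assms(2,4) by unfold_locales (auto simp: medial_map_def)
  have "link_components D = comps"
    using assms(5) by (simp add: link_components_def diagram_of_def comps_def)
  moreover have "proper_coloring M C" using assms(3) by (simp add: medial_coloring_def)
  ultimately show ?thesis using color_preserving_iff by simp
qed

end
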